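(* Let $q$ be a prime and let $k$ be a non-negative integer. For every $\epsilon>0$, \[ \sum_{\substack{\chi \bmod q\\ \chi\neq\chi_0}}\left|\frac{L'}{L}(1,\chi)\right|^{2k} =(q-2)\sum_{m\ge1}\frac{\Big(\sum_{m=m_1m_2\cdots m_k}\Lambda(m_1)\cdots\Lambda(m_k)\Big)^2}{m^2}+O_{\epsilon}\!\left(q^{9/10+\epsilon}\right), \] where the sum on the left runs over the non-principal (hence primitive) Dirichlet characters modulo $q$, the inner sum on the right runs over ordered $k$-tuples of positive integers $(m_1,\dots,m_k)$ with product $m$, and the implied constant depends on $\epsilon$ (and on the fixed $k$) but not on $q$.
   Context: $\Lambda$ is the von Mangoldt function. For a Dirichlet character $\chi$ modulo $q$, $L(s,\chi)$ is the Dirichlet $L$-function and $L'(s,\chi)$ its derivative in $s$; $\chi_0$ is the principal character modulo $q$. *)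

theory Defs
  imports
    "HOL-Complex_Analysis.Complex_Analysis"
    "HOL-Number_Theory.Number_Theory"
    "HOL-Number_Theory.Prime_Powers"
    "HOL-Real_Asymp.Real_Asymp"
begin

definition dirichlet_character :: "nat \<Rightarrow> (nat \<Rightarrow> complex) \<Rightarrow> bool" where
  "dirichlet_character q X \<longleftrightarrow>
     (\<forall>a b. X (a * b) = X a * X b) \<and>
     (\<forall>a. X (a + q) = X a) \<and>
     (\<forall>a. X a \<noteq> 0 \<longleftrightarrow> coprime a q)"

definition principal_character :: "nat \<Rightarrow> nat \<Rightarrow> complex" where
  "principal_character q a = (if coprime a q then 1 else 0)"

text \<open>
  The meromorphic continuation to \<open>\<complex>\<close> of the Dirichlet series of \<open>X\<close>. The predicate
  \<^const>\<open>nicely_meromorphic_on\<close> demands analyticity away from the poles and the value 0 at poles,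
  which makes the continuation unique as a function.
\<close>
definition dirichlet_L :: "(nat \<Rightarrow> complex) \<Rightarrow> complex \<Rightarrow> complex" where
  "dirichlet_L X = (THE f. f nicely_meromorphic_on UNIV \<and>
     (\<forall>s. Re s > 1 \<longrightarrow> f s = (\<Sum>n. X (Suc n) / of_nat (Suc n) powr s)))"

definition factorizations :: "nat \<Rightarrow> nat \<Rightarrow> nat list set" where
  "factorizations k m = {ms. length ms = k \<and> (\<forall>d\<in>set ms. d > 0) \<and> prod_list ms = m}"

definition mangoldt_conv :: "nat \<Rightarrow> nat \<Rightarrow> real" where
  "mangoldt_conv k m = (\<Sum>ms\<in>factorizations k m. \<Prod>d\<leftarrow>ms. mangoldt d)"


subsection \<open>Well-definedness\<close>

lemma dirichlet_character_mod:
  assumes "dirichlet_character q X"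
  shows   "X (a mod q) = X a"
proof -
  have "X (b + n * q) = X b" for b n
  proof (induction n)
    case (Suc n)
    have "X (b + Suc n * q) = X ((b + n * q) + q)"
      by (simp add: algebra_simps)
    also have "\<dots> = X b"
      using assms Suc by (simp add: dirichlet_character_def)
    finally show ?case .
  qed auto
  from this[of "a mod q" "a div q"] show ?thesis
    by (simp add: add.commute)
qed

lemma dirichlet_character_1:
  assumes "dirichlet_character q X"
  shows   "X 1 = 1"
proof -
  have "X (1 * 1) = X 1 * X 1" "X 1 \<noteq> 0"
    using assms unfolding dirichlet_character_def by (blast, simp)
  thus ?thesis by simp
qed

lemma dirichlet_character_power:
  assumes "dirichlet_character q X"
  shows   "X (a ^ n) = X a ^ n"
  using assms dirichlet_character_1[OF assms]
  by (induction n) (auto simp: dirichlet_character_def)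

lemma finite_dirichlet_characters:
  assumes "q > 0"
  shows   "finite {X. dirichlet_character q X}"
proof -
  define R where "R = insert 0 {z::complex. z ^ totient q = 1}"
  have "finite R"
    unfolding R_def using assms by (auto intro!: finite_roots_unity simp: Suc_le_eq)
  hence fin: "finite (PiE {..<q} (\<lambda>_. R))"
    by (intro finite_PiE) auto
  have "X a \<in> R" if X: "dirichlet_character q X" for X a
  proof (cases "coprime a q")
    case True
    hence "[a ^ totient q = 1] (mod q)"
      by (rule euler_theorem)
    hence "X (a ^ totient q) = X 1"
      using dirichlet_character_mod[OF X] unfolding cong_def by metis
    thus ?thesis
      using dirichlet_character_1[OF X] dirichlet_character_power[OF X] by (simp add: R_def)
  next
    case False
    thus ?thesis using X by (auto simp: dirichlet_character_def R_def)
  qed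
  hence "(\<lambda>X. restrict X {..<q}) ` {X. dirichlet_character q X} \<subseteq> PiE {..<q} (\<lambda>_. R)"
    by (intro image_subsetI) (simp add: restrict_PiE_iff)
  hence "finite ((\<lambda>X. restrict X {..<q}) ` {X. dirichlet_character q X})"
    using fin finite_subset by blast
  moreover have "inj_on (\<lambda>X. restrict X {..<q}) {X. dirichlet_character q X}"
  proof (rule inj_onI, clarify)
    fix X Y assume *: "dirichlet_character q X" "dirichlet_character q Y"
                      "restrict X {..<q} = restrict Y {..<q}"
    show "X = Y"
    proof
      fix a
      have "X (a mod q) = Y (a mod q)"
        using fun_cong[OF *(3), of "a mod q"] assms by simp
      thus "X a = Y a"
        using * by (simp add: dirichlet_character_mod)
    qed
  qed
  ultimately show ?thesis
    by (rule finite_imageD)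
qed

lemma sum_dirichlet_character_eq_0:
  assumes X: "dirichlet_character q X" and "X \<noteq> principal_character q" and q: "q > 0"
  shows   "(\<Sum>a<q. X a) = 0"
proof -
  obtain b where b: "X b \<noteq> principal_character q b"
    using assms by auto
  hence cop: "coprime b q" and Xb: "X b \<noteq> 1"
    using X by (auto simp: principal_character_def dirichlet_character_def split: if_splits)
  have "inj_on (\<lambda>a. (b * a) mod q) {..<q}"
  proof (rule inj_onI)
    fix x y assume *: "x \<in> {..<q}" "y \<in> {..<q}" "(b * x) mod q = (b * y) mod q"
    hence "[b * x = b * y] (mod q)" by (simp add: cong_def)
    hence "[x = y] (mod q)" using cop by (simp add: cong_mult_lcancel_nat)
    thus "x = y" using * by (simp add: cong_def)
  qed
  moreover from this have "(\<lambda>a. (b * a) mod q) ` {..<q} = {..<q}"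
    using q by (intro endo_inj_surj) auto
  ultimately have "bij_betw (\<lambda>a. (b * a) mod q) {..<q} {..<q}"
    by (simp add: bij_betw_def)
  hence "(\<Sum>a<q. X a) = (\<Sum>a<q. X ((b * a) mod q))"
    by (rule sum.reindex_bij_betw [symmetric])
  also have "\<dots> = (\<Sum>a<q. X b * X a)"
    using X by (intro sum.cong refl)
      (auto simp: dirichlet_character_mod[OF X], simp add: dirichlet_character_def)
  also have "\<dots> = X b * (\<Sum>a<q. X a)"
    by (simp add: sum_distrib_left)
  finally show ?thesis using Xb by simp
qed

text \<open>
  Iterated differences of \<open>x \<mapsto> x\<^sup>-\<^sup>s\<close>. Repeated summation by parts of the Dirichlet series
  against them continues it to the whole plane.
\<close>
fun powr_diff :: "nat \<Rightarrow> complex \<Rightarrow> real \<Rightarrow> complex" where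
  "powr_diff 0 s x = of_real x powr (-s)"
| "powr_diff (Suc k) s x = powr_diff k s x - powr_diff k s (x + 1)"

lemma powr_diff_has_vector_derivative:
  "x > 0 \<Longrightarrow> (powr_diff k s has_vector_derivative (-s * powr_diff k (s + 1) x)) (at x)"
proof (induction k arbitrary: x)
  case 0
  have "((\<lambda>z. z powr (-s)) has_field_derivative (-s * of_real x powr (-s - 1))) (at (of_real x))"
    using 0 by (auto intro!: derivative_eq_intros)
  hence "((\<lambda>x. of_real x powr (-s)) has_vector_derivative (-s * of_real x powr (-s - 1))) (at x)"
    by (rule has_vector_derivative_real_field)
  moreover have "powr_diff 0 s = (\<lambda>x. of_real x powr (-s))"
    by auto
  ultimately show ?case by (simp add: minus_diff_commute)
next
  case (Suc k)
  have "((\<lambda>x. powr_diff k s (x + 1)) has_vector_derivative (1 *\<^sub>R (-s * powr_diff k (s + 1) (x + 1)))) (at x)"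
    using vector_diff_chain_at[of "\<lambda>x. x + 1" 1 x "powr_diff k s" "-s * powr_diff k (s + 1) (x + 1)"]
      Suc.IH[of "x + 1"] Suc.prems
    by (auto simp: o_def has_vector_derivative_add_const intro!: derivative_eq_intros)
  hence "((\<lambda>x. powr_diff k s x - powr_diff k s (x + 1)) has_vector_derivative
           (-s * powr_diff k (s + 1) x - 1 *\<^sub>R (-s * powr_diff k (s + 1) (x + 1)))) (at x)"
    using Suc.IH[OF Suc.prems] by (rule has_vector_derivative_diff[rotated])
  moreover have "powr_diff (Suc k) s = (\<lambda>x. powr_diff k s x - powr_diff k s (x + 1))"
    by auto
  ultimately show ?case by (simp add: algebra_simps)
qed

lemma norm_powr_diff_le:
  assumes "x > 0" "Re s + real k \<ge> 0"
  shows   "norm (powr_diff k s x) \<le> norm (pochhammer s k) * x powr (-Re s - real k)"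
  using assms
proof (induction k arbitrary: s x)
  case 0
  thus ?case by (simp add: norm_powr_real_powr)
next
  case (Suc k)
  define B where "B = norm (pochhammer s (Suc k)) * x powr (-Re s - real (Suc k))"
  have bound: "norm (-s * powr_diff k (s + 1) y) \<le> B" if y: "y \<in> {x..x+1}" for y
  proof -
    have "norm (powr_diff k (s + 1) y) \<le> norm (pochhammer (s + 1) k) * y powr (-Re (s + 1) - real k)"
      using Suc.prems y by (intro Suc.IH) auto
    also have "\<dots> \<le> norm (pochhammer (s + 1) k) * x powr (-Re s - real (Suc k))"
    proof (intro mult_left_mono)
      have "y powr (-Re s - real (Suc k)) \<le> x powr (-Re s - real (Suc k))"
        using Suc.prems y by (intro powr_mono2') auto
      moreover have "-Re (s + 1) - real k = -Re s - real (Suc k)"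
        by simp
      ultimately show "y powr (-Re (s + 1) - real k) \<le> x powr (-Re s - real (Suc k))"
        by (simp only:)
    qed auto
    finally have "norm s * norm (powr_diff k (s + 1) y) \<le>
        norm s * (norm (pochhammer (s + 1) k) * x powr (-Re s - real (Suc k)))"
      by (intro mult_left_mono) auto
    thus ?thesis
      by (simp add: B_def pochhammer_rec norm_mult mult.assoc)
  qed
  have "norm (powr_diff k s x - powr_diff k s (x + 1)) \<le> B * norm (x - (x + 1))"
  proof (rule differentiable_bound[where S = "{x..x+1}"])
    show "(powr_diff k s has_derivative (\<lambda>t. t *\<^sub>R (-s * powr_diff k (s + 1) y))) (at y within {x..x+1})"
      if "y \<in> {x..x+1}" for y
      by (rule has_derivative_at_withinI,
          rule powr_diff_has_vector_derivative[unfolded has_vector_derivative_def])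
         (use that Suc.prems in auto)
    show "onorm (\<lambda>t. t *\<^sub>R (-s * powr_diff k (s + 1) y)) \<le> B" if "y \<in> {x..x+1}" for y
    proof (rule onorm_le)
      fix t :: real
      show "norm (t *\<^sub>R (-s * powr_diff k (s + 1) y)) \<le> B * norm t"
        using mult_right_mono[OF bound[OF that], of "\<bar>t\<bar>"] by (simp add: mult_ac)
    qed
  qed auto
  thus ?case by (simp add: B_def)
qed

lemma holomorphic_powr_diff: "x > 0 \<Longrightarrow> (\<lambda>s. powr_diff k s x) holomorphic_on A"
  by (induction k arbitrary: x) (auto intro!: holomorphic_intros)

lemma powr_diff_series:
  fixes f :: "nat \<Rightarrow> complex" and k :: nat
  assumes bdd: "\<And>n. norm (f n) \<le> B"
  defines "T \<equiv> (\<lambda>s. \<Sum>n. f (Suc n) * powr_diff k s (real (Suc n)))"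
  shows   "T holomorphic_on {s. Re s > 1 - real k}" (is ?thesis1)
    and   "Re s > 1 - real k \<Longrightarrow> summable (\<lambda>n. f (Suc n) * powr_diff k s (real (Suc n)))"
proof -
  have unif: "uniform_limit (cball s d) (\<lambda>N s. \<Sum>n<N. f (Suc n) * powr_diff k s (real (Suc n))) T sequentially"
    and summ: "summable (\<lambda>n. f (Suc n) * powr_diff k s (real (Suc n)))"
    if d: "d \<ge> 0" "Re s - d > 1 - real k" for s d
  proof -
    have "compact ((\<lambda>s. pochhammer s k) ` cball s d)"
      unfolding pochhammer_prod by (intro compact_continuous_image continuous_intros) auto
    then obtain P where P: "norm (pochhammer z k) \<le> P" if "z \<in> cball s d" for z
      by (metis bounded_iff compact_imp_bounded image_eqI)
    define M where "M = (\<lambda>n. B * (P * real (Suc n) powr (-(Re s - d + real k))))"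
    have "B \<ge> 0" using bdd[of 0] norm_ge_zero order_trans by blast
    have "P \<ge> 0" using P[of s] d by (smt (verit) centre_in_cball norm_ge_zero)
    have M: "norm (f (Suc n) * powr_diff k z (real (Suc n))) \<le> M n" if z: "z \<in> cball s d" for n z
    proof -
      have "\<bar>Re (s - z)\<bar> \<le> d"
        using z abs_Re_le_cmod[of "s - z"] by (auto simp: dist_norm)
      hence Re: "Re z \<ge> Re s - d" by auto
      have "norm (powr_diff k z (real (Suc n))) \<le> norm (pochhammer z k) * real (Suc n) powr (-Re z - real k)"
        using Re d by (intro norm_powr_diff_le) auto
      also have "\<dots> \<le> P * real (Suc n) powr (-(Re s - d + real k))"
        using Re P[OF z] \<open>P \<ge> 0\<close> by (intro mult_mono powr_mono) auto
      finally show ?thesis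
        unfolding norm_mult M_def using bdd \<open>B \<ge> 0\<close> by (intro mult_mono) auto
    qed
    have "summable (\<lambda>n. real n powr (-(Re s - d + real k)))"
      using d by (subst summable_real_powr_iff) auto
    hence "summable M"
      unfolding M_def by (intro summable_mult) (subst summable_Suc_iff)
    show "uniform_limit (cball s d) (\<lambda>N s. \<Sum>n<N. f (Suc n) * powr_diff k s (real (Suc n))) T sequentially"
      unfolding T_def by (rule Weierstrass_m_test[OF M \<open>summable M\<close>])
    show "summable (\<lambda>n. f (Suc n) * powr_diff k s (real (Suc n)))"
    proof (rule summable_comparison_test'[OF \<open>summable M\<close>])
      show "norm (f (Suc n) * powr_diff k s (real (Suc n))) \<le> M n" for n
        by (rule M) (use d in auto)
    qed
  qed
  show ?thesis1
  proof (rule holomorphic_uniform_sequence)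
    show "open {s. 1 - real k < Re s}"
      by (rule open_halfspace_Re_gt)
    show "(\<lambda>s. \<Sum>n<N. f (Suc n) * powr_diff k s (real (Suc n))) holomorphic_on {s. 1 - real k < Re s}" for N
      by (intro holomorphic_intros holomorphic_powr_diff) auto
    fix s assume s: "s \<in> {s. 1 - real k < Re s}"
    define d where "d = (Re s - (1 - real k)) / 2"
    have d: "d > 0" "Re s - d > 1 - real k"
      using s by (auto simp: d_def field_simps)
    have "cball s d \<subseteq> {s. 1 - real k < Re s}"
    proof
      fix z assume "z \<in> cball s d"
      hence "\<bar>Re (s - z)\<bar> \<le> d"
        using abs_Re_le_cmod[of "s - z"] by (auto simp: dist_norm)
      thus "z \<in> {s. 1 - real k < Re s}" using d by auto
    qed
    thus "\<exists>d>0. cball s d \<subseteq> {s. 1 - real k < Re s} \<and>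
            uniform_limit (cball s d) (\<lambda>N s. \<Sum>n<N. f (Suc n) * powr_diff k s (real (Suc n))) T sequentially"
      using unif[of d s] d by auto
  qed
  show "summable (\<lambda>n. f (Suc n) * powr_diff k s (real (Suc n)))" if "Re s > 1 - real k"
    using summ[of 0 s] that by simp
qed

definition zero_mean_periodic :: "nat \<Rightarrow> (nat \<Rightarrow> complex) \<Rightarrow> bool" where
  "zero_mean_periodic q f \<longleftrightarrow> (\<forall>n. f (n + q) = f n) \<and> (\<Sum>n<q. f n) = 0"

lemma periodic_bounded:
  fixes f :: "nat \<Rightarrow> complex"
  assumes "\<And>n. f (n + q) = f n" "q > 0"
  obtains B where "\<And>n. norm (f n) \<le> B"
proof -
  have *: "f (b + n * q) = f b" for b n
  proof (induction n)
    case (Suc n)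
    thus ?case using assms(1)[of "b + n * q"] by (simp add: algebra_simps)
  qed auto
  have "norm (f n) \<le> (\<Sum>a<q. norm (f a))" for n
  proof -
    have "f n = f (n mod q)"
      using *[of "n mod q" "n div q"] by (simp add: add.commute)
    moreover have "norm (f (n mod q)) \<le> (\<Sum>a<q. norm (f a))"
      using assms by (intro member_le_sum) auto
    ultimately show ?thesis by simp
  qed
  thus ?thesis using that by blast
qed

lemma powr_diff_summation_by_parts:
  assumes f: "zero_mean_periodic q f" and q: "q > 0"
  obtains g c where "zero_mean_periodic q g"
    "\<And>k s. Re s > 1 - real k \<Longrightarrow>
       (\<Sum>n. f (Suc n) * powr_diff k s (real (Suc n))) =
       c * powr_diff k s 1 + (\<Sum>n. g (Suc n) * powr_diff (Suc k) s (real (Suc n)))"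
proof -
  define F where "F = (\<lambda>n. \<Sum>m<n. f (Suc m))"
  define c where "c = (\<Sum>n<q. F n) / of_nat q"
  define g where "g = (\<lambda>n. F n - c)"
  have fper: "f (n + q) = f n" for n
    using f by (simp add: zero_mean_periodic_def)
  have block: "(\<Sum>m<q. f (n + m)) = 0" for n
  proof (induction n)
    case (Suc n)
    have "(\<Sum>m<q. f (Suc n + m)) = (\<Sum>m<q. f (n + Suc m))" by simp
    also have "\<dots> = (\<Sum>m<Suc q. f (n + m)) - f n"
      by (simp only: sum.lessThan_Suc_shift) simp
    also have "\<dots> = 0" using Suc fper[of n] by simp
    finally show ?case .
  qed (use f in \<open>simp add: zero_mean_periodic_def\<close>)
  have Fper: "F (n + q) = F n" for n
  proof -
    have "F (n + q) = F n + (\<Sum>m<q. f (Suc n + m))"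
      unfolding F_def by (induction q) (simp_all add: add_ac)
    thus ?thesis using block[of "Suc n"] by simp
  qed
  have g: "zero_mean_periodic q g"
    using q by (auto simp: zero_mean_periodic_def g_def Fper sum_subtractf c_def)
  obtain B where B: "\<And>n. norm (F n) \<le> B" using periodic_bounded[of F, OF Fper q] by blast
  obtain B' where B': "\<And>n. norm (g n) \<le> B'"
    using periodic_bounded[of g q] g q unfolding zero_mean_periodic_def by blast
  obtain B'' where B'': "\<And>n. norm (f n) \<le> B''"
    using periodic_bounded[of f, OF fper q] by blast
  have "(\<Sum>n. f (Suc n) * powr_diff k s (real (Suc n))) =
       c * powr_diff k s 1 + (\<Sum>n. g (Suc n) * powr_diff (Suc k) s (real (Suc n)))"
    if s: "Re s > 1 - real k" for k s
  proof -
    define h where "h = (\<lambda>n. powr_diff k s (real (Suc n)))"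
    have h_Suc: "powr_diff (Suc k) s (real (Suc n)) = h n - h (Suc n)" for n
      by (simp add: h_def add_ac)
    have "summable h"
      using powr_diff_series(2)[of "\<lambda>_. 1" 1 k s] s by (simp add: h_def)
    hence h0: "h \<longlonglongrightarrow> 0" by (rule summable_LIMSEQ_zero)
    have parts: "(\<Sum>n<M. f (Suc n) * h n) =
        F M * h M + c * (h 0 - h M) + (\<Sum>n<M. g (Suc n) * (h n - h (Suc n)))" for M
      by (induction M) (simp_all add: F_def g_def algebra_simps)
    have "(\<lambda>M. \<Sum>n<M. f (Suc n) * h n) \<longlonglongrightarrow> (\<Sum>n. f (Suc n) * h n)"
      using powr_diff_series(2)[of f B'' k s] B'' s unfolding h_def
      by (intro summable_LIMSEQ) auto
    moreover have "(\<lambda>M. F M * h M + c * (h 0 - h M) + (\<Sum>n<M. g (Suc n) * (h n - h (Suc n))))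
        \<longlonglongrightarrow> 0 + c * (h 0 - 0) + (\<Sum>n. g (Suc n) * (h n - h (Suc n)))"
    proof (intro tendsto_intros h0)
      show "(\<lambda>M. F M * h M) \<longlonglongrightarrow> 0"
        by (rule lim_null_mult_left_bounded[where B = B]) (use B h0 in auto)
      show "(\<lambda>M. \<Sum>n<M. g (Suc n) * (h n - h (Suc n))) \<longlonglongrightarrow> (\<Sum>n. g (Suc n) * (h n - h (Suc n)))"
        using powr_diff_series(2)[of g B' "Suc k" s] B' s unfolding h_Suc
        by (intro summable_LIMSEQ) auto
    qed
    ultimately have "(\<Sum>n. f (Suc n) * h n) = c * h 0 + (\<Sum>n. g (Suc n) * (h n - h (Suc n)))"
      unfolding parts using LIMSEQ_unique by fastforce
    thus ?thesis
      unfolding h_Suc by (simp add: h_def)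
  qed
  thus ?thesis using that g by blast
qed

lemma zero_mean_periodic_continuation:
  assumes "zero_mean_periodic q f" "q > 0"
  shows   "\<exists>G. G holomorphic_on {s. Re s > 1 - real k - real N} \<and>
             (\<forall>s. Re s > 1 - real k \<longrightarrow> G s = (\<Sum>n. f (Suc n) * powr_diff k s (real (Suc n))))"
  using assms(1)
proof (induction N arbitrary: f k)
  case 0
  then obtain B where "\<And>n. norm (f n) \<le> B"
    using periodic_bounded[of f q] assms(2) unfolding zero_mean_periodic_def by blast
  thus ?case
    using powr_diff_series(1)[of f B k] by auto
next
  case (Suc N)
  obtain g c where g: "zero_mean_periodic q g"
    "\<And>k s. Re s > 1 - real k \<Longrightarrow>
       (\<Sum>n. f (Suc n) * powr_diff k s (real (Suc n))) =
       c * powr_diff k s 1 + (\<Sum>n. g (Suc n) * powr_diff (Suc k) s (real (Suc n)))"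
    using powr_diff_summation_by_parts[OF Suc.prems assms(2)] by blast
  obtain G where G: "G holomorphic_on {s. Re s > 1 - real (Suc k) - real N}"
    "\<And>s. Re s > 1 - real (Suc k) \<Longrightarrow> G s = (\<Sum>n. g (Suc n) * powr_diff (Suc k) s (real (Suc n)))"
    using Suc.IH[OF g(1), of "Suc k"] by blast
  have "(\<lambda>s. c * powr_diff k s 1 + G s) holomorphic_on {s. Re s > 1 - real k - real (Suc N)}"
    using G(1) by (intro holomorphic_intros holomorphic_powr_diff) (auto simp: algebra_simps)
  moreover have "c * powr_diff k s 1 + G s = (\<Sum>n. f (Suc n) * powr_diff k s (real (Suc n)))"
    if "Re s > 1 - real k" for s
    using g(2)[of k s] G(2)[of s] that by simp
  ultimately show ?case by blast
qed

lemma dirichlet_series_entire_continuation: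
  assumes X: "dirichlet_character q X" "X \<noteq> principal_character q" and q: "q > 0"
  obtains G where "G holomorphic_on UNIV"
    "\<And>s. Re s > 1 \<Longrightarrow> G s = (\<Sum>n. X (Suc n) / of_nat (Suc n) powr s)"
proof -
  define D where "D = (\<lambda>s. \<Sum>n. X (Suc n) / of_nat (Suc n) powr s)"
  have D: "D s = (\<Sum>n. X (Suc n) * powr_diff 0 s (real (Suc n)))" for s
    unfolding D_def by (intro suminf_cong) (simp add: powr_minus field_simps)
  have "zero_mean_periodic q X"
    using sum_dirichlet_character_eq_0[OF X q] X(1)
    by (auto simp: zero_mean_periodic_def dirichlet_character_def)
  from zero_mean_periodic_continuation[OF this q, of 0]
  have "\<forall>N. \<exists>G. G holomorphic_on {s. Re s > 1 - real N} \<and> (\<forall>s. Re s > 1 \<longrightarrow> G s = D s)"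
    unfolding D by simp
  then obtain G where G: "\<And>N. G N holomorphic_on {s. Re s > 1 - real N}"
      "\<And>N s. Re s > 1 \<Longrightarrow> G N s = D s"
    by metis
  have mono: "G M s = G N s" if "Re s > 1 - real M" "M \<le> N" for M N s
  proof (rule analytic_continuation_open
      [where s = "{s. Re s > 1}" and s' = "{s. Re s > 1 - real M}" and f = "G M" and g = "G N"])
    show "{s. Re s > 1} \<noteq> {}" by (auto intro!: exI[of _ 2])
    show "connected {s. Re s > 1 - real M}"
      by (intro convex_connected convex_halfspace_Re_gt)
    show "G N holomorphic_on {s. Re s > 1 - real M}"
      by (rule holomorphic_on_subset[OF G(1)]) (use that in auto)
  qed (use G that in \<open>auto intro: open_halfspace_Re_gt\<close>)
  define H where "H = (\<lambda>s. G (nat \<lceil>2 - Re s\<rceil>) s)"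
  have H: "H s = G N s" if "Re s > 1 - real N" for N s
  proof -
    have "Re s > 1 - real (nat \<lceil>2 - Re s\<rceil>)" by linarith
    thus ?thesis
      unfolding H_def using that mono by (metis nle_le)
  qed
  have "H field_differentiable at s" for s
  proof -
    define N where "N = nat \<lceil>2 - Re s\<rceil>"
    have N: "Re s > 1 - real N" unfolding N_def by linarith
    have "H holomorphic_on {s. Re s > 1 - real N}"
      using G(1)[of N] by (rule holomorphic_transform) (use H in auto)
    thus ?thesis
      using N open_halfspace_Re_gt holomorphic_on_imp_differentiable_at by blast
  qed
  hence "H holomorphic_on UNIV"
    by (simp add: holomorphic_on_def)
  moreover have "H s = D s" if "Re s > 1" for s
    using H[of 0 s] G(2)[of s 0] that by simp
  ultimately show ?thesis
    using that unfolding D_def by blast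
qed

lemma nicely_meromorphic_unique:
  assumes f: "f nicely_meromorphic_on UNIV" and g: "g holomorphic_on UNIV"
    and eq: "\<And>s. Re s > 1 \<Longrightarrow> f s = g s"
  shows "f = g"
proof
  fix z
  have g': "g analytic_on UNIV" using g by (simp add: analytic_on_open)
  have "(\<lambda>z. f z - g z) meromorphic_on UNIV"
    using f g' analytic_on_imp_meromorphic_on[OF g']
    by (intro meromorphic_on_diff) (auto simp: nicely_meromorphic_on_def)
  hence "(\<forall>\<^sub>\<approx>z\<in>UNIV. f z - g z = 0) \<or> (\<forall>\<^sub>\<approx>z\<in>UNIV. f z - g z \<noteq> 0)"
    by (intro meromorphic_imp_constant_or_avoid) auto
  moreover have "\<not>(\<forall>\<^sub>\<approx>z\<in>UNIV. f z - g z \<noteq> 0)"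
  proof
    assume "\<forall>\<^sub>\<approx>z\<in>UNIV. f z - g z \<noteq> 0"
    hence "eventually (\<lambda>z. f z - g z \<noteq> 0) (at 2)"
      by (simp add: eventually_cosparse_open_eq)
    moreover have "eventually (\<lambda>z. z \<in> {s. Re s > 1}) (at 2)"
      by (intro eventually_at_in_open' open_halfspace_Re_gt) auto
    ultimately have "eventually (\<lambda>z::complex. False) (at 2)"
      by eventually_elim (use eq in auto)
    thus False by simp
  qed
  ultimately have "\<forall>\<^sub>\<approx>z\<in>UNIV. f z - g z = 0" by blast
  hence ev: "eventually (\<lambda>w. f w = g w) (at z)"
    by (simp add: eventually_cosparse_open_eq)
  have lim: "g \<midarrow>z\<rightarrow> g z"
    using g' analytic_at_imp_isCont analytic_on_analytic_at isContD by blast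
  hence "f \<midarrow>z\<rightarrow> g z"
    using tendsto_cong[OF ev] by blast
  moreover from this have "\<not>is_pole f z"
    unfolding is_pole_def using not_tendsto_and_filterlim_at_infinity[of "at z" f "g z"] by auto
  hence "f \<midarrow>z\<rightarrow> f z"
    using f by (auto simp: nicely_meromorphic_on_def)
  ultimately show "f z = g z"
    using LIM_unique by blast
qed

theorem dirichlet_L_nonprincipal:
  assumes "dirichlet_character q X" "X \<noteq> principal_character q" "q > 0"
  shows   "dirichlet_L X holomorphic_on UNIV"
    and   "Re s > 1 \<Longrightarrow> dirichlet_L X s = (\<Sum>n. X (Suc n) / of_nat (Suc n) powr s)"
proof -
  obtain G where G: "G holomorphic_on UNIV"
    "\<And>s. Re s > 1 \<Longrightarrow> G s = (\<Sum>n. X (Suc n) / of_nat (Suc n) powr s)"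
    using dirichlet_series_entire_continuation[OF assms] by blast
  have "dirichlet_L X = G"
    unfolding dirichlet_L_def
  proof (rule the_equality)
    show "G nicely_meromorphic_on UNIV \<and>
        (\<forall>s. Re s > 1 \<longrightarrow> G s = (\<Sum>n. X (Suc n) / of_nat (Suc n) powr s))"
      using G by (auto intro!: analytic_on_imp_nicely_meromorphic_on simp: analytic_on_open)
  next
    fix f assume "f nicely_meromorphic_on UNIV \<and>
        (\<forall>s. Re s > 1 \<longrightarrow> f s = (\<Sum>n. X (Suc n) / of_nat (Suc n) powr s))"
    thus "f = G"
      using G by (intro nicely_meromorphic_unique) auto
  qed
  thus "dirichlet_L X holomorphic_on UNIV"
    and "Re s > 1 \<Longrightarrow> dirichlet_L X s = (\<Sum>n. X (Suc n) / of_nat (Suc n) powr s)"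
    using G by auto
qed

lemma finite_factorizations: "m > 0 \<Longrightarrow> finite (factorizations k m)"
proof (rule finite_subset)
  assume m: "m > 0"
  show "factorizations k m \<subseteq> {ms. set ms \<subseteq> {..m} \<and> length ms = k}"
  proof (clarsimp simp: factorizations_def)
    fix ms :: "nat list" and d
    assume "d \<in> set ms" "m = prod_list ms"
    thus "d \<le> prod_list ms"
      using m by (auto simp: in_set_conv_decomp)
  qed
qed (auto intro: finite_lists_length_eq)

lemma mangoldt_conv_Suc:
  assumes "m > 0"
  shows   "mangoldt_conv (Suc k) m = (\<Sum>d | d dvd m. mangoldt d * mangoldt_conv k (m div d))"
proof -
  have eq: "factorizations (Suc k) m =
      (\<lambda>(d, ms). d # ms) ` (SIGMA d:{d. d dvd m}. factorizations k (m div d))"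
    (is "?A = ?B")
  proof (intro equalityI subsetI)
    fix ms assume "ms \<in> ?A"
    thus "ms \<in> ?B"
      by (cases ms) (force simp: factorizations_def image_iff)+
  next
    fix ms assume "ms \<in> ?B"
    thus "ms \<in> ?A"
      using assms by (auto simp: factorizations_def intro!: Nat.gr0I)
  qed
  have "mangoldt_conv (Suc k) m =
      (\<Sum>(d, ms)\<in>(SIGMA d:{d. d dvd m}. factorizations k (m div d)). mangoldt d * (\<Prod>d\<leftarrow>ms. mangoldt d))"
    unfolding mangoldt_conv_def eq
    by (subst sum.reindex) (auto simp: inj_on_def case_prod_unfold)
  also have "\<dots> = (\<Sum>d | d dvd m. \<Sum>ms\<in>factorizations k (m div d). mangoldt d * (\<Prod>d\<leftarrow>ms. mangoldt d))"
    using assms by (subst sum.Sigma) (auto intro!: finite_factorizations simp: dvd_div_eq_0_iff intro: Nat.gr0I)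
  finally show ?thesis
    by (simp add: mangoldt_conv_def sum_distrib_left)
qed

lemma mangoldt_conv_bounds:
  assumes "m > 0"
  shows   "mangoldt_conv k m \<ge> 0 \<and> mangoldt_conv k m \<le> ln (real m) ^ k"
  using assms
proof (induction k arbitrary: m)
  case 0
  have "factorizations 0 m = (if m = 1 then {[]} else {})"
    by (auto simp: factorizations_def)
  thus ?case by (simp add: mangoldt_conv_def)
next
  case (Suc k)
  have pos: "m div d > 0" if "d dvd m" for d
    using that Suc.prems by (auto elim!: dvdE)
  have "mangoldt_conv (Suc k) m \<le> (\<Sum>d | d dvd m. mangoldt d * ln (real m) ^ k)"
    unfolding mangoldt_conv_Suc[OF Suc.prems]
  proof (intro sum_mono mult_left_mono mangoldt_nonneg)
    fix d assume "d \<in> {d. d dvd m}"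
    hence d: "m div d > 0" using pos by auto
    have "mangoldt_conv k (m div d) \<le> ln (real (m div d)) ^ k"
      using Suc.IH[OF d] by blast
    also have "\<dots> \<le> ln (real m) ^ k"
      using d Suc.prems by (intro power_mono) (auto simp: div_le_dividend intro!: ln_ge_zero)
    finally show "mangoldt_conv k (m div d) \<le> ln (real m) ^ k" .
  qed
  also have "\<dots> = ln (real m) ^ Suc k"
    using Suc.prems mangoldt_sum[of m, where ?'a = real]
    by (simp add: sum_distrib_right [symmetric])
  finally show ?case
    using Suc.IH pos unfolding mangoldt_conv_Suc[OF Suc.prems]
    by (auto intro!: sum_nonneg mult_nonneg_nonneg mangoldt_nonneg)
qed

lemma mangoldt_conv_summable:
  "(\<lambda>m. (mangoldt_conv k m)\<^sup>2 / real m ^ 2) summable_on {1..}"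
proof -
  have "(\<lambda>m. ln (real m) ^ (2 * k) / real m ^ 2) \<in> O(\<lambda>m. real m powr (-3/2))"
    by real_asymp
  hence "summable (\<lambda>m. ln (real m) ^ (2 * k) / real m ^ 2)"
    by (rule summable_comparison_test_bigo[rotated])
       (auto simp: summable_real_powr_iff)
  hence "summable (\<lambda>m. if m \<in> {1..} then (mangoldt_conv k m)\<^sup>2 / real m ^ 2 else 0)"
  proof (rule summable_comparison_test'[where N = 1])
    fix m :: nat assume m: "m \<ge> 1"
    have "(mangoldt_conv k m)\<^sup>2 \<le> (ln (real m) ^ k)\<^sup>2"
      using mangoldt_conv_bounds[of m k] m by (intro power_mono) auto
    thus "norm (if m \<in> {1..} then (mangoldt_conv k m)\<^sup>2 / real m ^ 2 else 0) \<le>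
            ln (real m) ^ (2 * k) / real m ^ 2"
      using m by (auto simp: power_mult [symmetric] mult.commute intro!: divide_right_mono)
  qed
  hence "(\<lambda>m. if m \<in> {1..} then (mangoldt_conv k m)\<^sup>2 / real m ^ 2 else 0) summable_on UNIV"
    by (subst summable_on_UNIV_nonneg_real_iff) auto
  thus ?thesis
    by (rule summable_on_cong_neutral[THEN iffD1, rotated -1]) auto
qed

end

theory Submission
  imports Defs
begin

text \<open>
  Put \<open>P(X) = \<Sum>\<^bsub>n \<le> q\<^esub> \<Lambda>(n) X(n) / n\<close>. Since \<open>\<Lambda> * 1 = log\<close>, the coefficients of \<open>L(1, X) P(X) + L'(1, X)\<close>
  vanish for \<open>n \<le> q\<close> and are at most \<open>log n\<close> in absolute value. The weights \<open>1 / n\<close> make the off-diagonal terms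
  in the mean square of a Dirichlet polynomial over all characters a power of \<open>log q\<close>, whatever power of \<open>q\<close> its
  length is. Hence \<open>L'/L(1, X)\<close> is \<open>-P(X)\<close> up to an error that is small in mean square, provided that \<open>L(1, X)\<close>
  is not small, and the moments of \<open>P(X)\<close> are the diagonal main term. If \<open>X\<^sup>2\<close> is not principal, then
  \<open>|L(1, X)|\<close> exceeds a power of \<open>1 / log q\<close> by the inequality \<open>3 + 4 cos t + cos 2t \<ge> 0\<close>; the one remaining
  character is handled by Siegel's theorem. The resulting error term is a power of \<open>log q\<close> times \<open>q\<^sup>1\<^sup>/\<^sup>2\<close>.
\<close>

subsection \<open>Dirichlet characters modulo a prime\<close>

text \<open>Length q suffices for P: its truncation leaves a diagonal of about the sum of (log n)^2
  / n^2 over n > q, that is 1 / q up to logarithms, against q - 1 characters. The moments involve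
  the first power of this error rather than its square, and passing from one to the other costs the
  factor q^(1/2). A mean value says nothing about a single character, and 1 / L(1, X) enters to the
  power 2 k. For one real character even |L(1, X)| >= c q^(-1/2) would be too weak as soon as k >=
  1, so an arbitrarily small power of q, chosen in terms of k, is required; hence Siegel's theorem
  and an ineffective constant. The 2 k-th moment of P is the mean square of P^k, whose coefficients
  agree with \<open>mangoldt_conv k\<close> up to q. Partial sums of length q^6 stand in for L and
  L' at 1: the trivial bound q for character sums then leaves an error of order 1 / q^2. All lower
  bounds for L rest on F' = -F K, with a Dirichlet series K whose coefficients have nonnegative real
  part, and on the limit 1 of F at infinity; this takes the place of complex logarithms and Euler
  products.\<close>

lemma dirichlet_character_mult: "dirichlet_character q X \<Longrightarrow> X (a * b) = X a * X b"
  by (simp add: dirichlet_character_def)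

lemma dirichlet_character_eq_0_iff: "dirichlet_character q X \<Longrightarrow> X a = 0 \<longleftrightarrow> \<not>coprime a q"
  by (auto simp: dirichlet_character_def)

lemma dirichlet_character_cong:
  assumes "dirichlet_character q X" "[a = b] (mod q)"
  shows   "X a = X b"
  using dirichlet_character_mod[OF assms(1), of a] dirichlet_character_mod[OF assms(1), of b] assms(2)
  by (simp add: cong_def)

lemma dirichlet_character_norm:
  assumes X: "dirichlet_character q X" and q: "q > 0"
  shows   "norm (X a) = (if coprime a q then 1 else 0)"
proof (cases "coprime a q")
  case True
  have "X (a ^ totient q) = X 1"
    by (rule dirichlet_character_cong[OF X]) (use True in \<open>rule euler_theorem\<close>)
  hence "norm (X a ^ totient q) = 1"
    unfolding dirichlet_character_1[OF X] dirichlet_character_power[OF X] by simp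
  hence "norm (X a) ^ totient q = 1"
    by (simp add: norm_power)
  moreover have "totient q > 0" using q by simp
  ultimately have "norm (X a) = 1"
    using power_eq_imp_eq_base[of "norm (X a)" "totient q" 1] by auto
  thus ?thesis using True by simp
qed (use X in \<open>auto simp: dirichlet_character_def\<close>)

lemma dirichlet_character_norm_le_1:
  "dirichlet_character q X \<Longrightarrow> q > 0 \<Longrightarrow> norm (X a) \<le> 1"
  using dirichlet_character_norm[of q X a] by simp

lemma dirichlet_character_principal: "dirichlet_character q (principal_character q)"
proof -
  have "coprime (a + q) q \<longleftrightarrow> coprime a q" for a
    by (metis coprime_iff_gcd_eq_1 gcd_add1)
  thus ?thesis by (simp add: dirichlet_character_def principal_character_def)
qed

lemma dirichlet_character_times:
  "dirichlet_character q X \<Longrightarrow> dirichlet_character q Y \<Longrightarrow> dirichlet_character q (\<lambda>n. X n * Y n)"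
  by (auto simp: dirichlet_character_def)

lemma dirichlet_character_cnj:
  "dirichlet_character q X \<Longrightarrow> dirichlet_character q (\<lambda>n. cnj (X n))"
  by (auto simp: dirichlet_character_def)

lemma dirichlet_character_times_cnj:
  assumes "dirichlet_character q X" "q > 0"
  shows   "X n * cnj (X n) = (if coprime n q then 1 else 0)"
  using dirichlet_character_norm[OF assms, of n] by (simp add: complex_norm_square [symmetric])

lemma residue_primroot_power_cong_exists:
  assumes q: "prime (q :: nat)" and g: "residue_primroot q g" and a: "coprime a q"
  shows   "\<exists>i. [g ^ i = a] (mod q)"
proof -
  have q1: "q > 1" and q0: "q \<noteq> 0" using q prime_gt_1_nat[of q] by auto
  have "coprime (a mod q) q" using a by (metis coprime_mod_left_iff q0)
  moreover from this have "a mod q \<noteq> 0" using q1 by (metis coprime_0_left_iff nat_dvd_1_iff_1 less_irrefl)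
  moreover have "a mod q < q" using q1 by simp
  ultimately have "a mod q \<in> totatives q" by (simp add: totatives_def)
  hence "a mod q \<in> (\<lambda>i. g ^ i mod q) ` {..<totient q}"
    unfolding bij_betw_imp_surj_on[OF residue_primroot_is_generator[OF q1 g]] .
  then obtain i where "a mod q = g ^ i mod q" by blast
  thus ?thesis unfolding cong_def by metis
qed

text \<open>The units form a cyclic group of order q - 1, so sending a generator \<open>g\<close> to
  a primitive (q - 1)-th root of unity gives a faithful character. What matters later is that it
  separates 1 from every other unit.\<close>

lemma generating_dirichlet_character_exists:
  assumes q: "prime (q :: nat)"
  obtains Y where "dirichlet_character q Y" "\<And>a. coprime a q \<Longrightarrow> Y a = 1 \<Longrightarrow> [a = 1] (mod q)"
proof -
  obtain g where g: "residue_primroot q g"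
    using prime_primitive_root_exists[of q] q prime_gt_1_nat by auto
  have q1: "q > 1" and q0: "q \<noteq> 0" using q prime_gt_1_nat[of q] by auto
  have cop: "coprime q g" and ord: "ord q g = q - 1"
    using g q by (auto simp: residue_primroot_def totient_prime)
  note ex = residue_primroot_power_cong_exists[OF q g]
  \<comment> \<open>The discrete logarithm is determined only modulo q - 1, so an arbitrary exponent
    may be chosen; \<open>w\<close> has exactly this period, which makes \<open>Y\<close>
    independent of the choice (\<open>w_ind\<close>).\<close>
  define ind where "ind = (\<lambda>a. SOME i. [g ^ i = a] (mod q))"
  have ind: "[g ^ ind a = a] (mod q)" if "coprime a q" for a
    unfolding ind_def by (rule someI_ex[OF ex[OF that]])
  define w where "w = (\<lambda>i::nat. cis (2 * pi * real i / real (q - 1)))"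
  have w_add: "w (i + j) = w i * w j" for i j
    by (simp add: w_def cis_mult add_divide_distrib ring_distribs)
  have w_eq: "w i = w j \<longleftrightarrow> [i = j] (mod (q - 1))" for i j
  proof -
    have "w i = exp (of_real (2 * pi * real i / real (q - 1)) * \<i>)" for i
      by (simp add: w_def cis_conv_exp mult.commute)
    moreover have "of_real (2 * pi * real i / real (q - 1)) * \<i> =
        2 * of_real pi * \<i> * of_nat i / of_nat (q - 1)" for i
      by simp
    ultimately have "w i = exp (2 * of_real pi * \<i> * of_nat i / of_nat (q - 1))" for i
      by (simp only:)
    thus ?thesis
      using complex_root_unity_eq[of "q - 1" i j] q1 by (simp add: cong_def)
  qed
  define Y where "Y = (\<lambda>a. if coprime a q then w (ind a) else 0)"
  have w_ind: "w (ind a) = w i" if "[g ^ i = a] (mod q)" "coprime a q" for a i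
  proof -
    have "[g ^ ind a = g ^ i] (mod q)"
      using ind[OF that(2)] that(1) cong_sym cong_trans by blast
    thus ?thesis
      using order_divides_expdiff[OF cop] ord w_eq by simp
  qed
  have "dirichlet_character q Y"
    unfolding dirichlet_character_def
  proof (intro conjI allI)
    fix a b
    show "Y (a * b) = Y a * Y b"
    proof (cases "coprime a q \<and> coprime b q")
      case True
      hence "[g ^ (ind a + ind b) = a * b] (mod q)"
        unfolding power_add by (intro cong_mult ind) auto
      thus ?thesis
        using True w_ind[of "ind a + ind b" "a * b"] by (simp add: Y_def w_add)
    qed (auto simp: Y_def)
    have cop_add: "coprime (a + q) q \<longleftrightarrow> coprime a q"
      by (metis coprime_iff_gcd_eq_1 gcd_add1)
    show "Y (a + q) = Y a"
    proof (cases "coprime a q")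
      case True
      have "[g ^ ind a = a + q] (mod q)"
        using ind[OF True] by (simp add: cong_def)
      thus ?thesis using True w_ind[of "ind a" "a + q"] by (simp add: Y_def cop_add)
    qed (simp add: Y_def cop_add)
    show "(Y a \<noteq> 0) = coprime a q"
      by (simp add: Y_def w_def)
  qed
  moreover have "[a = 1] (mod q)" if a: "coprime a q" "Y a = 1" for a
  proof -
    have "w (ind a) = w 0" using a by (simp add: Y_def w_def)
    hence "[g ^ ind a = g ^ 0] (mod q)"
      unfolding order_divides_expdiff[OF cop] ord using w_eq by blast
    thus ?thesis using ind[OF a(1)] cong_sym cong_trans by (metis power_0)
  qed
  ultimately show ?thesis using that by blast
qed

text \<open>Multiplication by a character \<open>Y\<close> with \<open>Y a\<close> different from 1
  permutes all characters, so the sum equals \<open>Y a\<close> times itself.\<close>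

lemma sum_dirichlet_characters_eq_0:
  assumes q: "prime (q :: nat)" and a: "coprime a q" "\<not>[a = 1] (mod q)"
  shows   "(\<Sum>X | dirichlet_character q X. X a) = 0"
proof -
  obtain Y where Y: "dirichlet_character q Y" "Y a \<noteq> 1"
    using generating_dirichlet_character_exists[OF q] a by metis
  have q0: "q > 0" using q prime_gt_0_nat by auto
  \<comment> \<open>The inverse permutation multiplies by \<open>cnj (Y n)\<close>. The product of
    \<open>Y n\<close> and its conjugate is 1 only at units, but \<open>X\<close> vanishes at all
    other arguments.\<close>
  have "bij_betw (\<lambda>X n. Y n * X n) {X. dirichlet_character q X} {X. dirichlet_character q X}"
  proof (rule bij_betwI[where g = "\<lambda>X n. cnj (Y n) * X n"])
    fix X assume "X \<in> {X. dirichlet_character q X}"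
    hence "dirichlet_character q X" by simp
    hence *: "Y n * cnj (Y n) * X n = X n" for n
      using dirichlet_character_times_cnj[OF Y(1) q0, of n] dirichlet_character_eq_0_iff[of q X n] by auto
    show "(\<lambda>n. cnj (Y n) * (Y n * X n)) = X" "(\<lambda>n. Y n * (cnj (Y n) * X n)) = X"
      using * by (simp_all add: fun_eq_iff mult_ac)
  qed (use Y dirichlet_character_times dirichlet_character_cnj in blast)+
  hence "(\<Sum>X | dirichlet_character q X. X a) = (\<Sum>X | dirichlet_character q X. Y a * X a)"
    by (rule sum.reindex_bij_betw [symmetric])
  also have "\<dots> = Y a * (\<Sum>X | dirichlet_character q X. X a)"
    by (simp add: sum_distrib_left)
  finally show ?thesis using Y(2) by simp
qed

text \<open>Double counting of the sum of \<open>X a\<close> over all residues and all characters: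
  summed over residues first, only the principal character contributes, namely q - 1; summed over
  characters first, only a = 1 contributes, namely their number.\<close>

lemma card_dirichlet_characters:
  assumes q: "prime (q :: nat)"
  shows   "card {X. dirichlet_character q X} = q - 1"
proof -
  have q0: "q > 0" and q1: "q > 1" using q prime_gt_1_nat[of q] by auto
  note fin = finite_dirichlet_characters[OF q0]
  have "(\<Sum>a<q. \<Sum>X | dirichlet_character q X. X a) = (\<Sum>X | dirichlet_character q X. \<Sum>a<q. X a)"
    by (rule sum.swap)
  also have "\<dots> = (\<Sum>X | dirichlet_character q X. if X = principal_character q then of_nat (q - 1) else 0)"
  proof (intro sum.cong refl)
    fix X assume "X \<in> {X. dirichlet_character q X}"
    moreover have "(\<Sum>a<q. principal_character q a) = of_nat (card {a\<in>{..<q}. coprime a q})"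
      unfolding principal_character_def by (subst sum.If_cases) (auto intro!: arg_cong[of _ _ card])
    moreover have "{a\<in>{..<q}. coprime a q} = {1..<q}"
    proof -
      have "coprime a q \<longleftrightarrow> a > 0" if "a < q" for a
      proof (cases "a = 0")
        case False
        hence "\<not>q dvd a" using that by (auto dest: dvd_imp_le)
        thus ?thesis using False q prime_imp_coprime coprime_commute by blast
      qed (use q1 in auto)
      thus ?thesis by auto
    qed
    ultimately show "(\<Sum>a<q. X a) = (if X = principal_character q then of_nat (q - 1) else 0)"
      using sum_dirichlet_character_eq_0[of q X] q0 by auto
  qed
  also have "\<dots> = of_nat (q - 1)"
    using fin dirichlet_character_principal by (subst sum.delta) auto
  also have "(\<Sum>a<q. \<Sum>X | dirichlet_character q X. X a) =
      (\<Sum>a<q. if a = 1 then of_nat (card {X. dirichlet_character q X}) else 0)"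
  proof (intro sum.cong refl)
    fix a assume a: "a \<in> {..<q}"
    show "(\<Sum>X | dirichlet_character q X. X a) =
      (if a = 1 then of_nat (card {X. dirichlet_character q X}) else 0)"
    proof (cases "a = 1")
      case True
      have "(\<Sum>X | dirichlet_character q X. X 1) = (\<Sum>X | dirichlet_character q X. 1)"
        by (intro sum.cong refl dirichlet_character_1[of q]) (simp only: mem_Collect_eq)
      thus ?thesis using True by simp
    next
      case False
      hence nc: "\<not>[a = 1] (mod q)" using a q1 by (simp add: cong_def)
      show ?thesis
      proof (cases "coprime a q")
        case True
        thus ?thesis using sum_dirichlet_characters_eq_0[OF q _ nc] False by simp
      next
        case nc: False
        hence "X a = 0" if "dirichlet_character q X" for X
          using dirichlet_character_eq_0_iff[OF that] by blast
        thus ?thesis using False by (simp add: sum.neutral)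
      qed
    qed
  qed
  also have "\<dots> = of_nat (card {X. dirichlet_character q X})"
    using q1 by (subst sum.delta) auto
  finally show ?thesis using of_nat_eq_iff by blast
qed

text \<open>For units, \<open>cnj (X n)\<close> is the value of \<open>X\<close> at an inverse n' of
  n, so the sum is one over \<open>X (m * n')\<close>, and m n' is 1 modulo q exactly when m and n
  are congruent.\<close>

lemma dirichlet_character_orthogonality:
  assumes q: "prime (q :: nat)"
  shows   "(\<Sum>X | dirichlet_character q X. X m * cnj (X n)) =
             (if coprime m q \<and> [m = n] (mod q) then of_nat (q - 1) else 0)"
proof (cases "coprime m q \<and> coprime n q")
  case False
  hence "X m * cnj (X n) = 0" if "dirichlet_character q X" for X
    using dirichlet_character_eq_0_iff[OF that] by auto
  moreover have "\<not>(coprime m q \<and> [m = n] (mod q))"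
    using False cong_imp_coprime by (metis coprime_commute cong_sym)
  ultimately have "(\<Sum>X | dirichlet_character q X. X m * cnj (X n)) = 0"
    by (intro sum.neutral) blast
  thus ?thesis using \<open>\<not>(coprime m q \<and> [m = n] (mod q))\<close> by (simp only: if_False)
next
  case True
  have q0: "q > 0" using q prime_gt_0_nat by auto
  obtain n' where n': "[n * n' = 1] (mod q)"
    using True cong_solve_coprime_nat[of n q] by auto
  have cn': "coprime n' q"
    using n' by (metis cong_imp_coprime cong_sym coprime_1_left coprime_mult_left_iff)
  have *: "X m * cnj (X n) = X (m * n')" if X: "dirichlet_character q X" for X
  proof -
    have "X n * X n' = X (n * n')"
      by (rule dirichlet_character_mult[OF X, symmetric])
    hence "X n * X n' = 1"
      unfolding dirichlet_character_cong[OF X n'] dirichlet_character_1[OF X] .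
    moreover have "X n * cnj (X n) = 1"
      using dirichlet_character_times_cnj[OF X q0, of n] True by simp
    ultimately have "cnj (X n) = X n'"
      by (metis mult.assoc mult.commute mult_1)
    thus ?thesis unfolding dirichlet_character_mult[OF X] by (rule arg_cong)
  qed
  have iff: "[m * n' = 1] (mod q) \<longleftrightarrow> [m = n] (mod q)"
  proof -
    have "[m * n' = 1] (mod q) \<longleftrightarrow> [m * n' = n * n'] (mod q)"
      using n' by (metis cong_sym cong_trans)
    also have "\<dots> \<longleftrightarrow> [m = n] (mod q)"
      using cn' by (simp add: cong_mult_rcancel_nat)
    finally show ?thesis .
  qed
  have sum1: "(\<Sum>X | dirichlet_character q X. X m * cnj (X n)) = (\<Sum>X | dirichlet_character q X. X (m * n'))"
    by (intro sum.cong refl *) (simp only: mem_Collect_eq)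
  have sum2: "(\<Sum>X | dirichlet_character q X. X (m * n')) = (if [m * n' = 1] (mod q) then of_nat (q - 1) else 0)"
  proof (cases "[m * n' = 1] (mod q)")
    case c: True
    have "(\<Sum>X | dirichlet_character q X. X (m * n')) = (\<Sum>X | dirichlet_character q X. 1)"
    proof (intro sum.cong refl)
      fix X assume "X \<in> {X. dirichlet_character q X}"
      hence X: "dirichlet_character q X" by simp
      show "X (m * n') = 1"
        using dirichlet_character_cong[OF X c] dirichlet_character_1[OF X] by (rule trans)
    qed
    thus ?thesis using c unfolding card_dirichlet_characters[OF q, symmetric] by simp
  next
    case False
    have "coprime (m * n') q" using True cn' by auto
    from sum_dirichlet_characters_eq_0[OF q this False] show ?thesis
      using False by (simp only: if_False)
  qed
  show ?thesis unfolding sum1 sum2 iff using True by simp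
qed

subsection \<open>Approximating L-functions by partial sums\<close>

text \<open>Full periods sum to 0; fewer than q terms of modulus at most 1 remain.\<close>

lemma norm_sum_dirichlet_character_le:
  assumes X: "dirichlet_character q X" "X \<noteq> principal_character q" and q: "q > 0"
  shows   "norm (\<Sum>i<n. X i) \<le> real q"
proof (induction n rule: less_induct)
  case (less n)
  show ?case
  proof (cases "n \<ge> q")
    case False
    have "norm (\<Sum>i<n. X i) \<le> (\<Sum>i<n. 1)"
      by (intro sum_norm_le dirichlet_character_norm_le_1[OF X(1) q])
    thus ?thesis using False by simp
  next
    case True
    have "(\<Sum>i<q + m. X i) = (\<Sum>i<m. X i)" for m
    proof (induction m)
      case 0
      thus ?case using sum_dirichlet_character_eq_0[OF X q] by simp
    next
      case (Suc m)
      have "X (q + m) = X m"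
        by (rule dirichlet_character_cong[OF X(1)]) (simp add: cong_def)
      thus ?case using Suc by simp
    qed
    from this[of "n - q"] have "(\<Sum>i<n. X i) = (\<Sum>i<n - q. X i)" using True by simp
    thus ?thesis using less[of "n - q"] True q by simp
  qed
qed

text \<open>Comparison with the telescoping differences of 2 / sqrt(n).\<close>

lemma sum_powr_three_halves_tail:
  assumes "N \<ge> 1"
  shows   "(\<lambda>n. if Suc n > N then real (Suc n) powr (-3/2) else 0) sums S \<Longrightarrow> S \<le> 2 / sqrt (real N)"
proof -
  assume sums: "(\<lambda>n. if Suc n > N then real (Suc n) powr (-3/2) else 0) sums S"
  have step: "real (Suc n) powr (-3/2) \<le> 2 / sqrt (real n) - 2 / sqrt (real (Suc n))" if n: "n \<ge> 1" for n
  proof -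
    define a b where "a = sqrt (real n)" and "b = sqrt (real (Suc n))"
    have ab: "a > 0" "b > 0" "a \<le> b" "b ^ 2 = a ^ 2 + 1"
      using n by (auto simp: a_def b_def)
    have "real (Suc n) powr (-3/2) = 1 / b ^ 3"
    proof -
      have "real (Suc n) powr (-3/2) = (real (Suc n) powr (1/2)) powr (-3)"
        by (simp add: powr_powr)
      also have "\<dots> = b powr (-3)"
        by (simp add: b_def powr_half_sqrt)
      also have "\<dots> = 1 / b ^ 3"
        using ab(2) by (simp add: powr_minus powr_numeral field_simps)
      finally show ?thesis .
    qed
    also have "\<dots> \<le> 2 * (b - a) / (a * b)"
    proof -
      have "(b - a) * (b + a) = 1" using ab(4) by (simp add: algebra_simps power2_eq_square)
      hence "b - a = 1 / (b + a)" using ab by (simp add: field_simps)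
      also have "\<dots> \<ge> 1 / (2 * b)"
        using ab by (intro divide_left_mono) auto
      finally have "2 * (b - a) \<ge> 1 / b" by (simp add: field_simps)
      hence "2 * (b - a) / (a * b) \<ge> (1 / b) / (b * b)"
        using ab by (intro frac_le mult_mono) auto
      thus ?thesis by (simp add: power3_eq_cube)
    qed
    also have "\<dots> = 2 / a - 2 / b" using ab by (simp add: field_simps)
    finally show ?thesis by (simp add: a_def b_def)
  qed
  \<comment> \<open>The surplus 2 / sqrt(M) is kept in the claim so that the induction telescopes;
    for M <= N both sides are 0.\<close>
  have partial: "(\<Sum>n<M. if Suc n > N then real (Suc n) powr (-3/2) else 0) \<le>
      2 / sqrt (real N) - (if M > N then 2 / sqrt (real M) else 2 / sqrt (real N))" for M
  proof (induction M)
    case (Suc M)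
    consider "M < N" | "M = N" | "M > N" by linarith
    thus ?case using Suc step[of M] assms by cases auto
  qed auto
  have "(\<Sum>n<M. if Suc n > N then real (Suc n) powr (-3/2) else 0) \<le> 2 / sqrt (real N)" for M
  proof -
    have "(if M > N then 2 / sqrt (real M) else 2 / sqrt (real N)) \<ge> 0" by simp
    thus ?thesis using partial[of M] by linarith
  qed
  moreover have "(\<lambda>M. \<Sum>n<M. if Suc n > N then real (Suc n) powr (-3/2) else 0) \<longlonglongrightarrow> S"
    using sums by (simp add: sums_def)
  ultimately show "S \<le> 2 / sqrt (real N)"
    by (intro LIMSEQ_le_const2) auto
qed

text \<open>Summation by parts of the tail n > N: partial sums of \<open>X\<close> are at most 2 q
  and the differences of n^(-s) are at most |s| n^(-3/2). The summed tail converges for Re s > 0; it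
  is identified with the difference first for Re s > 1 and then by analytic continuation.\<close>

lemma dirichlet_L_minus_partial_sum_le:
  assumes X: "dirichlet_character q X" "X \<noteq> principal_character q" and q: "q > 0"
    and s: "Re s \<ge> 1/2" and N: "N \<ge> 1"
  shows   "norm (dirichlet_L X s - (\<Sum>n=1..N. X n * of_nat n powr (-s))) \<le> 4 * real q * norm s / sqrt (real N)"
proof -
  \<comment> \<open>Partial sums that start afresh after N and are 0 before. The series
    \<open>T\<close> over all n is then just the tail, and \<open>powr_diff_series\<close> applies
    to it unchanged.\<close>
  define A where "A = (\<lambda>n. if n > N then (\<Sum>i=Suc N..n. X i) else 0)"
  have A_le: "norm (A n) \<le> 2 * real q" for n
  proof (cases "n > N")
    case True
    have eq: "{..<Suc n} = {..<Suc N} \<union> {Suc N..n}" using True by auto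
    have "(\<Sum>i<Suc n. X i) = (\<Sum>i<Suc N. X i) + (\<Sum>i=Suc N..n. X i)"
      unfolding eq by (rule sum.union_disjoint) auto
    hence "A n = (\<Sum>i<Suc n. X i) - (\<Sum>i<Suc N. X i)" using True by (simp add: A_def)
    also have "norm \<dots> \<le> norm (\<Sum>i<Suc n. X i) + norm (\<Sum>i<Suc N. X i)"
      by (rule norm_triangle_ineq4)
    also have "\<dots> \<le> real q + real q"
      by (intro add_mono norm_sum_dirichlet_character_le[OF X q])
    finally show ?thesis by simp
  qed (simp add: A_def)
  define T where "T = (\<lambda>s. \<Sum>n. A (Suc n) * powr_diff 1 s (real (Suc n)))"
  have T_holo: "T holomorphic_on {s. Re s > 0}"
    using powr_diff_series(1)[of A "2 * real q" 1] A_le by (simp add: T_def)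
  have T_sums: "(\<lambda>n. A (Suc n) * powr_diff 1 s (real (Suc n))) sums T s" if "Re s > 0" for s
    using powr_diff_series(2)[of A "2 * real q" 1 s] A_le that unfolding T_def by (intro summable_sums) simp
  define P where "P = (\<lambda>s. \<Sum>n=1..N. X n * of_nat n powr (-s))"
  have eq1: "dirichlet_L X s = P s + T s" if s: "Re s > 1" for s
  proof -
    define h where "h = (\<lambda>n. of_nat n powr (-s) :: complex)"
    have h_eq: "powr_diff 1 s (real n) = h n - h (Suc n)" for n
      by (simp add: h_def add_ac)
    have "summable (\<lambda>n. h (Suc n))"
      using powr_diff_series(2)[of "\<lambda>_. 1" 1 0 s] s by (simp add: h_def)
    hence h0: "(\<lambda>n. h (Suc n)) \<longlonglongrightarrow> 0" by (rule summable_LIMSEQ_zero)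
    have parts: "(\<Sum>n<M. X (Suc n) * h (Suc n)) =
        (\<Sum>n\<in>{1..min M N}. X n * h n) + A M * h (Suc M) + (\<Sum>n<M. A (Suc n) * (h (Suc n) - h (Suc (Suc n))))" for M
    proof (induction M)
      case 0
      thus ?case by (simp add: A_def)
    next
      case (Suc M)
      show ?case
      proof (cases "M \<ge> N")
        case False
        thus ?thesis using Suc by (simp add: A_def min_def algebra_simps)
      next
        case True
        have "A (Suc M) = A M + X (Suc M)"
          using True by (cases "M = N") (auto simp: A_def)
        thus ?thesis using Suc True by (simp add: min_absorb2 algebra_simps)
      qed
    qed
    have lim1: "(\<lambda>M. \<Sum>n<M. X (Suc n) * h (Suc n)) \<longlonglongrightarrow> dirichlet_L X s"
    proof -
      have "summable (\<lambda>n. X (Suc n) * powr_diff 0 s (real (Suc n)))"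
        by (rule powr_diff_series(2)[of X 1 0 s]) (use s dirichlet_character_norm_le_1[OF X(1) q] in auto)
      hence "summable (\<lambda>n. X (Suc n) * h (Suc n))"
        by (simp add: h_def)
      moreover have "dirichlet_L X s = (\<Sum>n. X (Suc n) * h (Suc n))"
        using dirichlet_L_nonprincipal(2)[OF X q s] by (simp add: h_def powr_minus divide_inverse)
      ultimately show ?thesis by (simp add: summable_LIMSEQ)
    qed
    have lim2: "(\<lambda>M. (\<Sum>n\<in>{1..min M N}. X n * h n) + A M * h (Suc M) +
        (\<Sum>n<M. A (Suc n) * (h (Suc n) - h (Suc (Suc n))))) \<longlonglongrightarrow> P s + 0 + T s"
    proof (intro tendsto_add)
      have "eventually (\<lambda>M. (\<Sum>n\<in>{1..min M N}. X n * h n) = P s) sequentially"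
        using eventually_ge_at_top[of N] by eventually_elim (simp add: P_def h_def)
      thus "(\<lambda>M. \<Sum>n\<in>{1..min M N}. X n * h n) \<longlonglongrightarrow> P s"
        by (rule tendsto_eventually)
      show "(\<lambda>M. A M * h (Suc M)) \<longlonglongrightarrow> 0"
        by (rule lim_null_mult_left_bounded[where B = "2 * real q"]) (use A_le h0 in auto)
      show "(\<lambda>M. \<Sum>n<M. A (Suc n) * (h (Suc n) - h (Suc (Suc n)))) \<longlonglongrightarrow> T s"
        using T_sums[of s] s unfolding sums_def h_eq by simp
    qed
    from LIMSEQ_unique[OF lim1[unfolded parts] lim2] show ?thesis by simp
  qed
  have eq: "dirichlet_L X s = P s + T s" if s: "Re s > 0" for s
  proof (rule analytic_continuation_open
      [where s = "{s. Re s > 1}" and s' = "{s. Re s > 0}" and f = "dirichlet_L X" and g = "\<lambda>s. P s + T s"])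
    show "{s. Re s > 1} \<noteq> {}" by (auto intro!: exI[of _ 2])
    show "connected {s. Re s > 0}"
      by (intro convex_connected convex_halfspace_Re_gt)
    show "dirichlet_L X holomorphic_on {s. Re s > 0}"
      by (rule holomorphic_on_subset[OF dirichlet_L_nonprincipal(1)[OF X q]]) auto
    show "(\<lambda>s. P s + T s) holomorphic_on {s. Re s > 0}"
      unfolding P_def by (intro holomorphic_intros T_holo) auto
  qed (use s eq1 in \<open>auto intro: open_halfspace_Re_gt\<close>)
  define g where "g = (\<lambda>n. if Suc n > N then real (Suc n) powr (-3/2) else 0)"
  have bound: "norm (A (Suc n) * powr_diff 1 s (real (Suc n))) \<le> 2 * real q * norm s * g n" for n
  proof (cases "Suc n > N")
    case True
    have "norm (powr_diff 1 s (real (Suc n))) \<le> norm (pochhammer s 1) * real (Suc n) powr (-Re s - real 1)"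
      using s by (intro norm_powr_diff_le) auto
    also have "\<dots> \<le> norm s * real (Suc n) powr (-3/2)"
      using s by (intro mult_mono powr_mono) auto
    finally have "norm (A (Suc n)) * norm (powr_diff 1 s (real (Suc n))) \<le>
        (2 * real q) * (norm s * real (Suc n) powr (-3/2))"
      using A_le by (intro mult_mono) auto
    thus ?thesis using True by (simp add: g_def norm_mult mult_ac)
  qed (simp add: A_def g_def)
  have "summable (\<lambda>n. real (Suc n) powr (-3/2))"
    by (subst summable_Suc_iff) (simp add: summable_real_powr_iff)
  hence "summable g"
    by (rule summable_comparison_test'[where N = 0]) (auto simp: g_def)
  hence g_sums: "g sums suminf g" by (rule summable_sums)
  have "norm (T s) \<le> (\<Sum>n. 2 * real q * norm s * g n)"
    unfolding T_def by (rule norm_suminf_le[OF bound]) (use \<open>summable g\<close> in \<open>rule summable_mult\<close>)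
  also have "\<dots> = 2 * real q * norm s * suminf g"
    using \<open>summable g\<close> by (rule suminf_mult)
  also have "\<dots> \<le> 2 * real q * norm s * (2 / sqrt (real N))"
    using sum_powr_three_halves_tail[OF N, of "suminf g"] g_sums unfolding g_def
    by (intro mult_left_mono) auto
  finally show ?thesis
    using eq[of s] s by (simp add: P_def)
qed

lemma norm_of_nat_powr: "norm (of_nat n powr (s :: complex)) = real n powr Re s"
  by (cases "n = 0") (simp_all add: norm_powr_real_powr)

lemma of_nat_powr_minus_has_field_derivative:
  assumes "n > 0"
  shows   "((\<lambda>s. of_nat n powr (-s)) has_field_derivative
              -(of_real (ln (real n)) * of_nat n powr (-s))) (at (s :: complex))"
proof -
  have eq: "of_nat n powr (-s) = exp (-s * of_real (ln (real n)))" for s :: complex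
    using assms by (simp add: powr_def Ln_of_nat)
  show ?thesis
    unfolding eq by (auto intro!: derivative_eq_intros)
qed

text \<open>Cauchy's inequality for the remainder on the circle of radius 1/2 about
  \<open>s\<close>, which stays in Re z >= 1/2, where
  \<open>dirichlet_L_minus_partial_sum_le\<close> holds. The radius doubles the constant, and |z| <=
  |s| + 1 there.\<close>

lemma deriv_dirichlet_L_minus_partial_sum_le:
  assumes X: "dirichlet_character q X" "X \<noteq> principal_character q" and q: "q > 0"
    and s: "Re s \<ge> 1" and N: "N \<ge> 1"
  shows   "norm (deriv (dirichlet_L X) s + (\<Sum>n=1..N. X n * of_real (ln (real n)) * of_nat n powr (-s)))
             \<le> 8 * real q * (norm s + 1) / sqrt (real N)"
proof -
  define P where "P = (\<lambda>s. \<Sum>n=1..N. X n * of_nat n powr (-s))"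
  define R where "R = (\<lambda>s. dirichlet_L X s - P s)"
  have L_holo: "dirichlet_L X holomorphic_on A" for A
    by (rule holomorphic_on_subset[OF dirichlet_L_nonprincipal(1)[OF X q]]) auto
  have R_holo: "R holomorphic_on A" for A
    unfolding R_def P_def by (intro holomorphic_intros L_holo)
  have P_deriv: "(P has_field_derivative -(\<Sum>n=1..N. X n * of_real (ln (real n)) * of_nat n powr (-s))) (at s)"
    unfolding P_def sum_negf [symmetric]
  proof (intro DERIV_sum)
    fix n assume "n \<in> {1..N}"
    hence "n > 0" by simp
    from DERIV_cmult[OF of_nat_powr_minus_has_field_derivative[OF this], of "X n" s]
    show "((\<lambda>s. X n * of_nat n powr (-s)) has_field_derivative
            -(X n * of_real (ln (real n)) * of_nat n powr (-s))) (at s)"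
      by (simp add: mult.assoc)
  qed
  have "(dirichlet_L X has_field_derivative deriv (dirichlet_L X) s) (at s)"
    by (rule holomorphic_derivI[OF L_holo[of UNIV]]) auto
  from DERIV_diff[OF this P_deriv]
  have "deriv R s = deriv (dirichlet_L X) s + (\<Sum>n=1..N. X n * of_real (ln (real n)) * of_nat n powr (-s))"
    unfolding R_def by (intro DERIV_imp_deriv) simp
  moreover have "norm ((deriv ^^ 1) R s) \<le> fact 1 * (4 * real q * (norm s + 1) / sqrt (real N)) / (1/2) ^ 1"
  proof (rule Cauchy_inequality)
    show "continuous_on (cball s (1/2)) R"
      using R_holo holomorphic_on_imp_continuous_on by blast
    fix z assume z: "norm (s - z) = 1/2"
    have "Re (s - z) \<le> 1/2" using complex_Re_le_cmod[of "s - z"] z by linarith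
    hence "Re z \<ge> 1/2" using s by simp
    hence "norm (R z) \<le> 4 * real q * norm z / sqrt (real N)"
      unfolding R_def P_def using dirichlet_L_minus_partial_sum_le[OF X q _ N, of z] by blast
    also have "norm z \<le> norm s + 1"
      using norm_triangle_ineq4[of s "s - z"] z by simp
    hence "4 * real q * norm z / sqrt (real N) \<le> 4 * real q * (norm s + 1) / sqrt (real N)"
      by (intro divide_right_mono mult_left_mono) auto
    finally show "norm (R z) \<le> 4 * real q * (norm s + 1) / sqrt (real N)" .
  qed (use R_holo in auto)
  ultimately show ?thesis by simp
qed

subsection \<open>Dirichlet series with coefficients of slow growth\<close>

lemma ln_power_le_powr:
  assumes "d > 0"
  obtains K :: real where "K > 0" "\<And>x. x \<ge> 1 \<Longrightarrow> (1 + ln x) ^ A \<le> K * x powr d"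
proof
  \<comment> \<open>From ln x <= x^e / e the A-th power costs x^(e A), and e A <= d; the 1 in the
    denominator covers A = 0.\<close>
  define e where "e = d / (real A + 1)"
  have e: "e > 0" using assms by (simp add: e_def)
  show "(1 + 1 / e) ^ A > 0" using e by (intro zero_less_power) (auto intro: add_pos_pos)
  fix x :: real assume x: "x \<ge> 1"
  have "1 + ln x \<le> x powr e + x powr e / e"
    using x e ln_powr_bound[OF x e] ge_one_powr_ge_zero[of x e] by (intro add_mono) auto
  also have "\<dots> = (1 + 1 / e) * x powr e" by (simp add: algebra_simps)
  finally have "(1 + ln x) ^ A \<le> ((1 + 1 / e) * x powr e) ^ A"
    using x by (intro power_mono) auto
  also have "\<dots> = (1 + 1 / e) ^ A * x powr (e * real A)"
    using x by (simp add: power_mult_distrib powr_realpow [symmetric] powr_powr)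
  also have "\<dots> \<le> (1 + 1 / e) ^ A * x powr d"
    using x e assms by (intro mult_left_mono powr_mono) (auto simp: e_def field_simps)
  finally show "(1 + ln x) ^ A \<le> (1 + 1 / e) ^ A * x powr d" .
qed

text \<open>This class contains bounded sequences, \<open>ln\<close> and \<open>mangoldt\<close>, is
  closed under pointwise products, and gives absolute convergence of the Dirichlet series for Re s >
  1.\<close>

definition slow_growth :: "(nat \<Rightarrow> complex) \<Rightarrow> bool" where
  "slow_growth a \<longleftrightarrow> (\<forall>d>0. \<exists>K. \<forall>n\<ge>1. norm (a n) \<le> K * real n powr d)"

lemma slow_growth_bounded:
  assumes "\<And>n. norm (a n) \<le> B"
  shows   "slow_growth a"
  unfolding slow_growth_def
proof (intro allI impI exI[of _ B])
  fix d :: real and n :: nat assume d: "d > 0" "n \<ge> 1"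
  have "B \<ge> 0" using assms[of 0] norm_ge_zero order_trans by blast
  hence "B * 1 \<le> B * real n powr d"
    using d by (intro mult_left_mono ge_one_powr_ge_zero) auto
  thus "norm (a n) \<le> B * real n powr d" using assms[of n] by simp
qed

lemma slow_growth_ln: "slow_growth (\<lambda>n. of_real (ln (real n)))"
  unfolding slow_growth_def
proof (intro allI impI)
  fix d :: real assume d: "d > 0"
  have "\<forall>n\<ge>1. norm (of_real (ln (real n)) :: complex) \<le> 1 / d * real n powr d"
    using ln_powr_bound[OF _ d] by auto
  thus "\<exists>K. \<forall>n\<ge>1. norm (of_real (ln (real n)) :: complex) \<le> K * real n powr d" by blast
qed

lemma slow_growth_mult:
  assumes "slow_growth a" "slow_growth b"
  shows   "slow_growth (\<lambda>n. a n * b n)"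
  unfolding slow_growth_def
proof (intro allI impI)
  fix d :: real assume d: "d > 0"
  then obtain K L where K: "\<forall>n\<ge>1. norm (a n) \<le> K * real n powr (d/2)"
    and L: "\<forall>n\<ge>1. norm (b n) \<le> L * real n powr (d/2)"
    using assms half_gt_zero unfolding slow_growth_def by metis
  have "norm (a n * b n) \<le> K * L * real n powr d" if n: "n \<ge> 1" for n
  proof -
    have "norm (a n) * norm (b n) \<le> (K * real n powr (d/2)) * (L * real n powr (d/2))"
      using K L n by (intro mult_mono order_trans[OF norm_ge_zero K[rule_format]]) auto
    also have "\<dots> = K * L * (real n powr (d/2) * real n powr (d/2))" by simp
    also have "real n powr (d/2) * real n powr (d/2) = real n powr d"
      by (simp flip: powr_add)
    finally show ?thesis by (simp add: norm_mult)
  qed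
  thus "\<exists>K. \<forall>n\<ge>1. norm (a n * b n) \<le> K * real n powr d" by blast
qed

lemma mangoldt_le_ln:
  assumes "n > 0"
  shows   "mangoldt n \<le> ln (real n)"
proof -
  have "mangoldt n \<le> (\<Sum>d | d dvd n. mangoldt d :: real)"
    using assms by (intro member_le_sum) (auto intro: mangoldt_nonneg)
  thus ?thesis using mangoldt_sum[of n, where ?'a = real] assms by simp
qed

lemma slow_growth_mangoldt: "slow_growth mangoldt"
  unfolding slow_growth_def
proof (intro allI impI)
  fix d :: real assume d: "d > 0"
  then obtain K where K: "\<forall>n\<ge>1. norm (of_real (ln (real n)) :: complex) \<le> K * real n powr d"
    using slow_growth_ln unfolding slow_growth_def by blast
  have "norm (mangoldt n :: complex) \<le> K * real n powr d" if n: "n \<ge> 1" for n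
  proof -
    have "norm (mangoldt n :: complex) \<le> ln (real n)" using mangoldt_le_ln[of n] n by simp
    also have "ln (real n) \<le> norm (of_real (ln (real n)) :: complex)" by simp
    also have "\<dots> \<le> K * real n powr d" using K n by blast
    finally show ?thesis .
  qed
  thus "\<exists>K. \<forall>n\<ge>1. norm (mangoldt n :: complex) \<le> K * real n powr d" by blast
qed

definition dser :: "(nat \<Rightarrow> complex) \<Rightarrow> complex \<Rightarrow> complex" where
  "dser a s = (\<Sum>n. a (Suc n) * of_nat (Suc n) powr (-s))"

lemma dser_terms_dominated:
  assumes a: "slow_growth a" and c: "c > 1"
  shows   "\<exists>h. summable h \<and>
             (\<forall>n s. Re s \<ge> c \<longrightarrow> norm (a (Suc n) * of_nat (Suc n) powr (-s)) \<le> h n)"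
proof -
  define d where "d = (c - 1) / 2"
  have d: "d > 0" "d - c < -1" using c by (auto simp: d_def field_simps)
  obtain K where K: "\<And>n. n \<ge> 1 \<Longrightarrow> norm (a n) \<le> K * real n powr d"
    using a d(1) unfolding slow_growth_def by blast
  show ?thesis
  proof (intro exI conjI allI impI)
    have "summable (\<lambda>n. real n powr (d - c))" using d by (simp add: summable_real_powr_iff)
    hence "summable (\<lambda>n. real (Suc n) powr (d - c))" by (subst summable_Suc_iff)
    thus "summable (\<lambda>n. K * real (Suc n) powr (d - c))" by (rule summable_mult)
    fix n s assume s: "Re s \<ge> c"
    have "norm (a (Suc n) * of_nat (Suc n) powr (-s)) = norm (a (Suc n)) * real (Suc n) powr (-Re s)"
      by (simp add: norm_mult norm_of_nat_powr del: of_nat_Suc)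
    also have "\<dots> \<le> (K * real (Suc n) powr d) * real (Suc n) powr (-c)"
      using s order_trans[OF norm_ge_zero K[of "Suc n"]] by (intro mult_mono K powr_mono) auto
    also have "\<dots> = K * real (Suc n) powr (d - c)"
      by (simp add: powr_diff powr_minus field_simps)
    finally show "norm (a (Suc n) * of_nat (Suc n) powr (-s)) \<le> K * real (Suc n) powr (d - c)" .
  qed
qed

lemma dser_abs_summable:
  assumes "slow_growth a" "Re s > 1"
  shows   "summable (\<lambda>n. norm (a (Suc n) * of_nat (Suc n) powr (-s)))"
proof -
  obtain h where h: "summable h \<and>
    (\<forall>n z. Re z \<ge> Re s \<longrightarrow> norm (a (Suc n) * of_nat (Suc n) powr (-z)) \<le> h n)"
    using dser_terms_dominated[OF assms] ..
  have "norm (a (Suc n) * of_nat (Suc n) powr (-s)) \<le> h n" for n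
    by (rule h[THEN conjunct2, rule_format]) (rule order.refl)
  thus ?thesis
    by (intro summable_comparison_test'[OF h[THEN conjunct1], of 0]) (simp only: real_norm_def abs_norm_cancel)
qed

lemma dser_sums:
  assumes "slow_growth a" "Re s > 1"
  shows   "(\<lambda>n. a (Suc n) * of_nat (Suc n) powr (-s)) sums dser a s"
  unfolding dser_def using summable_norm_cancel[OF dser_abs_summable[OF assms]] by (rule summable_sums)

lemma dser_has_sum:
  assumes "slow_growth a" "Re s > 1"
  shows   "((\<lambda>n. a n * of_nat n powr (-s)) has_sum dser a s) {1..}"
proof -
  have "((\<lambda>n. a (Suc n) * of_nat (Suc n) powr (-s)) has_sum dser a s) UNIV"
    by (rule norm_summable_imp_has_sum[OF dser_abs_summable[OF assms] dser_sums[OF assms]])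
  moreover have "bij_betw Suc UNIV {1..}"
    by (rule bij_betwI[of _ _ _ "\<lambda>n. n - 1"]) auto
  ultimately show ?thesis
    using has_sum_reindex_bij_betw[of Suc UNIV "{1..}" "\<lambda>n. a n * of_nat n powr (-s)"] by blast
qed

lemma dser_abs_summable_on:
  assumes "slow_growth a" "Re s > 1"
  shows   "(\<lambda>n. norm (a n * of_nat n powr (-s))) summable_on {1..}"
proof -
  have "slow_growth (\<lambda>n. of_real (norm (a n)))"
    using assms(1) by (simp add: slow_growth_def)
  from dser_has_sum[OF this, of "of_real (Re s)"] assms(2)
  have "(\<lambda>n. complex_of_real (norm (a n)) * of_nat n powr (-of_real (Re s))) summable_on {1..}"
    by (auto intro: has_sum_imp_summable)
  hence "(\<lambda>n. Re (complex_of_real (norm (a n)) * of_nat n powr (-of_real (Re s)))) summable_on {1..}"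
    by (rule summable_on_Re)
  thus ?thesis
  proof (rule summable_on_cong[THEN iffD1, rotated])
    fix n :: nat assume n: "n \<in> {1..}"
    have "complex_of_real (norm (a n)) * of_nat n powr (-of_real (Re s)) = of_real (norm (a n) * real n powr (-Re s))"
      using n powr_of_real[of "real n" "-Re s"] by simp
    thus "Re (complex_of_real (norm (a n)) * of_nat n powr (-of_real (Re s))) = norm (a n * of_nat n powr (-s))"
      by (simp only: Re_complex_of_real) (simp add: norm_mult norm_of_nat_powr)
  qed
qed

text \<open>Termwise differentiation; around each point \<open>dser_terms_dominated\<close> with a
  slightly smaller abscissa provides the uniform majorant.\<close>

lemma dser_has_field_derivative:
  assumes a: "slow_growth a" and s: "Re s > 1"
  shows   "(dser a has_field_derivative -dser (\<lambda>n. of_real (ln (real n)) * a n) s) (at s)"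
proof -
  define S where "S = {s. Re s > 1}"
  define f where "f = (\<lambda>n s. a (Suc n) * of_nat (Suc n) powr (-s))"
  define f' where "f' = (\<lambda>n s. -(of_real (ln (real (Suc n))) * a (Suc n) * of_nat (Suc n) powr (-s)))"
  have "\<exists>g g'. \<forall>x\<in>S. ((\<lambda>n. f n x) sums g x) \<and> ((\<lambda>n. f' n x) sums g' x) \<and> (g has_field_derivative g' x) (at x)"
  proof (rule series_and_derivative_comparison_local)
    show "open S" unfolding S_def by (rule open_halfspace_Re_gt)
    show "(f n has_field_derivative f' n x) (at x)" if "x \<in> S" for n x
      using DERIV_cmult[OF of_nat_powr_minus_has_field_derivative[of "Suc n" x], of "a (Suc n)"]
      unfolding f_def f'_def by (simp add: mult_ac)
    fix x assume x: "x \<in> S"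
    define d where "d = (Re x - 1) / 2"
    have d: "d > 0" "Re x - d > 1" using x by (auto simp: d_def S_def field_simps)
    obtain h where h': "summable h \<and> (\<forall>n s. Re s \<ge> Re x - d \<longrightarrow> norm (f n s) \<le> h n)"
      unfolding f_def using dser_terms_dominated[OF a d(2)] ..
    hence h: "summable h" "\<And>n s. Re s \<ge> Re x - d \<Longrightarrow> norm (f n s) \<le> h n" by blast+
    have "norm (f n y) \<le> h n" if "y \<in> ball x d \<inter> S" for n y
    proof (rule h(2))
      have "\<bar>Re (x - y)\<bar> \<le> norm (x - y)" by (rule abs_Re_le_cmod)
      moreover have "norm (x - y) < d" using that by (simp add: dist_norm)
      ultimately show "Re y \<ge> Re x - d" by simp
    qed
    thus "\<exists>d h. 0 < d \<and> summable h \<and> (\<forall>\<^sub>F n in sequentially. \<forall>y\<in>ball x d \<inter> S. norm (f n y) \<le> h n)"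
      using d(1) h(1) by (intro exI[of _ d] exI[of _ h]) auto
  qed
  then obtain g g' where g: "\<And>x. x \<in> S \<Longrightarrow> (\<lambda>n. f n x) sums g x" "\<And>x. x \<in> S \<Longrightarrow> (\<lambda>n. f' n x) sums g' x"
     "\<And>x. x \<in> S \<Longrightarrow> (g has_field_derivative g' x) (at x)" by blast
  have sS: "s \<in> S" using s by (simp add: S_def)
  have g_eq: "dser a x = g x" if "x \<in> S" for x
    using g(1)[OF that] unfolding dser_def f_def by (simp add: sums_iff)
  have "(\<lambda>n. -f' n s) sums -g' s" using g(2)[OF sS] by (rule sums_minus)
  hence "dser (\<lambda>n. of_real (ln (real n)) * a n) s = -g' s"
    unfolding dser_def f'_def by (simp add: sums_iff)
  moreover have "(dser a has_field_derivative g' s) (at s)"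
    by (rule has_field_derivative_transform_within_open[OF g(3)[OF sS], of S])
       (use sS g_eq in \<open>auto simp: S_def open_halfspace_Re_gt\<close>)
  ultimately show ?thesis by simp
qed

lemma holomorphic_dser: "slow_growth a \<Longrightarrow> dser a holomorphic_on {s. Re s > 1}"
  by (subst holomorphic_on_open) (auto simp: open_halfspace_Re_gt intro: dser_has_field_derivative)

text \<open>Absolute convergence permits regrouping the pairs (m, n) by their product. Slow growth
  of \<open>c\<close> is assumed because deriving it would require a divisor bound; in the
  application \<open>c\<close> is \<open>ln\<close> times the character.\<close>

lemma dser_mult:
  assumes a: "slow_growth a" and b: "slow_growth b" and s: "Re s > 1"
    and c: "slow_growth c" "\<And>n. n \<ge> 1 \<Longrightarrow> c n = (\<Sum>d | d dvd n. a d * b (n div d))"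
  shows   "dser a s * dser b s = dser c s"
proof -
  define f where "f = (\<lambda>n::nat. a n * of_nat n powr (-s))"
  define g where "g = (\<lambda>n::nat. b n * of_nat n powr (-s))"
  have f: "(\<lambda>n. norm (f n)) summable_on {1..}" and g: "(\<lambda>n. norm (g n)) summable_on {1..}"
    unfolding f_def g_def using dser_abs_summable_on[OF a s] dser_abs_summable_on[OF b s] by blast+
  have "(\<lambda>p. norm (case p of (m,n) \<Rightarrow> f m * g n)) summable_on {1..} \<times> {1..}"
    using f g by (subst Infinite_Sum.abs_summable_on_Sigma_iff)
      (auto simp: norm_mult infsum_cmult_right' infsum_nonneg abs_mult
            intro!: summable_on_cmult_right summable_on_cmult_left)
  hence fg': "(\<lambda>(m,n). f m * g n) summable_on {1..} \<times> {1..}"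
    by (rule abs_summable_summable)
  have "dser a s * dser b s = infsum f {1..} * infsum g {1..}"
    using infsumI[OF dser_has_sum[OF a s]] infsumI[OF dser_has_sum[OF b s]] by (simp add: f_def g_def)
  also have "\<dots> = infsum (\<lambda>m. infsum (\<lambda>n. f m * g n) {1..}) {1..}"
    by (simp add: infsum_cmult_right' infsum_cmult_left')
  also have "\<dots> = infsum (\<lambda>(m,n). f m * g n) ({1..} \<times> {1..})"
    using infsum_Sigma_banach[OF fg'] by simp
  also have "\<dots> = infsum (\<lambda>(n,d). f d * g (n div d)) (SIGMA n:{1..}. {d. d dvd n})"
    by (rule infsum_reindex_bij_witness[of _ "\<lambda>(n,d). (d, n div d)" "\<lambda>(m,n). (m * n, m)"])
       (auto simp: Suc_le_eq intro!: Nat.gr0I)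
  also have "\<dots> = infsum (\<lambda>n. infsum (\<lambda>d. f d * g (n div d)) {d. d dvd n}) {1..}"
  proof -
    have "(\<lambda>(n,d). f d * g (n div d)) summable_on (SIGMA n:{1..}. {d. d dvd n})"
      using fg' summable_on_reindex_bij_witness[of "{1..} \<times> {1..}" "\<lambda>(n,d). (d, n div d)" "\<lambda>(m,n). (m * n, m)"
          "SIGMA n:{1..}. {d. d dvd n}" "\<lambda>(n,d). f d * g (n div d)" "\<lambda>(m,n). f m * g n"]
      by (force simp: Suc_le_eq intro!: Nat.gr0I)
    from infsum_Sigma_banach[OF this] show ?thesis by simp
  qed
  also have "\<dots> = infsum (\<lambda>n. c n * of_nat n powr (-s)) {1..}"
  proof (rule infsum_cong)
    fix n :: nat assume n: "n \<in> {1..}"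
    have "infsum (\<lambda>d. f d * g (n div d)) {d. d dvd n} = (\<Sum>d | d dvd n. f d * g (n div d))"
      using n by (intro infsum_finite) auto
    also have "\<dots> = (\<Sum>d | d dvd n. a d * b (n div d) * of_nat n powr (-s))"
    proof (intro sum.cong refl)
      fix d assume "d \<in> {d. d dvd n}"
      then obtain e where e: "n = d * e" by auto
      have d: "d > 0" "e > 0" using e n by (auto intro!: Nat.gr0I)
      have "of_nat d powr (-s) * of_nat e powr (-s) = of_nat n powr (-s)"
        unfolding e using powr_times_real[of "of_nat d" "of_nat e" "-s"] by simp
      moreover have "n div d = e" using e d by simp
      ultimately show "f d * g (n div d) = a d * b (n div d) * of_nat n powr (-s)"
        by (simp only: f_def g_def mult_ac)
    qed
    also have "\<dots> = c n * of_nat n powr (-s)"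
      using n c(2)[of n] by (simp add: sum_distrib_right)
    finally show "infsum (\<lambda>d. f d * g (n div d)) {d. d dvd n} = c n * of_nat n powr (-s)" .
  qed
  also have "\<dots> = dser c s"
    using infsumI[OF dser_has_sum[OF c(1) s]] .
  finally show ?thesis .
qed

section \<open>Completely multiplicative coefficients and positivity of logarithmic
  derivatives\<close>

definition completely_mult :: "(nat \<Rightarrow> complex) \<Rightarrow> bool" where
  "completely_mult X \<longleftrightarrow> X 1 = 1 \<and> (\<forall>a b. X (a * b) = X a * X b) \<and> (\<forall>n. norm (X n) \<le> 1)"

lemma completely_mult_slow_growth: "completely_mult X \<Longrightarrow> slow_growth X"
  by (rule slow_growth_bounded[of _ 1]) (simp add: completely_mult_def)

text \<open>The identity Lambda * 1 = log, twisted by a completely multiplicative \<open>X\<close>.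
  In the form F' = -F K it can be stated before F is known to be nonzero.\<close>

lemma dser_log_derivative:
  assumes X: "completely_mult X" and s: "Re s > 1"
  shows   "(dser X has_field_derivative -(dser X s * dser (\<lambda>n. mangoldt n * X n) s)) (at s)"
proof -
  note slow = completely_mult_slow_growth[OF X]
  have mult: "X (a * b) = X a * X b" for a b using X by (simp add: completely_mult_def)
  have "dser X s * dser (\<lambda>n. mangoldt n * X n) s = dser (\<lambda>n. of_real (ln (real n)) * X n) s"
  proof (subst mult.commute, rule dser_mult)
    fix n :: nat assume n: "n \<ge> 1"
    have "(\<Sum>d | d dvd n. mangoldt d * X d * X (n div d)) = (\<Sum>d | d dvd n. mangoldt d * X n)"
    proof (intro sum.cong refl)
      fix d assume "d \<in> {d. d dvd n}"
      hence "d * (n div d) = n" by simp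
      hence "X n = X d * X (n div d)" using mult[of d "n div d"] by simp
      thus "mangoldt d * X d * X (n div d) = mangoldt d * X n" by simp
    qed
    also have "\<dots> = of_real (ln (real n)) * X n"
      using n mangoldt_sum[of n, where ?'a = complex] by (simp flip: sum_distrib_right)
    finally show "of_real (ln (real n)) * X n = (\<Sum>d | d dvd n. mangoldt d * X d * X (n div d))" ..
  qed (use slow s in \<open>auto intro: slow_growth_mult slow_growth_mangoldt slow_growth_ln\<close>)
  thus ?thesis using dser_has_field_derivative[OF slow s] by simp
qed

lemma completely_mult_dirichlet_character:
  assumes "dirichlet_character q X" "q > 0"
  shows   "completely_mult X"
  unfolding completely_mult_def
  using dirichlet_character_1[OF assms(1)] dirichlet_character_mult[OF assms(1)]
        dirichlet_character_norm_le_1[OF assms] by blast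

lemma completely_mult_1: "completely_mult (\<lambda>_. 1)"
  by (simp add: completely_mult_def)

lemma completely_mult_times:
  assumes X: "completely_mult X" and Y: "completely_mult Y"
  shows   "completely_mult (\<lambda>n. X n * Y n)"
proof -
  have "norm (X n * Y n) \<le> 1 * 1" for n
    unfolding norm_mult using X Y by (intro mult_mono) (auto simp: completely_mult_def)
  thus ?thesis using X Y by (simp add: completely_mult_def)
qed

lemma dirichlet_L_eq_dser:
  assumes X: "dirichlet_character q X" "X \<noteq> principal_character q" and q: "q > 0" and s: "Re s > 1"
  shows   "dirichlet_L X s = dser X s"
  using dirichlet_L_nonprincipal(2)[OF X q s] by (simp add: dser_def powr_minus divide_inverse)

text \<open>The term n = 1 is 1 and the others are at most 2^(2 - t) / n^2. The limit serves as
  initial value at infinity in the monotonicity arguments that follow.\<close>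

lemma tendsto_dser_at_top:
  assumes X: "completely_mult X"
  shows   "((\<lambda>t. dser X (of_real t)) \<longlongrightarrow> 1) at_top"
proof -
  note slow = completely_mult_slow_growth[OF X]
  have X1: "X 1 = 1" and Xle: "norm (X n) \<le> 1" for n using X by (auto simp: completely_mult_def)
  define h where "h = (\<lambda>n. real (Suc (Suc n)) powr (-2))"
  have "summable (\<lambda>n. real n powr (-2))" by (simp add: summable_real_powr_iff)
  hence h: "summable h"
    unfolding h_def using summable_Suc_iff[of "\<lambda>n. real n powr (-2)"]
      summable_Suc_iff[of "\<lambda>n. real (Suc n) powr (-2)"] by blast
  have bound: "norm (dser X (of_real t) - 1) \<le> 2 powr (2 - t) * suminf h" if t: "t \<ge> 2" for t
  proof -
    define f where "f = (\<lambda>n. X (Suc n) * of_nat (Suc n) powr (-of_real t))"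
    have f: "f sums dser X (of_real t)"
      unfolding f_def using t by (intro dser_sums slow) auto
    have "f 0 = 1" using X1 by (simp add: f_def)
    hence eq: "dser X (of_real t) - 1 = (\<Sum>n. f (Suc n))"
      using suminf_split_head[of f] f by (simp add: sums_iff)
    have le: "norm (f (Suc n)) \<le> 2 powr (2 - t) * h n" for n
    proof -
      have "norm (f (Suc n)) = norm (X (Suc (Suc n))) * real (Suc (Suc n)) powr (-t)"
        unfolding f_def by (simp add: norm_mult norm_of_nat_powr del: of_nat_Suc)
      also have "\<dots> \<le> 1 * (real (Suc (Suc n)) powr (2 - t) * h n)"
        unfolding h_def using Xle by (intro mult_mono) (auto simp flip: powr_add)
      also have "real (Suc (Suc n)) powr (2 - t) \<le> 2 powr (2 - t)"
        using t by (intro powr_mono2') auto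
      hence "1 * (real (Suc (Suc n)) powr (2 - t) * h n) \<le> 2 powr (2 - t) * h n"
        unfolding mult_1 by (rule mult_right_mono) (simp add: h_def)
      finally show ?thesis .
    qed
    have "norm (\<Sum>n. f (Suc n)) \<le> (\<Sum>n. 2 powr (2 - t) * h n)"
      by (rule norm_suminf_le[OF le]) (use h in \<open>rule summable_mult\<close>)
    also have "\<dots> = 2 powr (2 - t) * suminf h"
      using h by (rule suminf_mult)
    finally show ?thesis unfolding eq .
  qed
  have "((\<lambda>t::real. 2 powr (2 - t)) \<longlongrightarrow> 0) at_top"
    by real_asymp
  hence "((\<lambda>t. 2 powr (2 - t) * suminf h) \<longlongrightarrow> 0) at_top"
    by (rule tendsto_mult_left_zero)
  moreover have "eventually (\<lambda>t. norm (dser X (of_real t) - 1) \<le> 2 powr (2 - t) * suminf h) at_top"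
    using eventually_ge_at_top[of 2] by eventually_elim (rule bound)
  ultimately have "((\<lambda>t. dser X (of_real t) - 1) \<longlongrightarrow> 0) at_top"
    by (rule Lim_null_comparison[rotated])
  thus ?thesis using Lim_null by blast
qed

text \<open>Along the real axis the square of |F| has derivative -2 |F|^2 Re K <= 0, so it decreases
  towards its limit 1. This does the work of a logarithm of F, and nonvanishing is a
  by-product.\<close>

lemma norm_ge_1_of_log_derivative:
  fixes F K :: "complex \<Rightarrow> complex"
  assumes deriv: "\<And>t. t > 1 \<Longrightarrow> (F has_field_derivative -(F (of_real t) * K (of_real t))) (at (of_real t))"
    and K: "\<And>t. t > 1 \<Longrightarrow> Re (K (of_real t)) \<ge> 0"
    and lim: "((\<lambda>t. F (of_real t)) \<longlongrightarrow> 1) at_top"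
    and t: "t > 1"
  shows   "norm (F (of_real t)) \<ge> 1"
proof -
  define N where "N = (\<lambda>t. Re (F (of_real t)) ^ 2 + Im (F (of_real t)) ^ 2)"
  have N_eq: "N t = norm (F (of_real t)) ^ 2" for t by (simp add: N_def cmod_power2)
  have N_deriv: "(N has_real_derivative -(2 * N t * Re (K (of_real t)))) (at t)" if t: "t > 1" for t
  proof -
    have v: "((\<lambda>t. F (of_real t)) has_vector_derivative -(F (of_real t) * K (of_real t))) (at t)"
      using deriv[OF t] by (rule has_vector_derivative_real_field)
    have re: "((\<lambda>t. Re (F (of_real t))) has_real_derivative Re (-(F (of_real t) * K (of_real t)))) (at t)"
      using bounded_linear.has_vector_derivative[OF bounded_linear_Re v]
      by (simp add: has_real_derivative_iff_has_vector_derivative)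
    have im: "((\<lambda>t. Im (F (of_real t))) has_real_derivative Im (-(F (of_real t) * K (of_real t)))) (at t)"
      using bounded_linear.has_vector_derivative[OF bounded_linear_Im v]
      by (simp add: has_real_derivative_iff_has_vector_derivative)
    show ?thesis
      unfolding N_def
      by (rule derivative_eq_intros re im refl)+ (simp add: algebra_simps power2_eq_square)
  qed
  have mono: "N u \<le> N t" if "u \<ge> t" for u
  proof (rule DERIV_nonpos_imp_nonincreasing[OF that])
    fix x assume "t \<le> x" "x \<le> u"
    hence x: "x > 1" using t by simp
    have "-(2 * N x * Re (K (of_real x))) \<le> 0" using K[OF x] by (simp add: N_eq)
    thus "\<exists>y. (N has_real_derivative y) (at x) \<and> y \<le> 0" using N_deriv[OF x] by blast
  qed
  have "eventually (\<lambda>u. N u \<le> N t) at_top"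
    using eventually_ge_at_top[of t] by eventually_elim (rule mono)
  moreover have "(N \<longlongrightarrow> 1) at_top"
    unfolding N_eq using tendsto_power[OF tendsto_norm[OF lim], of 2] by simp
  ultimately have "N t \<ge> 1"
    by (intro tendsto_upperbound[where F = at_top]) auto
  hence "norm (F (of_real t)) ^ 2 \<ge> 1 ^ 2" by (simp add: N_eq)
  thus ?thesis using power2_le_imp_le[of 1 "norm (F (of_real t))"] by simp
qed

lemma Re_dser_nonneg:
  assumes "slow_growth a" "t > 1" "\<And>n. Re (a n) \<ge> 0"
  shows   "Re (dser a (of_real t)) \<ge> 0"
proof -
  have "(\<lambda>n. a (Suc n) * of_nat (Suc n) powr (-of_real t)) sums dser a (of_real t)"
    using assms by (intro dser_sums) auto
  hence "(\<lambda>n. Re (a (Suc n) * of_nat (Suc n) powr (-of_real t))) sums Re (dser a (of_real t))"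
    by (rule sums_Re)
  moreover have "Re (a (Suc n) * of_nat (Suc n) powr (-of_real t)) \<ge> 0" for n
  proof -
    have "of_nat (Suc n) powr (-of_real t) = complex_of_real (real (Suc n) powr (-t))"
      using powr_of_real[of "real (Suc n)" "-t"] by simp
    thus ?thesis using assms(3) by simp
  qed
  ultimately show ?thesis by (rule sums_le[OF _ sums_zero, rotated]) 
qed

text \<open>The negative logarithmic derivative of the product has coefficients Lambda(n) (3 + 4
  X(n) + X(n)^2) with nonnegative real part, so \<open>norm_ge_1_of_log_derivative\<close>
  applies.\<close>

lemma three_four_one:
  assumes X: "completely_mult X" and unit: "\<And>n. X n \<noteq> 0 \<Longrightarrow> norm (X n) = 1" and t: "t > 1"
  shows   "norm (dser (\<lambda>_. 1) (of_real t) ^ 3 * dser X (of_real t) ^ 4 * dser (\<lambda>n. X n * X n) (of_real t)) \<ge> 1"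
proof -
  define Y where "Y = (\<lambda>n. X n * X n)"
  have Y: "completely_mult Y" unfolding Y_def by (intro completely_mult_times X)
  note one = completely_mult_1
  define F where "F = (\<lambda>s. dser (\<lambda>_. 1) s ^ 3 * dser X s ^ 4 * dser Y s)"
  define k where "k = (\<lambda>X s. dser (\<lambda>n. mangoldt n * X n) s)"
  define K where "K = (\<lambda>s. 3 * k (\<lambda>_. 1) s + 4 * k X s + k Y s)"
  have slow: "slow_growth (\<lambda>n. mangoldt n * Z n)" if "completely_mult Z" for Z
    by (intro slow_growth_mult slow_growth_mangoldt completely_mult_slow_growth that)
  have "norm (F (of_real t)) \<ge> 1"
  proof (rule norm_ge_1_of_log_derivative[where K = K])
    fix t :: real assume t: "t > 1"
    hence t': "Re (of_real t) > 1" by simp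
    show "(F has_field_derivative -(F (of_real t) * K (of_real t))) (at (of_real t))"
      unfolding F_def K_def k_def
      by (rule derivative_eq_intros dser_log_derivative[OF one t'] dser_log_derivative[OF X t']
               dser_log_derivative[OF Y t'] refl)+
         (simp add: algebra_simps eval_nat_numeral)
    define w where "w = (\<lambda>n. 3 + 4 * X n + Y n)"
    have w: "Re (w n) \<ge> 0" for n
    proof (cases "X n = 0")
      case False
      hence "norm (X n) ^ 2 = 1" using unit[of n] by simp
      hence "Re (X n) ^ 2 + Im (X n) ^ 2 = 1" by (simp add: cmod_power2)
      \<comment> \<open>On the unit circle Re z^2 = 2 (Re z)^2 - 1; this is the inequality for 3 + 4
        cos t + cos 2t as a perfect square.\<close>
      hence "Re (w n) = 2 * (1 + Re (X n)) ^ 2"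
        unfolding w_def Y_def by (simp add: power2_eq_square algebra_simps)
      thus ?thesis by simp
    qed (simp add: w_def Y_def)
    have "(\<lambda>n. 3 * (mangoldt (Suc n) * 1 * of_nat (Suc n) powr (-of_real t)) +
               4 * (mangoldt (Suc n) * X (Suc n) * of_nat (Suc n) powr (-of_real t)) +
               mangoldt (Suc n) * Y (Suc n) * of_nat (Suc n) powr (-of_real t)) sums K (of_real t)"
      unfolding K_def k_def by (intro sums_add sums_mult dser_sums slow one X Y t')
    hence "(\<lambda>n. mangoldt (Suc n) * w (Suc n) * of_nat (Suc n) powr (-of_real t)) sums K (of_real t)"
      by (simp add: w_def algebra_simps)
    hence "K (of_real t) = dser (\<lambda>n. mangoldt n * w n) (of_real t)"
      unfolding dser_def by (simp add: sums_iff)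
    moreover have "norm (w n) \<le> 8" for n
    proof -
      have "norm (w n) \<le> norm (3 + 4 * X n) + norm (Y n)" unfolding w_def by (rule norm_triangle_ineq)
      also have "norm (3 + 4 * X n) \<le> norm (3 :: complex) + norm (4 * X n)" by (rule norm_triangle_ineq)
      finally show ?thesis using X Y by (simp add: completely_mult_def norm_mult) (smt (verit))
    qed
    hence "slow_growth (\<lambda>n. mangoldt n * w n)"
      by (intro slow_growth_mult slow_growth_mangoldt slow_growth_bounded)
    hence "Re (dser (\<lambda>n. mangoldt n * w n) (of_real t)) \<ge> 0"
      by (rule Re_dser_nonneg[OF _ t]) (auto intro!: mult_nonneg_nonneg mangoldt_nonneg w)
    ultimately show "Re (K (of_real t)) \<ge> 0" by simp
  next
    have "((\<lambda>t. F (of_real t)) \<longlongrightarrow> 1 ^ 3 * 1 ^ 4 * 1) at_top"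
      unfolding F_def by (intro tendsto_intros tendsto_dser_at_top one X Y)
    thus "((\<lambda>t. F (of_real t)) \<longlongrightarrow> 1) at_top" by simp
  qed (rule t)
  thus ?thesis by (simp add: F_def Y_def)
qed

subsection \<open>The pole of the zeta function\<close>

lemma norm_diff_le_of_vector_derivative:
  fixes f :: "real \<Rightarrow> complex"
  assumes "a \<le> b" and "\<And>y. y \<in> {a..b} \<Longrightarrow> (f has_vector_derivative f' y) (at y)"
    and "\<And>y. y \<in> {a..b} \<Longrightarrow> norm (f' y) \<le> B"
  shows   "norm (f b - f a) \<le> B * (b - a)"
proof -
  have "norm (f b - f a) \<le> B * norm (b - a)"
  proof (rule differentiable_bound[where S = "{a..b}" and f' = "\<lambda>y t. t *\<^sub>R f' y"])
    show "(f has_derivative (\<lambda>t. t *\<^sub>R f' y)) (at y within {a..b})" if "y \<in> {a..b}" for y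
      using assms(2)[OF that] unfolding has_vector_derivative_def by (rule has_derivative_at_withinI)
    show "onorm (\<lambda>t. t *\<^sub>R f' y) \<le> B" if "y \<in> {a..b}" for y
    proof (rule onorm_le)
      fix t :: real
      show "norm (t *\<^sub>R f' y) \<le> B * norm t"
        using mult_right_mono[OF assms(3)[OF that], of "\<bar>t\<bar>"] by (simp add: mult_ac)
    qed
  qed (use assms(1) in auto)
  thus ?thesis using assms(1) by simp
qed

text \<open>This is (s - 1) times the difference between n^(-s) and the integral of y^(-s) over
  [n, n + 1]; with the integral evaluated, the expression also makes sense at s = 1.\<close>

definition zeta_term :: "nat \<Rightarrow> complex \<Rightarrow> complex" where
  "zeta_term n s = (s - 1) * of_nat n powr (-s) - (of_nat n powr (1 - s) - of_nat (Suc n) powr (1 - s))"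

text \<open>The mean value inequality twice: \<open>zeta_term n s\<close> is the increment over
  [n, n + 1] of the auxiliary function \<open>\<phi>\<close>, whose derivative (1 - s) (y^(-s) -
  n^(-s)) is again an increment. The second application gains the factor 1 / n that gives
  convergence left of 1.\<close>

lemma norm_zeta_term_le:
  assumes n: "n > 0" and s: "Re s \<ge> 0"
  shows   "norm (zeta_term n s) \<le> norm (s - 1) * norm s * real n powr (-Re s - 1)"
proof -
  have der: "((\<lambda>y. of_real y powr z) has_vector_derivative z * of_real y powr (z - 1)) (at y)"
    if "y > 0" for y :: real and z :: complex
  proof -
    have "((\<lambda>w. w powr z) has_field_derivative (z * of_real y powr (z - 1))) (at (of_real y))"
      using that by (auto intro!: derivative_eq_intros)
    thus ?thesis by (rule has_vector_derivative_real_field)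
  qed
  define B where "B = norm s * real n powr (-Re s - 1)"
  have inner: "norm (of_real y powr (-s) - of_real (real n) powr (-s)) \<le> B" if y: "y \<in> {real n..real n + 1}" for y
  proof -
    have "norm (of_real y powr (-s) - of_real (real n) powr (-s)) \<le> B * (y - real n)"
    proof (rule norm_diff_le_of_vector_derivative)
      fix x assume x: "x \<in> {real n..y}"
      show "((\<lambda>y. of_real y powr (-s)) has_vector_derivative (-s) * of_real x powr (-s - 1)) (at x)"
        using x n by (intro der) auto
      have "norm ((-s) * of_real x powr (-s - 1)) = norm s * x powr (-Re s - 1)"
        using x n by (simp add: norm_mult norm_powr_real_powr)
      also have "\<dots> \<le> B"
        unfolding B_def using x n s by (intro mult_left_mono powr_mono2') auto
      finally show "norm ((-s) * of_real x powr (-s - 1)) \<le> B" .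
    qed (use y in auto)
    also have "\<dots> \<le> B * 1"
      using y by (intro mult_left_mono) (auto simp: B_def)
    finally show ?thesis by simp
  qed
  define \<phi> where "\<phi> = (\<lambda>y. of_real y powr (1 - s) + of_real y * ((s - 1) * of_real (real n) powr (-s)))"
  have "norm (\<phi> (real n + 1) - \<phi> (real n)) \<le> (norm (s - 1) * B) * (real n + 1 - real n)"
  proof (rule norm_diff_le_of_vector_derivative)
    fix y assume y: "y \<in> {real n..real n + 1}"
    have "((\<lambda>y. of_real y :: complex) has_vector_derivative 1) (at y)"
      by (rule has_vector_derivative_real_field) (auto intro!: derivative_eq_intros)
    from has_vector_derivative_mult_left[OF this, of "(s - 1) * of_real (real n) powr (-s)"]
    show "(\<phi> has_vector_derivative ((1 - s) * of_real y powr (1 - s - 1) + 1 * ((s - 1) * of_real (real n) powr (-s)))) (at y)"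
      unfolding \<phi>_def using y n by (intro has_vector_derivative_add der) auto
    have "(1 - s) * of_real y powr (1 - s - 1) + 1 * ((s - 1) * of_real (real n) powr (-s)) =
          (1 - s) * (of_real y powr (-s) - of_real (real n) powr (-s))"
      by (simp add: algebra_simps)
    also have "norm \<dots> = norm (s - 1) * norm (of_real y powr (-s) - of_real (real n) powr (-s))"
      by (simp add: norm_mult norm_minus_commute)
    also have "\<dots> \<le> norm (s - 1) * B"
      using inner[OF y] by (rule mult_left_mono) auto
    finally show "norm ((1 - s) * of_real y powr (1 - s - 1) + 1 * ((s - 1) * of_real (real n) powr (-s))) \<le> norm (s - 1) * B" .
  qed auto
  moreover have "\<phi> (real n + 1) - \<phi> (real n) = zeta_term n s"
    unfolding \<phi>_def zeta_term_def by (simp add: algebra_simps)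
  ultimately show ?thesis by (simp add: B_def mult_ac)
qed

text \<open>This is (s - 1) zeta(s), continued to Re s > 0 and free of the pole. The leading 1 is
  the telescoped sum of n^(1-s) - (n+1)^(1-s).\<close>

definition zeta_reg :: "complex \<Rightarrow> complex" where
  "zeta_reg s = 1 + (\<Sum>n. zeta_term (Suc n) s)"

lemma holomorphic_zeta_reg: "zeta_reg holomorphic_on {s. Re s > 0}"
proof -
  have "(\<lambda>s. \<Sum>n. zeta_term (Suc n) s) holomorphic_on {s. Re s > 0}"
  proof (rule holomorphic_uniform_sequence)
    show "open {s. Re s > 0}" by (rule open_halfspace_Re_gt)
    show "(\<lambda>s. \<Sum>n<N. zeta_term (Suc n) s) holomorphic_on {s. Re s > 0}" for N
      unfolding zeta_term_def by (intro holomorphic_intros)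
    fix s assume s: "s \<in> {s. Re s > 0}"
    define d where "d = Re s / 2"
    have d: "d > 0" "Re s - d = d" using s by (auto simp: d_def)
    have Re_z: "Re z \<ge> d" if "z \<in> cball s d" for z
      using that complex_Re_le_cmod[of "s - z"] d(2) by (simp add: dist_norm)
    have "uniform_limit (cball s d) (\<lambda>N s. \<Sum>n<N. zeta_term (Suc n) s) (\<lambda>s. \<Sum>n. zeta_term (Suc n) s) sequentially"
    proof (rule Weierstrass_m_test)
      fix n z assume z: "z \<in> cball s d"
      have nz: "norm z \<le> norm s + d"
        using z norm_triangle_ineq2[of z s] by (simp add: dist_norm norm_minus_commute)
      hence nz1: "norm (z - 1) \<le> norm s + d + 1"
        using norm_triangle_ineq4[of z 1] by simp
      have "norm (zeta_term (Suc n) z) \<le> norm (z - 1) * norm z * real (Suc n) powr (-Re z - 1)"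
        using Re_z[OF z] d by (intro norm_zeta_term_le) auto
      also have "\<dots> \<le> (norm s + d + 1) * (norm s + d) * real (Suc n) powr (-d - 1)"
        using Re_z[OF z] nz nz1 d by (intro mult_mono powr_mono) auto
      finally show "norm (zeta_term (Suc n) z) \<le> (norm s + d + 1) * (norm s + d) * real (Suc n) powr (-d - 1)" .
    next
      have "summable (\<lambda>n. real n powr (-d - 1))" using d by (simp add: summable_real_powr_iff)
      hence "summable (\<lambda>n. real (Suc n) powr (-d - 1))" by (subst summable_Suc_iff)
      thus "summable (\<lambda>n. (norm s + d + 1) * (norm s + d) * real (Suc n) powr (-d - 1))"
        by (rule summable_mult)
    qed
    moreover have "cball s d \<subseteq> {s. Re s > 0}" using Re_z d by fastforce
    ultimately show "\<exists>d>0. cball s d \<subseteq> {s. 0 < Re s} \<and>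
        uniform_limit (cball s d) (\<lambda>N s. \<Sum>n<N. zeta_term (Suc n) s) (\<lambda>s. \<Sum>n. zeta_term (Suc n) s) sequentially"
      using d(1) by blast
  qed
  thus ?thesis unfolding zeta_reg_def by (intro holomorphic_intros)
qed

lemma zeta_reg_1: "zeta_reg 1 = 1"
  by (simp add: zeta_reg_def zeta_term_def del: of_nat_Suc)

lemma zeta_reg_eq_dser:
  assumes s: "Re s > 1"
  shows   "zeta_reg s = (s - 1) * dser (\<lambda>_. 1) s"
proof -
  have 1: "(\<lambda>n. (s - 1) * (1 * of_nat (Suc n) powr (-s))) sums ((s - 1) * dser (\<lambda>_. 1) s)"
    by (intro sums_mult dser_sums completely_mult_slow_growth completely_mult_1 s)
  have "(\<lambda>n. real (Suc n) powr (1 - Re s)) \<longlonglongrightarrow> 0"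
  proof -
    have "(\<lambda>n. real n powr (1 - Re s)) \<longlonglongrightarrow> 0"
      using s by (intro tendsto_neg_powr filterlim_real_sequentially) auto
    thus ?thesis by (rule LIMSEQ_Suc)
  qed
  hence "(\<lambda>n. norm (of_nat (Suc n) powr (1 - s) :: complex)) \<longlonglongrightarrow> 0"
    by (simp add: norm_of_nat_powr del: of_nat_Suc)
  hence "(\<lambda>n. of_nat (Suc n) powr (1 - s) :: complex) \<longlonglongrightarrow> 0"
    by (rule tendsto_norm_zero_cancel)
  from telescope_sums'[OF this]
  have 2: "(\<lambda>n. of_nat (Suc n) powr (1 - s) - of_nat (Suc (Suc n)) powr (1 - s)) sums (1 - 0 :: complex)"
    by simp
  from sums_diff[OF 1 2] have "(\<lambda>n. zeta_term (Suc n) s) sums ((s - 1) * dser (\<lambda>_. 1) s - 1)"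
    by (simp add: zeta_term_def del: of_nat_Suc)
  thus ?thesis by (simp add: zeta_reg_def sums_iff)
qed

lemma norm_zeta_le:
  obtains C where "C > 0" "\<And>t. 1 < t \<Longrightarrow> t \<le> 2 \<Longrightarrow> norm (dser (\<lambda>_. 1) (of_real t)) \<le> C / (t - 1)"
proof -
  have "continuous_on {1..2} (\<lambda>t. zeta_reg (of_real t))"
    using holomorphic_on_imp_continuous_on[OF holomorphic_zeta_reg]
    by (rule continuous_on_compose2) (auto intro!: continuous_intros)
  hence "compact ((\<lambda>t. zeta_reg (of_real t)) ` {1..2})"
    by (intro compact_continuous_image) auto
  then obtain C where C: "C > 0" "\<forall>x\<in>(\<lambda>t. zeta_reg (of_real t)) ` {1..2}. norm x \<le> C"
    using compact_imp_bounded bounded_pos by metis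
  show ?thesis
  proof (rule that[OF C(1)])
    fix t :: real assume t: "1 < t" "t \<le> 2"
    have "norm (zeta_reg (of_real t)) \<le> C"
      using t by (intro C(2)[rule_format] imageI) auto
    also have "zeta_reg (of_real t) = of_real (t - 1) * dser (\<lambda>_. 1) (of_real t)"
      using t by (subst zeta_reg_eq_dser) auto
    also have "norm \<dots> = (t - 1) * norm (dser (\<lambda>_. 1) (of_real t))"
      unfolding norm_mult norm_of_real using t by simp
    finally have "(t - 1) * norm (dser (\<lambda>_. 1) (of_real t)) \<le> C" .
    thus "norm (dser (\<lambda>_. 1) (of_real t)) \<le> C / (t - 1)" using t by (simp add: field_simps)
  qed
qed

subsection \<open>Bounds for L-functions near 1\<close>

lemma sum_inverse_le:
  assumes "N \<ge> 1"
  shows   "(\<Sum>n=1..N. 1 / real n) \<le> 1 + ln (real N)"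
  using assms
proof (induction N rule: dec_induct)
  case (step N)
  have N: "real N > 0" using step by simp
  have "ln (real N / (real N + 1)) \<le> real N / (real N + 1) - 1"
    using N by (intro ln_le_minus_one) auto
  also have "\<dots> = -1 / (real N + 1)" using N by (simp add: field_simps)
  finally have "1 / (real N + 1) \<le> ln (real N + 1) - ln (real N)"
    using N by (simp add: ln_div)
  thus ?case using step.IH by (simp add: add.commute)
qed auto

text \<open>With partial sums of length N = q^2 the factor q in the remainder is cancelled by
  sqrt(N), and the partial sums are bounded by harmonic sums of order log q, with one more logarithm
  for the derivative.\<close>

lemma norm_dirichlet_L_le:
  assumes X: "dirichlet_character q X" "X \<noteq> principal_character q" and q: "q > 0"
    and t: "1 \<le> t" "t \<le> 2"
  shows   "norm (dirichlet_L X (of_real t)) \<le> 10 * (1 + ln (real q))"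
    and   "norm (deriv (dirichlet_L X) (of_real t)) \<le> 28 * (1 + ln (real q)) ^ 2"
proof -
  define N where "N = q ^ 2"
  define l where "l = 1 + ln (real q)"
  have l: "l \<ge> 1" using q by (simp add: l_def)
  have N: "N \<ge> 1" "sqrt (real N) = real q" using q by (auto simp: N_def Suc_le_eq)
  have lnN: "ln (real N) = 2 * ln (real q)" using q by (simp add: N_def ln_realpow)
  have harm: "(\<Sum>n=1..N. 1 / real n) \<le> 2 * l"
    using sum_inverse_le[OF N(1)] lnN by (simp add: l_def)
  have tm: "norm (X n * of_nat n powr (-of_real t)) \<le> 1 / real n" if "n \<in> {1..N}" for n
  proof -
    have "norm (X n * of_nat n powr (-of_real t)) = norm (X n) * real n powr (-t)"
      by (simp add: norm_mult norm_of_nat_powr)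
    also have "\<dots> \<le> 1 * real n powr (-1)"
      using t that by (intro mult_mono powr_mono dirichlet_character_norm_le_1[OF X(1) q]) auto
    also have "\<dots> = 1 / real n" using that by (simp add: powr_minus divide_inverse)
    finally show ?thesis .
  qed
  have "norm (\<Sum>n=1..N. X n * of_nat n powr (-of_real t)) \<le> (\<Sum>n=1..N. 1 / real n)"
    by (intro sum_norm_le tm)
  hence s1: "norm (\<Sum>n=1..N. X n * of_nat n powr (-of_real t)) \<le> 2 * l" using harm by simp
  have "norm (dirichlet_L X (of_real t) - (\<Sum>n=1..N. X n * of_nat n powr (-of_real t))) \<le> 4 * real q * t / real q"
    using dirichlet_L_minus_partial_sum_le[OF X q _ N(1), of "of_real t"] t N(2) by simp
  also have "\<dots> \<le> 8" using t q by simp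
  finally have "norm (dirichlet_L X (of_real t)) \<le> 8 + 2 * l"
    using s1 norm_triangle_sub[of "dirichlet_L X (of_real t)" "\<Sum>n=1..N. X n * of_nat n powr (-of_real t)"] by linarith
  thus "norm (dirichlet_L X (of_real t)) \<le> 10 * (1 + ln (real q))" using l by (simp add: l_def)
  define D where "D = (\<Sum>n=1..N. X n * of_real (ln (real n)) * of_nat n powr (-of_real t))"
  have "norm D \<le> (\<Sum>n=1..N. ln (real N) * (1 / real n))"
    unfolding D_def
  proof (intro sum_norm_le)
    fix n assume n: "n \<in> {1..N}"
    have "norm (X n * of_real (ln (real n)) * of_nat n powr (-of_real t)) =
          ln (real n) * norm (X n * of_nat n powr (-of_real t))"
      using n by (simp add: norm_mult)
    also have "\<dots> \<le> ln (real N) * (1 / real n)"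
      using n by (intro mult_mono tm) auto
    finally show "norm (X n * of_real (ln (real n)) * of_nat n powr (-of_real t)) \<le> ln (real N) * (1 / real n)" .
  qed
  also have "\<dots> = ln (real N) * (\<Sum>n=1..N. 1 / real n)" by (simp add: sum_distrib_left)
  also have "\<dots> \<le> (2 * l) * (2 * l)"
    using harm lnN q l by (intro mult_mono sum_nonneg) (auto simp: l_def)
  finally have D: "norm D \<le> 4 * l ^ 2" by (simp add: power2_eq_square)
  have "norm (deriv (dirichlet_L X) (of_real t) + D) \<le> 8 * real q * (t + 1) / real q"
    unfolding D_def using deriv_dirichlet_L_minus_partial_sum_le[OF X q _ N(1), of "of_real t"] t N(2) by simp
  also have "\<dots> \<le> 24 * 1" using t q by simp
  also have "\<dots> \<le> 24 * l ^ 2" using l by (intro mult_left_mono) (auto simp: one_le_power)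
  finally have "norm (deriv (dirichlet_L X) (of_real t)) \<le> 28 * l ^ 2"
    using D norm_triangle_ineq4[of "deriv (dirichlet_L X) (of_real t) + D" D] by simp
  thus "norm (deriv (dirichlet_L X) (of_real t)) \<le> 28 * (1 + ln (real q)) ^ 2" by (simp add: l_def)
qed

text \<open>At t = 1 + d, \<open>three_four_one\<close> and the pole of zeta force |L(t, X)|^4 to be
  at least of order d^3 / log q, while L(t, X) - L(1, X) is O(d (log q)^2). For small d the former
  wins, because d^(3/4) exceeds d. The hypothesis on the square of \<open>X\<close> ensures that
  L(s, X^2) has no pole and is O(log q) at t.\<close>

lemma complex_dirichlet_L_lower_bound:
  obtains c where "c > 0"
    "\<And>q X. q > 0 \<Longrightarrow> dirichlet_character q X \<Longrightarrow> X \<noteq> principal_character q \<Longrightarrow>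
        (\<lambda>n. X n * X n) \<noteq> principal_character q \<Longrightarrow> norm (dirichlet_L X 1) \<ge> c / (1 + ln (real q)) ^ 7"
proof -
  obtain C where C: "C > 0" and zeta: "\<And>t. 1 < t \<Longrightarrow> t \<le> 2 \<Longrightarrow> norm (dser (\<lambda>_. 1) (of_real t)) \<le> C / (t - 1)"
    using norm_zeta_le by blast
  \<comment> \<open>Chosen so that 10 C^3 is dominated by a fourth power and the fourth root can be
    taken exactly.\<close>
  define K where "K = 10 * C ^ 3 + 1"
  have K: "K \<ge> 1" using C by (simp add: K_def)
  have K4: "10 * C ^ 3 \<le> K ^ 4"
  proof -
    have "10 * C ^ 3 \<le> K ^ 1" by (simp add: K_def)
    also have "\<dots> \<le> K ^ 4" using K by (intro power_increasing) auto
    finally show ?thesis .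
  qed
  \<comment> \<open>The value for which 28 e^4 is half of e^3 / K: passing from t to 1 then loses at
    most half of the lower bound.\<close>
  define e where "e = 1 / (56 * K)"
  have e: "e > 0" "e \<le> 1" using K by (auto simp: e_def field_simps)
  show ?thesis
  proof (rule that[of "e ^ 3 / (2 * K)"])
    show "e ^ 3 / (2 * K) > 0" using e K by simp
    fix q :: nat and X
    assume q: "q > 0" and X: "dirichlet_character q X" "X \<noteq> principal_character q"
      and X2: "(\<lambda>n. X n * X n) \<noteq> principal_character q"
    define l where "l = 1 + ln (real q)"
    have l: "l \<ge> 1" using q by (simp add: l_def)
    \<comment> \<open>The exponent 9 makes d^3 / l equal to (e^3 / l^7)^4, and l^2 d has the same
      order l^(-7).\<close>
    define d where "d = e ^ 4 / l ^ 9"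
    have d: "d > 0" "d \<le> 1"
    proof -
      show "d > 0" using e l by (simp add: d_def)
      have "e ^ 4 \<le> 1" using e by (intro power_le_one) auto
      moreover have "l ^ 9 \<ge> 1" using l by (rule one_le_power)
      ultimately show "d \<le> 1" unfolding d_def by (intro divide_le_eq_1_pos[THEN iffD2]) linarith+
    qed
    define t where "t = 1 + d"
    have t: "1 < t" "t \<le> 2" "t - 1 = d" using d by (auto simp: t_def)
    have X2': "dirichlet_character q (\<lambda>n. X n * X n)" by (intro dirichlet_character_times X)
    have unit: "norm (X n) = 1" if "X n \<noteq> 0" for n
      using dirichlet_character_norm[OF X(1) q, of n] that by (auto split: if_splits)
    have "1 \<le> norm (dser (\<lambda>_. 1) (of_real t) ^ 3 * dser X (of_real t) ^ 4 * dser (\<lambda>n. X n * X n) (of_real t))"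
      by (intro three_four_one completely_mult_dirichlet_character[OF X(1) q] unit t)
    also have "\<dots> = norm (dser (\<lambda>_. 1) (of_real t)) ^ 3 * norm (dirichlet_L X (of_real t)) ^ 4 *
        norm (dirichlet_L (\<lambda>n. X n * X n) (of_real t))"
      using t dirichlet_L_eq_dser[OF X q, of "of_real t"] dirichlet_L_eq_dser[OF X2' X2 q, of "of_real t"]
      by (simp add: norm_mult norm_power)
    also have "\<dots> \<le> (C / d) ^ 3 * norm (dirichlet_L X (of_real t)) ^ 4 * (10 * l)"
      using zeta[OF t(1,2)] norm_dirichlet_L_le(1)[OF X2' X2 q, of t] t C d
      by (intro mult_mono power_mono) (auto simp: l_def)
    finally have "1 \<le> (C / d) ^ 3 * norm (dirichlet_L X (of_real t)) ^ 4 * (10 * l)" .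
    hence "d ^ 3 \<le> norm (dirichlet_L X (of_real t)) ^ 4 * l * (10 * C ^ 3)"
      using d by (simp add: field_simps power_divide)
    also have "\<dots> \<le> norm (dirichlet_L X (of_real t)) ^ 4 * l * K ^ 4"
      using K4 l by (intro mult_left_mono) auto
    finally have "d ^ 3 / (l * K ^ 4) \<le> norm (dirichlet_L X (of_real t)) ^ 4"
      using l K by (simp add: field_simps)
    moreover have "(e ^ 3 / (l ^ 7 * K)) ^ 4 = d ^ 3 / (l * K ^ 4)"
      using l by (simp add: d_def power_divide power_mult_distrib field_simps flip: power_mult power_Suc power_Suc2)
    ultimately have "(e ^ 3 / (l ^ 7 * K)) ^ 4 \<le> norm (dirichlet_L X (of_real t)) ^ 4" by simp
    hence big: "e ^ 3 / (l ^ 7 * K) \<le> norm (dirichlet_L X (of_real t))"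
      by (rule power_le_imp_le_base[of _ 3, unfolded numeral_eq_Suc, simplified]) 
         (use l K e in auto)
    have "norm (dirichlet_L X (of_real t) - dirichlet_L X (of_real 1)) \<le> 28 * l ^ 2 * (t - 1)"
    proof (rule norm_diff_le_of_vector_derivative)
      fix y assume y: "y \<in> {1..t}"
      have "(dirichlet_L X has_field_derivative deriv (dirichlet_L X) (of_real y)) (at (of_real y))"
        by (rule holomorphic_derivI[OF dirichlet_L_nonprincipal(1)[OF X q]]) auto
      thus "((\<lambda>y. dirichlet_L X (of_real y)) has_vector_derivative deriv (dirichlet_L X) (of_real y)) (at y)"
        by (rule has_vector_derivative_real_field)
      show "norm (deriv (dirichlet_L X) (of_real y)) \<le> 28 * l ^ 2"
        unfolding l_def using y t by (intro norm_dirichlet_L_le(2)[OF X q]) auto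
    qed (use t in auto)
    also have "28 * l ^ 2 * (t - 1) = 28 * e ^ 4 / l ^ 7"
      unfolding t d_def using l by (simp add: field_simps flip: power_add)
    also have "\<dots> = e ^ 3 / (2 * (l ^ 7 * K))"
      using K l by (simp add: e_def field_simps power_divide eval_nat_numeral)
    finally have "norm (dirichlet_L X (of_real t) - dirichlet_L X 1) \<le> e ^ 3 / (2 * (l ^ 7 * K))" by simp
    moreover have "a - b \<le> y" if "z \<le> b" "a \<le> x" "x \<le> y + z" for a b x y z :: real
      using that by linarith
    ultimately have "norm (dirichlet_L X 1) \<ge> e ^ 3 / (l ^ 7 * K) - e ^ 3 / (2 * (l ^ 7 * K))"
      using big norm_triangle_sub[of "dirichlet_L X (of_real t)" "dirichlet_L X 1"] by blast
    also have "e ^ 3 / (l ^ 7 * K) - e ^ 3 / (2 * (l ^ 7 * K)) = e ^ 3 / (2 * K) / l ^ 7"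
      using K l by (simp add: field_simps)
    finally show "norm (dirichlet_L X 1) \<ge> e ^ 3 / (2 * K) / (1 + ln (real q)) ^ 7"
      by (simp add: l_def)
  qed
qed

subsection \<open>Estermann's lemma\<close>

lemma slow_growth_power:
  assumes "slow_growth a"
  shows   "slow_growth (\<lambda>n. a n ^ j)"
proof (induction j)
  case 0
  show ?case by (rule slow_growth_bounded[of _ 1]) simp
next
  case (Suc j)
  thus ?case using slow_growth_mult[OF assms Suc] by simp
qed

lemma dser_add:
  assumes "slow_growth a" "slow_growth b" "Re s > 1"
  shows   "dser (\<lambda>n. a n + b n) s = dser a s + dser b s"
  using sums_add[OF dser_sums[OF assms(1,3)] dser_sums[OF assms(2,3)]]
  by (simp add: dser_def sums_iff ring_distribs)

lemma higher_deriv_dser: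
  assumes a: "slow_growth a" and s: "Re s > 1"
  shows   "(deriv ^^ j) (dser a) s = (-1) ^ j * dser (\<lambda>n. of_real (ln (real n)) ^ j * a n) s"
  using s
proof (induction j arbitrary: s)
  case (Suc j)
  define b where "b = (\<lambda>n. of_real (ln (real n)) ^ j * a n)"
  have b: "slow_growth b"
    unfolding b_def by (intro slow_growth_mult slow_growth_power slow_growth_ln a)
  have "eventually (\<lambda>z. z \<in> {z. Re z > 1}) (nhds s)"
    using Suc.prems by (intro eventually_nhds_in_open open_halfspace_Re_gt) auto
  hence ev: "eventually (\<lambda>z. (deriv ^^ j) (dser a) z = (-1) ^ j * dser b z) (nhds s)"
    by eventually_elim (use Suc.IH in \<open>simp add: b_def\<close>)
  have "((\<lambda>z. (-1) ^ j * dser b z) has_field_derivative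
          (-1) ^ j * -dser (\<lambda>n. of_real (ln (real n)) * b n) s) (at s)"
    by (rule DERIV_cmult[OF dser_has_field_derivative[OF b Suc.prems]])
  hence "deriv (\<lambda>z. (-1) ^ j * dser b z) s = (-1) ^ j * -dser (\<lambda>n. of_real (ln (real n)) * b n) s"
    by (rule DERIV_imp_deriv)
  thus ?case
    using deriv_cong_ev[OF ev refl] by (simp add: b_def mult.assoc)
qed simp

lemma sums_in_closed_set:
  fixes f :: "nat \<Rightarrow> complex"
  assumes "f sums s" "closed A" "0 \<in> A" "\<And>x y. x \<in> A \<Longrightarrow> y \<in> A \<Longrightarrow> x + y \<in> A" "\<And>n. f n \<in> A"
  shows   "s \<in> A"
proof -
  have "(\<Sum>n<N. f n) \<in> A" for N
    using assms by (induction N) auto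
  thus ?thesis
    using assms(1,2) closed_sequentially[of A "\<lambda>N. \<Sum>n<N. f n" s] by (simp add: sums_def)
qed

lemma of_nat_powr_of_real:
  "of_nat n powr (-of_real t) = complex_of_real (real n powr (-t))"
  using powr_of_real[of "real n" "-t"] by simp

lemma dser_nonneg_Reals:
  assumes "slow_growth a" "t > 1" "\<And>n. a n \<in> \<real>\<^sub>\<ge>\<^sub>0"
  shows   "dser a (of_real t) \<in> \<real>\<^sub>\<ge>\<^sub>0"
proof (rule sums_in_closed_set)
  show "(\<lambda>n. a (Suc n) * of_nat (Suc n) powr (-of_real t)) sums dser a (of_real t)"
    using assms by (intro dser_sums) auto
  show "a (Suc n) * of_nat (Suc n) powr (-of_real t) \<in> \<real>\<^sub>\<ge>\<^sub>0" for n
    using assms(3) unfolding of_nat_powr_of_real by (intro nonneg_Reals_mult_I) auto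
qed (auto intro: nonneg_Reals_add_I)

lemma dser_Reals:
  assumes "slow_growth a" "t > 1" "\<And>n. a n \<in> \<real>"
  shows   "dser a (of_real t) \<in> \<real>"
proof (rule sums_in_closed_set)
  show "(\<lambda>n. a (Suc n) * of_nat (Suc n) powr (-of_real t)) sums dser a (of_real t)"
    using assms by (intro dser_sums) auto
  show "a (Suc n) * of_nat (Suc n) powr (-of_real t) \<in> \<real>" for n
    using assms(3) unfolding of_nat_powr_of_real by (intro Reals_mult) auto
qed (auto intro: closed_complex_Reals)

lemma sum_nonneg_Reals:
  fixes f :: "'a \<Rightarrow> complex"
  assumes "\<And>i. i \<in> A \<Longrightarrow> f i \<in> \<real>\<^sub>\<ge>\<^sub>0"
  shows   "sum f A \<in> \<real>\<^sub>\<ge>\<^sub>0"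
  using assms by (induction A rule: infinite_finite_induct) (auto intro: nonneg_Reals_add_I)

text \<open>Leibniz' rule for F' = -F K expresses each derivative of F through lower ones and
  through derivatives of -K, whose signs at 2 alternate term by term; the signs multiply to (-1)^m.
  The information thus comes from the coefficients of the logarithmic derivative, not from those of
  F.\<close>

lemma higher_deriv_sign_of_log_derivative:
  assumes F: "F holomorphic_on {s. Re s > 1}"
    and deriv: "\<And>s. Re s > 1 \<Longrightarrow> deriv F s = -(F s * dser c s)"
    and c: "slow_growth c" "\<And>n. c n \<in> \<real>\<^sub>\<ge>\<^sub>0"
    and F2: "F 2 \<in> \<real>\<^sub>\<ge>\<^sub>0"
  shows   "(-1) ^ m * (deriv ^^ m) F 2 \<in> \<real>\<^sub>\<ge>\<^sub>0"
proof (induction m rule: less_induct)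
  case (less m)
  show ?case
  proof (cases m)
    case 0
    thus ?thesis using F2 by simp
  next
    case (Suc k)
    define S where "S = {s. Re s > 1}"
    have S: "open S" "2 \<in> S" by (auto simp: S_def open_halfspace_Re_gt)
    define g where "g = (\<lambda>s. -dser c s)"
    have holo: "F holomorphic_on S" "g holomorphic_on S" "deriv F holomorphic_on S" "dser c holomorphic_on S"
      unfolding g_def S_def
      by (intro F holomorphic_intros holomorphic_dser c holomorphic_deriv open_halfspace_Re_gt)+
    have g_sign: "(-1) ^ Suc j * (deriv ^^ j) g 2 \<in> \<real>\<^sub>\<ge>\<^sub>0" for j
    proof -
      have "(deriv ^^ j) g 2 = -((-1) ^ j * dser (\<lambda>n. of_real (ln (real n)) ^ j * c n) 2)"
        unfolding g_def using higher_deriv_uminus[OF holo(4) S, of j] higher_deriv_dser[OF c(1), of 2 j] by simp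
      hence "(-1) ^ Suc j * (deriv ^^ j) g 2 = dser (\<lambda>n. of_real (ln (real n)) ^ j * c n) (of_real 2)"
        by simp
      also have "\<dots> \<in> \<real>\<^sub>\<ge>\<^sub>0"
      proof (rule dser_nonneg_Reals)
        fix n
        have "of_real (ln (real n)) ^ j \<in> (\<real>\<^sub>\<ge>\<^sub>0 :: complex set)"
          by (cases "n = 0") (auto simp flip: of_real_power)
        thus "of_real (ln (real n)) ^ j * c n \<in> \<real>\<^sub>\<ge>\<^sub>0" using c(2) by (rule nonneg_Reals_mult_I)
      qed (auto intro!: slow_growth_mult slow_growth_power slow_growth_ln c)
      finally show ?thesis .
    qed
    have "(deriv ^^ m) F 2 = (deriv ^^ k) (deriv F) 2"
      using Suc by (simp add: funpow_Suc_right del: funpow.simps)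
    also have "\<dots> = (deriv ^^ k) (\<lambda>s. F s * g s) 2"
      by (rule higher_deriv_transform_within_open[OF holo(3) _ S])
         (use holo deriv in \<open>auto intro!: holomorphic_intros simp: g_def S_def\<close>)
    also have "\<dots> = (\<Sum>i=0..k. of_nat (k choose i) * (deriv ^^ i) F 2 * (deriv ^^ (k - i)) g 2)"
      by (rule higher_deriv_mult[OF holo(1,2) S])
    finally have "(-1) ^ m * (deriv ^^ m) F 2 =
      (\<Sum>i=0..k. (-1) ^ m * (of_nat (k choose i) * (deriv ^^ i) F 2 * (deriv ^^ (k - i)) g 2))"
      by (simp add: sum_distrib_left)
    also have "\<dots> \<in> \<real>\<^sub>\<ge>\<^sub>0"
    proof (rule sum_nonneg_Reals)
      fix i assume i: "i \<in> {0..k}"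
      have "(-1) ^ m = (-1) ^ i * ((-1) ^ Suc (k - i) :: complex)"
        using i Suc by (simp flip: power_add)
      hence "(-1) ^ m * (of_nat (k choose i) * (deriv ^^ i) F 2 * (deriv ^^ (k - i)) g 2) =
         of_nat (k choose i) * ((-1) ^ i * (deriv ^^ i) F 2) * ((-1) ^ Suc (k - i) * (deriv ^^ (k - i)) g 2)"
        by (simp only: mult_ac)
      also have "\<dots> \<in> \<real>\<^sub>\<ge>\<^sub>0"
        using i Suc by (intro nonneg_Reals_mult_I g_sign less) auto
      finally show "(-1) ^ m * (of_nat (k choose i) * (deriv ^^ i) F 2 * (deriv ^^ (k - i)) g 2) \<in> \<real>\<^sub>\<ge>\<^sub>0" .
    qed
    finally show ?thesis .
  qed
qed

lemma higher_deriv_inverse_minus_1: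
  assumes "Re s > 1"
  shows   "(deriv ^^ m) (\<lambda>s. inverse (s - 1)) s = (-1) ^ m * fact m * inverse (s - 1) ^ Suc m"
  using assms
proof (induction m arbitrary: s)
  case (Suc m)
  have "eventually (\<lambda>z. z \<in> {z. Re z > 1}) (nhds s)"
    using Suc.prems by (intro eventually_nhds_in_open open_halfspace_Re_gt) auto
  hence ev: "eventually (\<lambda>z. (deriv ^^ m) (\<lambda>s. inverse (s - 1)) z = (-1) ^ m * fact m * inverse (z - 1) ^ Suc m) (nhds s)"
    by eventually_elim (use Suc.IH in simp)
  have s1: "s \<noteq> 1" using Suc.prems by auto
  have "((\<lambda>z. inverse (z - 1)) has_field_derivative -(inverse (s - 1) ^ 2)) (at s)"
    using s1 by (auto intro!: derivative_eq_intros simp: power2_eq_square)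
  from DERIV_cmult[OF DERIV_power_Suc[OF this, of m], of "(-1) ^ m * fact m"]
  have "deriv (\<lambda>z. (-1) ^ m * fact m * inverse (z - 1) ^ Suc m) s =
         (-1) ^ m * fact m * ((1 + of_nat m) * (-(inverse (s - 1) ^ 2) * inverse (s - 1) ^ m))"
    by (rule DERIV_imp_deriv)
  moreover have "(-1) ^ m * fact m * ((1 + of_nat m) * (-(inverse (s - 1) ^ 2) * inverse (s - 1) ^ m)) =
      (-1) ^ Suc m * fact (Suc m) * inverse (s - 1) ^ Suc (Suc m)"
    by (simp add: power2_eq_square mult_ac)
  ultimately show ?case
    using deriv_cong_ev[OF ev refl] by simp
qed simp

text \<open>
  The Taylor coefficients of \<open>F\<close> at 2 alternate in sign, because \<open>-F'/F\<close> has nonnegative coefficients. After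
  subtraction of the pole at 1 the series still converges at \<open>\<beta> < 1\<close>; its first \<open>M\<close> terms are bounded below by
  the signs and the others by Cauchy's inequality.
\<close>
lemma estermann:
  fixes P F :: "complex \<Rightarrow> complex"
  assumes P: "P holomorphic_on {s. Re s > 0}"
    and F: "\<And>s. Re s > 1 \<Longrightarrow> F s = P s / (s - 1)"
    and deriv: "\<And>s. Re s > 1 \<Longrightarrow> deriv F s = -(F s * dser c s)"
    and c: "slow_growth c" "\<And>n. c n \<in> \<real>\<^sub>\<ge>\<^sub>0"
    and F2: "F 2 \<in> \<real>\<^sub>\<ge>\<^sub>0" "norm (F 2) \<ge> 1"
    and B: "\<And>s. s \<in> cball 2 (4/3) \<Longrightarrow> norm (P s) \<le> B"
    and \<beta>: "3/4 \<le> \<beta>" "\<beta> < 1" and P\<beta>: "Re (P (of_real \<beta>)) \<ge> 0" and M: "M > 0"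
  shows   "Re (P 1) * (2 - \<beta>) ^ M / (1 - \<beta>) \<ge> 1 - 96 * B * (15/16) ^ M"
proof -
  define S where "S = {s. Re s > 1}"
  have S: "open S" "2 \<in> S" by (auto simp: S_def open_halfspace_Re_gt)
  \<comment> \<open>\<open>F\<close> minus its polar part P(1) / (s - 1), with the removable
    singularity at 1 filled in.\<close>
  define H where "H = (\<lambda>s. if s = 1 then deriv P 1 else (P s - P 1) / (s - 1))"
  have H_holo: "H holomorphic_on {s. Re s > 0}"
    unfolding H_def by (rule pole_lemma_open[OF P open_halfspace_Re_gt])
  have in_half: "Re s > 0" if "s \<in> cball 2 (4/3)" for s
    using that complex_Re_le_cmod[of "2 - s"] by (simp add: dist_norm)
  have H_holo': "H holomorphic_on ball 2 (4/3)"
    by (rule holomorphic_on_subset[OF H_holo]) (use in_half in auto)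
  have H_cont: "continuous_on (cball 2 (4/3)) H"
    by (rule continuous_on_subset[OF holomorphic_on_imp_continuous_on[OF H_holo]]) (use in_half in auto)
  have P1: "norm (P 1) \<le> B" by (rule B) (simp add: dist_norm)
  \<comment> \<open>The circle of radius 4/3 about 2 stays at distance at least 1/3 from 1, whence 2
    B / (1/3) = 6 B. Its disc contains \<open>\<beta>\<close>, at distance at most 5/4 from the
    centre.\<close>
  have H_bound: "norm (H s) \<le> 6 * B" if s: "norm (2 - s) = 4/3" for s
  proof -
    have "norm (2 - s) \<le> norm (1 - s) + norm (1 :: complex)"
      using norm_triangle_ineq[of "1 - s" 1] by simp
    hence far: "norm (s - 1) \<ge> 1/3" using s by (simp add: norm_minus_commute)
    hence "s \<noteq> 1" by auto
    hence "norm (H s) = norm (P s - P 1) / norm (s - 1)"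
      by (simp add: H_def norm_divide)
    also have "\<dots> \<le> (B + B) / (1/3)"
    proof (rule frac_le)
      show "norm (P s - P 1) \<le> B + B"
        using norm_triangle_ineq4[of "P s" "P 1"] B[of s] P1 s by (simp add: dist_norm)
    qed (use far P1 order_trans[OF norm_ge_zero P1] in auto)
    finally show ?thesis by simp
  qed
  define l where "l = Re (P 1)"
  \<comment> \<open>Real parts of the Taylor coefficients of \<open>H\<close> in powers of 2 - s.
    The pole contributes exactly -l to each, so the signs of the derivatives of \<open>F\<close>
    give b_m >= -l, and |F(2)| >= 1 improves this to 1 - l for m = 0.\<close>
  define b where "b = (\<lambda>m. Re ((-1) ^ m * (deriv ^^ m) H 2 / fact m))"
  have F_holo: "F holomorphic_on S"
  proof (rule holomorphic_transform)
    show "(\<lambda>s. P s / (s - 1)) holomorphic_on S"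
      by (intro holomorphic_intros holomorphic_on_subset[OF P]) (auto simp: S_def)
  qed (use F in \<open>auto simp: S_def\<close>)
  have derivs: "(deriv ^^ m) H 2 = (deriv ^^ m) F 2 - P 1 * ((-1) ^ m * fact m)" for m
  proof -
    have inv: "(\<lambda>s. inverse (s - 1)) holomorphic_on S"
      by (intro holomorphic_intros) (auto simp: S_def)
    have "(deriv ^^ m) H 2 = (deriv ^^ m) (\<lambda>s. F s - P 1 * inverse (s - 1)) 2"
    proof (rule higher_deriv_transform_within_open[OF _ _ S])
      show "H holomorphic_on S" by (rule holomorphic_on_subset[OF H_holo]) (auto simp: S_def)
      show "H w = F w - P 1 * inverse (w - 1)" if "w \<in> S" for w
        using that F[of w] by (auto simp: S_def H_def divide_inverse algebra_simps)
    qed (intro holomorphic_intros F_holo inv)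
    also have "\<dots> = (deriv ^^ m) F 2 - (deriv ^^ m) (\<lambda>s. P 1 * inverse (s - 1)) 2"
      by (rule higher_deriv_diff[OF F_holo _ S]) (intro holomorphic_intros inv)
    also have "(deriv ^^ m) (\<lambda>s. P 1 * inverse (s - 1)) 2 = P 1 * (deriv ^^ m) (\<lambda>s. inverse (s - 1)) 2"
      by (rule higher_deriv_cmult[OF inv S(2,1)])
    finally show ?thesis using higher_deriv_inverse_minus_1[of 2 m] by simp
  qed
  have b_eq: "b m = Re ((-1) ^ m * (deriv ^^ m) F 2) / fact m - l" for m
  proof -
    have "(-1) ^ m * (deriv ^^ m) H 2 = (-1) ^ m * (deriv ^^ m) F 2 - P 1 * fact m"
      unfolding derivs by (simp add: algebra_simps flip: power_mult_distrib)
    hence "(-1) ^ m * (deriv ^^ m) H 2 / fact m = (-1) ^ m * (deriv ^^ m) F 2 / of_real (fact m) - P 1"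
      by (simp add: diff_divide_distrib)
    thus ?thesis unfolding b_def l_def by (simp only: minus_complex.sel Re_divide_of_real)
  qed
  have sign: "Re ((-1) ^ m * (deriv ^^ m) F 2) \<ge> 0" for m
    using higher_deriv_sign_of_log_derivative[OF F_holo[unfolded S_def] deriv c F2(1), of m]
    by (simp add: complex_nonneg_Reals_iff)
  have b_ge: "b m \<ge> -l" for m
    using sign[of m] by (simp add: b_eq)
  have b_0: "b 0 \<ge> 1 - l"
    using F2 by (auto simp: b_eq elim!: nonneg_Reals_cases)
  define u where "u = 2 - \<beta>"
  have u: "u > 1" "u \<le> 5/4" "u - 1 = 1 - \<beta>" using \<beta> by (auto simp: u_def)
  \<comment> \<open>15/16 is the ratio of the largest distance 5/4 to the radius 4/3. Summing the
    geometric series from M on then yields the factor 6 * 16 = 96.\<close>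
  have b_abs: "\<bar>b m * u ^ m\<bar> \<le> 6 * B * (15/16) ^ m" for m
  proof -
    have "\<bar>b m\<bar> \<le> norm ((-1) ^ m * (deriv ^^ m) H 2 / fact m)"
      unfolding b_def by (rule abs_Re_le_cmod)
    also have "\<dots> = norm ((deriv ^^ m) H 2) / fact m"
      by (simp add: norm_divide norm_mult norm_power)
    also have "norm ((deriv ^^ m) H 2) \<le> fact m * (6 * B) / (4/3) ^ m"
      by (rule Cauchy_inequality[OF H_holo' H_cont _ H_bound]) auto
    hence "norm ((deriv ^^ m) H 2) / fact m \<le> (fact m * (6 * B) / (4/3) ^ m) / fact m"
      by (rule divide_right_mono) auto
    also have "\<dots> = 6 * B * (3/4) ^ m" by (simp add: power_divide)
    finally have "\<bar>b m\<bar> * u ^ m \<le> (6 * B * (3/4) ^ m) * (5/4) ^ m"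
      using u P1 order_trans[OF norm_ge_zero P1] by (intro mult_mono power_mono) auto
    also have "(6 * B * (3/4) ^ m) * (5/4) ^ m = 6 * B * (3/4 * (5/4)) ^ m"
      by (simp only: power_mult_distrib mult.assoc)
    finally show ?thesis using u by (simp add: abs_mult)
  qed
  have taylor: "(\<lambda>m. (deriv ^^ m) H 2 / fact m * (of_real \<beta> - 2) ^ m) sums H (of_real \<beta>)"
  proof (rule holomorphic_power_series[OF H_holo'])
    have "norm (of_real (2 - \<beta>) :: complex) < 4/3"
      unfolding norm_of_real using \<beta> by simp
    thus "complex_of_real \<beta> \<in> ball 2 (4/3)" by (simp add: dist_norm)
  qed
  have taylor_eq: "(deriv ^^ m) H 2 / fact m * (of_real \<beta> - 2) ^ m =
      (-1) ^ m * (deriv ^^ m) H 2 / fact m * of_real (u ^ m)" for m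
  proof -
    have "(of_real \<beta> - 2 :: complex) = -1 * of_real u" by (simp add: u_def)
    thus ?thesis by (simp only: power_mult_distrib of_real_power) (simp add: mult_ac)
  qed
  have "(\<lambda>m. Re ((-1) ^ m * (deriv ^^ m) H 2 / fact m * of_real (u ^ m))) sums Re (H (of_real \<beta>))"
    by (rule sums_Re[OF taylor[unfolded taylor_eq]])
  hence b_sums: "(\<lambda>m. b m * u ^ m) sums Re (H (of_real \<beta>))"
    by (simp only: b_def Re_complex_of_real Im_complex_of_real times_complex.sel mult_zero_right diff_zero)
  have geo: "(\<lambda>m. 6 * B * (15/16) ^ (m + M)) sums (96 * B * (15/16) ^ M)"
    using sums_mult[OF geometric_sums[of "15/16 :: real"], of "6 * B * (15/16) ^ M"]
    by (simp add: power_add mult_ac)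
  have "Re (H (of_real \<beta>)) = (\<Sum>m. b (m + M) * u ^ (m + M)) + (\<Sum>m<M. b m * u ^ m)"
    using suminf_split_initial_segment[OF sums_summable[OF b_sums], of M] b_sums by (simp add: sums_iff)
  moreover have "norm (\<Sum>m. b (m + M) * u ^ (m + M)) \<le> 96 * B * (15/16) ^ M"
  proof -
    have "norm (\<Sum>m. b (m + M) * u ^ (m + M)) \<le> (\<Sum>m. 6 * B * (15/16) ^ (m + M))"
      by (rule norm_suminf_le) (use b_abs sums_summable[OF geo] in auto)
    thus ?thesis using geo by (simp add: sums_iff)
  qed
  moreover have "(\<Sum>m<M. b m * u ^ m) \<ge> 1 - l * ((u ^ M - 1) / (u - 1))"
  proof -
    have "(\<Sum>m<M. (if m = 0 then 1 else 0) + (- l) * u ^ m) \<le> (\<Sum>m<M. b m * u ^ m)"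
    proof (rule sum_mono)
      fix m
      show "(if m = 0 then 1 else 0) + (- l) * u ^ m \<le> b m * u ^ m"
        using b_0 mult_right_mono[OF b_ge[of m], of "u ^ m"] u by auto
    qed
    moreover have "(\<Sum>m<M. (if m = 0 then 1 else 0) + (- l) * u ^ m) = 1 - l * (\<Sum>m<M. u ^ m)"
      using M by (simp add: sum_subtractf sum_distrib_left)
    ultimately show ?thesis using u geometric_sum[of u M] by simp
  qed
  ultimately have lower: "Re (H (of_real \<beta>)) \<ge> 1 - l * ((u ^ M - 1) / (u - 1)) - 96 * B * (15/16) ^ M"
    by (simp add: abs_le_iff)
  have "H (of_real \<beta>) = (P 1 - P (of_real \<beta>)) / of_real (1 - \<beta>)"
    using \<beta> minus_divide_divide[of "P 1 - P (of_real \<beta>)" "1 - of_real \<beta>"] by (simp add: H_def)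
  hence "Re (H (of_real \<beta>)) = (l - Re (P (of_real \<beta>))) / (1 - \<beta>)"
    by (simp only: Re_divide_of_real minus_complex.sel l_def)
  \<comment> \<open>The sign hypothesis at \<open>\<beta>\<close> discards the unknown value
    P(\<open>\<beta>\<close>). What remains combines with the finite geometric sum into l u^M / (1 -
    \<open>\<beta>\<close>).\<close>
  also have "\<dots> \<le> l / (1 - \<beta>)"
    using P\<beta> \<beta> by (intro divide_right_mono) auto
  finally have "l / (1 - \<beta>) + l * ((u ^ M - 1) / (1 - \<beta>)) \<ge> 1 - 96 * B * (15/16) ^ M"
    using lower u(3) by simp
  also have "l / (1 - \<beta>) + l * ((u ^ M - 1) / (1 - \<beta>)) = l * u ^ M / (1 - \<beta>)"
    by (simp add: algebra_simps diff_divide_distrib)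
  finally show ?thesis by (simp add: l_def u_def)
qed

subsection \<open>Siegel's theorem\<close>

lemma real_pos_of_nonzero_tendsto_1:
  fixes f :: "real \<Rightarrow> real"
  assumes cont: "continuous_on {a..} f" and nz: "\<And>x. x \<ge> a \<Longrightarrow> f x \<noteq> 0" and lim: "(f \<longlongrightarrow> 1) at_top"
  shows   "f a > 0"
proof (rule ccontr)
  assume "\<not>f a > 0"
  have "eventually (\<lambda>x. f x > 0) at_top"
    by (rule order_tendstoD(1)[OF lim]) simp
  hence "eventually (\<lambda>x. f x > 0 \<and> x \<ge> a) at_top"
    using eventually_ge_at_top[of a] by eventually_elim simp
  then obtain b where b: "f b > 0" "b \<ge> a"
    by (auto simp: eventually_at_top_linorder)
  have "\<exists>x. a \<le> x \<and> x \<le> b \<and> f x = 0"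
    by (rule IVT') (use b \<open>\<not>f a > 0\<close> in \<open>auto intro: continuous_on_subset[OF cont]\<close>)
  thus False using nz by blast
qed

text \<open>The number M of terms treated by sign is taken near 16 times the logarithm of the bound
  on the disc: the Cauchy tail is then at most 1/2, and (2 - \<open>\<beta>\<close>)^M is a small
  power of that bound. \<open>G\<close> stays abstract because it will be one L-function in one case
  and a product of three in the other; the positivity used is 1 + g(n) >= 0, and \<open>A\<close>
  absorbs the size of \<open>zeta_reg\<close> on the disc.\<close>

lemma estermann_lower_bound:
  obtains A :: real where "A \<ge> 1"
    "\<And>G g Bg \<beta>. G holomorphic_on UNIV \<Longrightarrow>
       (\<And>s. Re s > 1 \<Longrightarrow> deriv G s = -(G s * dser (\<lambda>n. mangoldt n * g n) s)) \<Longrightarrow>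
       (\<And>n. g n \<in> \<real>) \<Longrightarrow> (\<And>n. Re (g n) \<ge> -1) \<Longrightarrow> (\<And>n. norm (g n) \<le> 3) \<Longrightarrow>
       (\<And>t. t > 1 \<Longrightarrow> G (of_real t) \<in> \<real>) \<Longrightarrow> ((\<lambda>t. G (of_real t)) \<longlongrightarrow> 1) at_top \<Longrightarrow>
       Bg \<ge> 1 \<Longrightarrow> (\<And>s. s \<in> cball 2 (4/3) \<Longrightarrow> norm (G s) \<le> Bg) \<Longrightarrow> 3/4 \<le> \<beta> \<Longrightarrow> \<beta> < 1 \<Longrightarrow>
       Re (zeta_reg (of_real \<beta>) * G (of_real \<beta>)) \<ge> 0 \<Longrightarrow>
       Re (G 1) \<ge> (1 - \<beta>) / 6 * (A * Bg) powr (-16 * (1 - \<beta>))"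
proof -
  have in_half: "Re s > 0" if "s \<in> cball 2 (4/3)" for s
    using that complex_Re_le_cmod[of "2 - s"] by (simp add: dist_norm)
  have "continuous_on (cball 2 (4/3)) zeta_reg"
    by (rule continuous_on_subset[OF holomorphic_on_imp_continuous_on[OF holomorphic_zeta_reg]])
       (use in_half in auto)
  hence "bounded (zeta_reg ` cball 2 (4/3))"
    by (intro compact_imp_bounded compact_continuous_image) auto
  then obtain W where W: "\<And>s. s \<in> cball 2 (4/3) \<Longrightarrow> norm (zeta_reg s) \<le> W"
    unfolding bounded_iff by blast
  have W1: "W \<ge> 1" using W[of 1] zeta_reg_1 by (simp add: dist_norm)
  show ?thesis
  proof (rule that[of "192 * W"])
    show "192 * W \<ge> 1" using W1 by simp
    fix G :: "complex \<Rightarrow> complex" and g :: "nat \<Rightarrow> complex" and Bg \<beta> :: real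
    assume G: "G holomorphic_on UNIV"
      and dG: "\<And>s. Re s > 1 \<Longrightarrow> deriv G s = -(G s * dser (\<lambda>n. mangoldt n * g n) s)"
      and g: "\<And>n. g n \<in> \<real>" "\<And>n. Re (g n) \<ge> -1" "\<And>n. norm (g n) \<le> 3"
      and G_real: "\<And>t. t > 1 \<Longrightarrow> G (of_real t) \<in> \<real>" and lim: "((\<lambda>t. G (of_real t)) \<longlongrightarrow> 1) at_top"
      and Bg: "Bg \<ge> 1" "\<And>s. s \<in> cball 2 (4/3) \<Longrightarrow> norm (G s) \<le> Bg"
      and \<beta>: "3/4 \<le> \<beta>" "\<beta> < 1" and P\<beta>: "Re (zeta_reg (of_real \<beta>) * G (of_real \<beta>)) \<ge> 0"
    define Z where "Z = dser (\<lambda>_. 1)"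
    define F where "F = (\<lambda>s. Z s * G s)"
    define c where "c = (\<lambda>n. mangoldt n * (1 + g n))"
    have slow_g: "slow_growth g" using g(3) by (rule slow_growth_bounded)
    have slow_c: "slow_growth c"
    proof -
      have "norm (1 + g n) \<le> 4" for n using norm_triangle_ineq[of 1 "g n"] g(3)[of n] by simp
      thus ?thesis unfolding c_def
        by (intro slow_growth_mult slow_growth_mangoldt slow_growth_bounded)
    qed
    have c_nonneg: "c n \<in> \<real>\<^sub>\<ge>\<^sub>0" for n
    proof -
      have "1 + g n \<in> \<real>\<^sub>\<ge>\<^sub>0" "mangoldt n \<in> (\<real>\<^sub>\<ge>\<^sub>0 :: complex set)"
        using g(1,2)[of n] by (auto simp: complex_nonneg_Reals_iff complex_is_Real_iff mangoldt_nonneg)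
      thus ?thesis unfolding c_def by (intro nonneg_Reals_mult_I)
    qed
    have dF: "(F has_field_derivative -(F s * dser c s)) (at s)" if s: "Re s > 1" for s
    proof -
      have dG': "(G has_field_derivative -(G s * dser (\<lambda>n. mangoldt n * g n) s)) (at s)"
        using holomorphic_derivI[OF G, of s] dG[OF s] by simp
      have "dser c s = dser (\<lambda>n. mangoldt n * 1 + mangoldt n * g n) s"
        unfolding c_def by (simp add: algebra_simps)
      also have "\<dots> = dser (\<lambda>n. mangoldt n * 1) s + dser (\<lambda>n. mangoldt n * g n) s"
        by (rule dser_add) (use s slow_g slow_growth_mangoldt in \<open>auto intro: slow_growth_mult\<close>)
      finally have eq: "dser c s = dser (\<lambda>n. mangoldt n * 1) s + dser (\<lambda>n. mangoldt n * g n) s" .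
      have "(F has_field_derivative -(Z s * dser (\<lambda>n. mangoldt n * 1) s) * G s +
          -(G s * dser (\<lambda>n. mangoldt n * g n) s) * Z s) (at s)"
        unfolding F_def Z_def by (intro DERIV_mult dser_log_derivative completely_mult_1 s dG')
      thus ?thesis unfolding eq by (simp add: F_def algebra_simps)
    qed
    have limF: "((\<lambda>t. F (of_real t)) \<longlongrightarrow> 1) at_top"
      using tendsto_mult[OF tendsto_dser_at_top[OF completely_mult_1] lim] by (simp add: F_def Z_def)
    have normF: "norm (F (of_real t)) \<ge> 1" if t: "t > 1" for t
    proof (rule norm_ge_1_of_log_derivative[where K = "dser c", OF _ _ limF t])
      fix t :: real assume t: "t > 1"
      show "(F has_field_derivative -(F (of_real t) * dser c (of_real t))) (at (of_real t))"
        by (rule dF) (use t in simp)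
      show "Re (dser c (of_real t)) \<ge> 0"
        by (rule Re_dser_nonneg[OF slow_c t]) (use c_nonneg in \<open>simp add: complex_nonneg_Reals_iff\<close>)
    qed
    have F_real: "F (of_real t) \<in> \<real>" if t: "t > 1" for t
      unfolding F_def Z_def
      by (intro Reals_mult G_real dser_Reals t completely_mult_slow_growth completely_mult_1) auto
    \<comment> \<open>Right of 1 on the real axis \<open>F\<close> is real and at least 1 in
      modulus, so it keeps the sign of its limit 1.\<close>
    have "Re (F (of_real 2)) > 0"
    proof (rule real_pos_of_nonzero_tendsto_1[of 2 "\<lambda>t. Re (F (of_real t))"])
      have "continuous_on {s. Re s > 1} F"
        using dF by (intro holomorphic_on_imp_continuous_on)
          (auto simp: holomorphic_on_open open_halfspace_Re_gt)
      hence "continuous_on {2..} (\<lambda>t. F (complex_of_real t))"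
        by (rule continuous_on_compose2) (auto intro!: continuous_intros)
      thus "continuous_on {2..} (\<lambda>t. Re (F (complex_of_real t)))" by (intro continuous_intros)
      show "((\<lambda>t. Re (F (complex_of_real t))) \<longlongrightarrow> 1) at_top"
        using tendsto_Re[OF limF] by simp
      fix t :: real assume "t \<ge> 2"
      hence "norm (F (of_real t)) \<ge> 1" "F (of_real t) \<in> \<real>" by (auto intro: normF F_real)
      thus "Re (F (of_real t)) \<noteq> 0" by (auto elim!: Reals_cases)
    qed
    hence F2: "F 2 \<in> \<real>\<^sub>\<ge>\<^sub>0"
      using F_real[of 2] by (simp add: complex_nonneg_Reals_iff complex_is_Real_iff)
    define P where "P = (\<lambda>s. zeta_reg s * G s)"
    have P_holo: "P holomorphic_on {s. Re s > 0}"
      unfolding P_def by (intro holomorphic_intros holomorphic_zeta_reg holomorphic_on_subset[OF G]) auto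
    have FP: "F s = P s / (s - 1)" if "Re s > 1" for s
      using that zeta_reg_eq_dser[OF that] by (auto simp: F_def P_def Z_def)
    have PB: "norm (P s) \<le> W * Bg" if "s \<in> cball 2 (4/3)" for s
      unfolding P_def norm_mult using W[OF that] Bg(2)[OF that] W1 by (intro mult_mono) auto
    have dF': "deriv F s = -(F s * dser c s)" if "Re s > 1" for s
      using dF[OF that] by (rule DERIV_imp_deriv)
    have est: "Re (P 1) * (2 - \<beta>) ^ M / (1 - \<beta>) \<ge> 1 - 96 * (W * Bg) * (15/16) ^ M" if "M > 0" for M
      using estermann[OF P_holo FP dF' slow_c c_nonneg F2 _ PB \<beta> _ that] normF[of 2] P\<beta>
      by (simp add: P_def)
    \<comment> \<open>Twice the factor 96 W Bg in front of the tail. Since 15/16 <= exp(-1/16),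
      taking at least 16 ln y terms makes the tail at most 1/2.\<close>
    define y where "y = 192 * W * Bg"
    have y: "y \<ge> 1" using mult_mono[of 1 "192 * W" 1 Bg] W1 Bg by (simp add: y_def)
    define M where "M = nat \<lceil>16 * ln y\<rceil> + 1"
    have M: "M > 0" "real M \<ge> 16 * ln y" "real M \<le> 16 * ln y + 2"
    proof -
      have "16 * ln y \<ge> 0" using y by simp
      thus "real M \<ge> 16 * ln y" "real M \<le> 16 * ln y + 2" unfolding M_def by linarith+
    qed (simp add: M_def)
    have "y * (15/16) ^ M \<le> 1"
    proof -
      have "(15/16 :: real) \<le> exp (-1/16)"
        using exp_ge_add_one_self[of "-1/16 :: real"] by simp
      hence "(15/16 :: real) ^ M \<le> exp (-1/16) ^ M" by (intro power_mono) auto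
      also have "\<dots> = exp (-(real M / 16))" by (simp flip: exp_of_nat_mult)
      also have "\<dots> \<le> exp (-ln y)" using M(2) by simp
      also have "\<dots> = 1 / y" using y by (simp add: exp_minus divide_inverse)
      finally show ?thesis using y by (simp add: field_simps)
    qed
    hence "96 * (W * Bg) * (15/16) ^ M \<le> 1/2" by (simp add: y_def)
    hence half: "Re (P 1) * (2 - \<beta>) ^ M / (1 - \<beta>) \<ge> 1/2" using est[OF M(1)] by linarith
    have "(2 - \<beta>) ^ M \<le> exp (1 - \<beta>) ^ M"
      using \<beta> exp_ge_add_one_self[of "1 - \<beta>"] by (intro power_mono) auto
    also have "\<dots> = exp (real M * (1 - \<beta>))" by (simp flip: exp_of_nat_mult)
    also have "\<dots> \<le> exp ((16 * ln y + 2) * (1 - \<beta>))"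
      using M(3) \<beta> by (intro exp_mono mult_right_mono) auto
    also have "\<dots> = exp (2 * (1 - \<beta>)) * y powr (16 * (1 - \<beta>))"
      using y by (simp add: powr_def exp_add [symmetric] algebra_simps)
    also have "\<dots> \<le> 3 * y powr (16 * (1 - \<beta>))"
    proof (rule mult_right_mono)
      have "exp (2 * (1 - \<beta>)) \<le> exp 1" using \<beta> by (intro exp_mono) auto
      also have "\<dots> \<le> (3 :: real)" by (rule exp_le)
      finally show "exp (2 * (1 - \<beta>)) \<le> 3" .
    qed auto
    finally have up: "(2 - \<beta>) ^ M \<le> 3 * y powr (16 * (1 - \<beta>))" .
    have pos: "(2 - \<beta>) ^ M > 0" using \<beta> by simp
    have gen: "a / 6 * inverse z = a / 2 / (3 * z)" for a z :: real
      by (cases "z = 0") (auto simp: field_simps)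
    have inv: "y powr (-16 * (1 - \<beta>)) = inverse (y powr (16 * (1 - \<beta>)))"
      using powr_minus[of y "16 * (1 - \<beta>)"] by (simp only: mult_minus_left)
    have "(1 - \<beta>) / 6 * y powr (-16 * (1 - \<beta>)) = (1 - \<beta>) / 2 / (3 * y powr (16 * (1 - \<beta>)))"
      unfolding inv by (rule gen)
    also have "\<dots> \<le> (1 - \<beta>) / 2 / (2 - \<beta>) ^ M"
    proof (rule divide_left_mono[OF up])
      have "3 * y powr (16 * (1 - \<beta>)) > 0" using y by simp
      thus "0 < (3 * y powr (16 * (1 - \<beta>))) * (2 - \<beta>) ^ M" using pos by (rule mult_pos_pos)
    qed (use \<beta> in simp)
    also have "\<dots> \<le> Re (P 1)"
      using half \<beta> pos by (simp add: field_simps)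
    finally show "Re (G 1) \<ge> (1 - \<beta>) / 6 * (192 * W * Bg) powr (-16 * (1 - \<beta>))"
      by (simp add: P_def zeta_reg_1 y_def)
  qed
qed

section \<open>L-functions of real characters on the real axis, and products of characters\<close>

lemma dirichlet_L_Reals:
  assumes X: "dirichlet_character q X" "X \<noteq> principal_character q" and q: "q > 0"
    and real: "\<And>n. X n \<in> \<real>" and x: "x \<ge> 1/2"
  shows   "dirichlet_L X (of_real x) \<in> \<real>"
proof -
  define S where "S = (\<lambda>N. \<Sum>n=1..N. X n * of_nat n powr (-of_real x))"
  have "S N \<in> \<real>" for N
    unfolding S_def of_nat_powr_of_real by (intro sum_in_Reals Reals_mult real) auto
  moreover have "S \<longlonglongrightarrow> dirichlet_L X (of_real x)"
  proof -
    have "(\<lambda>N. 4 * real q * norm (complex_of_real x) / sqrt (real N)) \<longlonglongrightarrow> 0"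
      by (intro tendsto_divide_0[OF tendsto_const] filterlim_at_top_imp_at_infinity
            filterlim_compose[OF sqrt_at_top filterlim_real_sequentially])
    moreover have "eventually (\<lambda>N. norm (S N - dirichlet_L X (of_real x)) \<le> 4 * real q * norm (complex_of_real x) / sqrt (real N)) sequentially"
      using eventually_ge_at_top[of 1]
    proof eventually_elim
      case (elim N)
      thus ?case
        using dirichlet_L_minus_partial_sum_le[OF X q _ elim, of "of_real x"] x
        by (simp add: S_def norm_minus_commute)
    qed
    ultimately have "(\<lambda>N. S N - dirichlet_L X (of_real x)) \<longlonglongrightarrow> 0"
      by (rule Lim_null_comparison[rotated])
    thus ?thesis by (rule LIM_zero_cancel)
  qed
  ultimately show ?thesis
    using closed_sequentially[OF closed_complex_Reals, of S "dirichlet_L X (of_real x)"] by simp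
qed

text \<open>Comparison with the partial sum of length 1. A fixed power of q does no harm here,
  because this bound later enters with an exponent proportional to 1 -
  \<open>\<beta>\<close>.\<close>

lemma norm_dirichlet_L_disc_le:
  assumes X: "dirichlet_character q X" "X \<noteq> principal_character q" and q: "q > 0"
    and s: "s \<in> cball 2 (4/3)"
  shows   "norm (dirichlet_L X s) \<le> 15 * real q"
proof -
  have "Re s \<ge> 1/2"
    using s complex_Re_le_cmod[of "2 - s"] by (simp add: dist_norm)
  hence "norm (dirichlet_L X s - (\<Sum>n=1..1. X n * of_nat n powr (-s))) \<le> 4 * real q * norm s / sqrt (real 1)"
    by (intro dirichlet_L_minus_partial_sum_le[OF X q]) auto
  hence 1: "norm (dirichlet_L X s - 1) \<le> 4 * real q * norm s"
    using dirichlet_character_1[OF X(1)] by simp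
  have "norm s \<le> 10/3"
    using s norm_triangle_ineq2[of s 2] by (simp add: dist_norm norm_minus_commute)
  hence "4 * real q * norm s \<le> 4 * real q * (10/3)" by (intro mult_left_mono) auto
  hence "norm (dirichlet_L X s - 1) \<le> 40/3 * real q" using 1 by simp
  moreover have "norm (dirichlet_L X s) \<le> norm (dirichlet_L X s - 1) + 1"
    using norm_triangle_ineq[of "dirichlet_L X s - 1" 1] by simp
  moreover have "real q \<ge> 1" using q by simp
  ultimately show ?thesis by linarith
qed

lemma deriv_dirichlet_L:
  assumes X: "dirichlet_character q X" "X \<noteq> principal_character q" and q: "q > 0" and s: "Re s > 1"
  shows   "(dirichlet_L X has_field_derivative -(dirichlet_L X s * dser (\<lambda>n. mangoldt n * X n) s)) (at s)"
proof -
  have "(dser X has_field_derivative -(dser X s * dser (\<lambda>n. mangoldt n * X n) s)) (at s)"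
    by (intro dser_log_derivative completely_mult_dirichlet_character[OF X(1) q] s)
  moreover have "eventually (\<lambda>z. z \<in> {z. Re z > 1}) (nhds s)"
    using s by (intro eventually_nhds_in_open open_halfspace_Re_gt) auto
  hence "eventually (\<lambda>z. dser X z = dirichlet_L X z) (nhds s)"
    by eventually_elim (use dirichlet_L_eq_dser[OF X q] in simp)
  ultimately show ?thesis
    using DERIV_cong_ev[of s s "dser X" "dirichlet_L X"] dirichlet_L_eq_dser[OF X q s] by simp
qed

lemma tendsto_dirichlet_L_at_top:
  assumes X: "dirichlet_character q X" "X \<noteq> principal_character q" and q: "q > 0"
  shows   "((\<lambda>t. dirichlet_L X (of_real t)) \<longlongrightarrow> 1) at_top"
proof -
  have "eventually (\<lambda>t. dser X (of_real t) = dirichlet_L X (of_real t)) at_top"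
    using eventually_gt_at_top[of 1] by eventually_elim (use dirichlet_L_eq_dser[OF X q] in simp)
  thus ?thesis
    by (rule Lim_transform_eventually[OF tendsto_dser_at_top[OF completely_mult_dirichlet_character[OF X(1) q]]])
qed

text \<open>In \<open>three_four_one\<close> a product of modulus at least 1 cannot have a zero
  factor.\<close>

lemma dirichlet_L_nonzero_of_real_gt_1:
  assumes X: "dirichlet_character q X" "X \<noteq> principal_character q" and q: "q > 0"
    and t: "t > 1"
  shows   "dirichlet_L X (of_real t) \<noteq> 0"
proof -
  have "norm (X n) = 1" if "X n \<noteq> 0" for n
    using dirichlet_character_norm[OF X(1) q, of n] that by (auto split: if_splits)
  from three_four_one[OF completely_mult_dirichlet_character[OF X(1) q] this t]
  have "dser X (of_real t) \<noteq> 0" by auto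
  thus ?thesis using dirichlet_L_eq_dser[OF X q, of "of_real t"] t by simp
qed

text \<open>The Chinese remainder theorem gives an argument that is 1 modulo q and at which
  \<open>Y\<close> is neither 0 nor 1, so the product is not principal whatever \<open>X\<close>
  is.\<close>

lemma dirichlet_character_product:
  assumes X: "dirichlet_character q X" and Y: "dirichlet_character r Y" "Y \<noteq> principal_character r"
    and cop: "coprime q r" and pos: "q > 0" "r > 0"
  shows   "dirichlet_character (q * r) (\<lambda>n. X n * Y n)" "(\<lambda>n. X n * Y n) \<noteq> principal_character (q * r)"
proof -
  have per: "X (a + q * r) = X a" "Y (a + q * r) = Y a" for a
    using dirichlet_character_cong[OF X, of "a + q * r" a] dirichlet_character_cong[OF Y(1), of "a + q * r" a]
    by (auto simp: cong_def)
  show "dirichlet_character (q * r) (\<lambda>n. X n * Y n)"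
    unfolding dirichlet_character_def per
  proof (intro conjI allI refl)
    fix a b
    show "X (a * b) * Y (a * b) = X a * Y a * (X b * Y b)"
      unfolding dirichlet_character_mult[OF X] dirichlet_character_mult[OF Y(1)] by simp
    show "X a * Y a \<noteq> 0 \<longleftrightarrow> coprime a (q * r)"
      using dirichlet_character_eq_0_iff[OF X, of a] dirichlet_character_eq_0_iff[OF Y(1), of a] by simp
  qed
  obtain b where "Y b \<noteq> principal_character r b" using Y(2) by blast
  hence b: "coprime b r" "Y b \<noteq> 1"
    using dirichlet_character_eq_0_iff[OF Y(1), of b] by (auto simp: principal_character_def split: if_splits)
  obtain x where x: "[x = 1] (mod q)" "[x = b] (mod r)"
    using binary_chinese_remainder_nat[OF cop, of 1 b] by blast
  have "X x = 1"
    using dirichlet_character_cong[OF X x(1)] dirichlet_character_1[OF X] by simp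
  moreover have "Y x = Y b" by (rule dirichlet_character_cong[OF Y(1) x(2)])
  moreover have "coprime x q" using \<open>X x = 1\<close> dirichlet_character_eq_0_iff[OF X, of x] by auto
  moreover have "Y b \<noteq> 0" using b dirichlet_character_eq_0_iff[OF Y(1), of b] by auto
  hence "coprime x r" using \<open>Y x = Y b\<close> dirichlet_character_eq_0_iff[OF Y(1), of x] by auto
  ultimately have "X x * Y x \<noteq> principal_character (q * r) x"
    using b by (simp add: principal_character_def)
  thus "(\<lambda>n. X n * Y n) \<noteq> principal_character (q * r)" by (auto dest: fun_cong[of _ _ x])
qed

text \<open>
  Either no real character has a zero just left of 1, and Estermann's lemma applies to
  \<open>\<zeta>(s) L(s, X)\<close> at a point where this is negative; or one such zero \<open>\<beta>\<close> of some \<open>L(s, X\<^sub>1)\<close> serves for all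
  other characters, through \<open>\<zeta>(s) L(s, X\<^sub>1) L(s, X) L(s, X\<^sub>1 X)\<close>. The case \<open>L(1, X) = 0\<close> need not be excluded: there the
  quotient \<open>L'(1, X) / L(1, X)\<close> has the value 0 in HOL.
\<close>
lemma siegel:
  fixes \<epsilon> :: real
  assumes \<epsilon>: "\<epsilon> > 0"
  obtains c where "c > 0"
    "\<And>q X. prime q \<Longrightarrow> dirichlet_character q X \<Longrightarrow> X \<noteq> principal_character q \<Longrightarrow> (\<And>n. X n \<in> \<real>) \<Longrightarrow>
        dirichlet_L X 1 \<noteq> 0 \<Longrightarrow> norm (dirichlet_L X 1) \<ge> c * real q powr (-\<epsilon>)"
proof (rule estermann_lower_bound)
  fix A :: real assume A: "A \<ge> 1" and est:
    "\<And>G g Bg \<beta>. G holomorphic_on UNIV \<Longrightarrow>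
       (\<And>s. Re s > 1 \<Longrightarrow> deriv G s = -(G s * dser (\<lambda>n. mangoldt n * g n) s)) \<Longrightarrow>
       (\<And>n. g n \<in> \<real>) \<Longrightarrow> (\<And>n. Re (g n) \<ge> -1) \<Longrightarrow> (\<And>n. norm (g n) \<le> 3) \<Longrightarrow>
       (\<And>t. t > 1 \<Longrightarrow> G (of_real t) \<in> \<real>) \<Longrightarrow> ((\<lambda>t. G (of_real t)) \<longlongrightarrow> 1) at_top \<Longrightarrow>
       Bg \<ge> 1 \<Longrightarrow> (\<And>s. s \<in> cball 2 (4/3) \<Longrightarrow> norm (G s) \<le> Bg) \<Longrightarrow> 3/4 \<le> \<beta> \<Longrightarrow> \<beta> < 1 \<Longrightarrow>
       Re (zeta_reg (of_real \<beta>) * G (of_real \<beta>)) \<ge> 0 \<Longrightarrow>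
       Re (G 1) \<ge> (1 - \<beta>) / 6 * (A * Bg) powr (-16 * (1 - \<beta>))"
  have "isCont zeta_reg 1"
    by (rule continuous_on_interior[OF holomorphic_on_imp_continuous_on[OF holomorphic_zeta_reg]])
       (simp add: interior_open open_halfspace_Re_gt)
  hence "\<forall>e>0. \<exists>d>0. \<forall>x. dist x 1 < d \<longrightarrow> dist (zeta_reg x) (zeta_reg 1) < e"
    unfolding continuous_at_eps_delta .
  then obtain d0 where d0: "d0 > 0" "\<And>x. dist x 1 < d0 \<Longrightarrow> dist (zeta_reg x) 1 < 1"
    unfolding zeta_reg_1 using zero_less_one by blast
  have W_pos: "Re (zeta_reg (of_real x)) \<ge> 0" if "\<bar>x - 1\<bar> < d0" for x
  proof -
    have "dist (complex_of_real x) 1 = \<bar>x - 1\<bar>"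
      using dist_of_real[of x 1, where ?'a = complex] by (simp add: dist_real_def)
    hence "norm (1 - zeta_reg (of_real x)) < 1"
      using d0(2)[of "of_real x"] that by (simp add: dist_norm norm_minus_commute)
    thus ?thesis using complex_Re_le_cmod[of "1 - zeta_reg (of_real x)"] by simp
  qed
  \<comment> \<open>\<open>d0\<close> keeps the values of \<open>zeta_reg\<close> near 1 in the
    right half-plane, 1/4 is the range of Estermann's lemma, and 33 comes from the exponent 32 (1 -
    \<open>\<beta>\<close>) + \<open>\<eta>\<close> <= 33 \<open>\<eta>\<close> in the second
    case.\<close>
  define \<eta> where "\<eta> = min (min d0 (1/4)) (\<epsilon> / 33)"
  have \<eta>: "\<eta> > 0" "\<eta> \<le> d0" "\<eta> \<le> 1/4" "33 * \<eta> \<le> \<epsilon>"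
    using d0(1) \<epsilon> by (auto simp: \<eta>_def min_def)
  define R where "R = (\<lambda>q X. prime q \<and> dirichlet_character q X \<and> X \<noteq> principal_character q \<and> (\<forall>n. X n \<in> \<real>))"
  have R: "q > 0" "dirichlet_character q X" "X \<noteq> principal_character q" "\<And>n. X n \<in> \<real>"
    if "R q X" for q X
    using that prime_gt_0_nat[of q] by (auto simp: R_def)
  have val3: "X n = 0 \<or> X n = 1 \<or> X n = -1" if RX: "R q X" for q n and X :: "nat \<Rightarrow> complex"
  proof -
    obtain r where r: "X n = of_real r" using R(4)[OF RX, of n] by (auto elim!: Reals_cases)
    have "norm (X n) = 1 \<or> norm (X n) = 0"
      using dirichlet_character_norm[OF R(2,1)[OF RX], of n] by auto
    thus ?thesis using r by (auto simp: abs_if split: if_splits)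
  qed
  \<comment> \<open>It remains open which case holds, and in the second case the exceptional zero is
    not located: this is where the constant becomes ineffective.\<close>
  show ?thesis
  proof (cases "\<exists>q X \<beta>. R q X \<and> 1 - \<eta> < \<beta> \<and> \<beta> < 1 \<and> dirichlet_L X (of_real \<beta>) = 0")
    case False
    define \<beta> where "\<beta> = 1 - \<eta> / 2"
    have \<beta>: "3/4 \<le> \<beta>" "\<beta> < 1" "1 - \<eta> < \<beta>" "1 - \<beta> = \<eta> / 2" "\<bar>\<beta> - 1\<bar> < d0" using \<eta> by (auto simp: \<beta>_def)
    define c where "c = \<eta> / 12 * (15 * A) powr (-8 * \<eta>)"
    show ?thesis
    proof (rule that[of c])
      show "c > 0" using \<eta> A by (simp add: c_def)
      fix q X assume "prime q" "dirichlet_character q X" "X \<noteq> principal_character q" "\<And>n. X n \<in> \<real>"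
        and nz: "dirichlet_L X 1 \<noteq> 0"
      hence RX: "R q X" by (simp add: R_def)
      note X = R(2,3)[OF RX] R(1)[OF RX]
      have q1: "real q \<ge> 1" using X(3) by simp
      \<comment> \<open>There is no zero from \<open>\<beta>\<close> on: below 1 by the case
        assumption, at 1 by \<open>nz\<close>, beyond 1 by the 3-4-1 inequality. Hence the sign at
        \<open>\<beta>\<close> is that of the limit 1.\<close>
      have pos: "Re (dirichlet_L X (of_real \<beta>)) > 0"
      proof (rule real_pos_of_nonzero_tendsto_1[of \<beta> "\<lambda>t. Re (dirichlet_L X (of_real t))"])
        have "continuous_on {\<beta>..} (\<lambda>t. dirichlet_L X (of_real t))"
          using holomorphic_on_imp_continuous_on[OF dirichlet_L_nonprincipal(1)[OF X]]
          by (rule continuous_on_compose2) (auto intro!: continuous_intros)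
        thus "continuous_on {\<beta>..} (\<lambda>t. Re (dirichlet_L X (of_real t)))" by (intro continuous_intros)
        show "((\<lambda>t. Re (dirichlet_L X (of_real t))) \<longlongrightarrow> 1) at_top"
          using tendsto_Re[OF tendsto_dirichlet_L_at_top[OF X]] by simp
        fix t assume t: "t \<ge> \<beta>"
        have "dirichlet_L X (of_real t) \<noteq> 0"
        proof (cases t "1 :: real" rule: linorder_cases)
          case less
          thus ?thesis using False RX t \<beta>(3) by fastforce
        next
          case equal
          thus ?thesis using nz by simp
        next
          case greater
          thus ?thesis by (rule dirichlet_L_nonzero_of_real_gt_1[OF X])
        qed
        moreover have "dirichlet_L X (of_real t) \<in> \<real>"
          by (rule dirichlet_L_Reals[OF X R(4)[OF RX]]) (use t \<beta> in auto)
        ultimately show "Re (dirichlet_L X (of_real t)) \<noteq> 0" by (auto elim!: Reals_cases)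
      qed
      have L_real: "dirichlet_L X (of_real \<beta>) \<in> \<real>"
        by (rule dirichlet_L_Reals[OF X R(4)[OF RX]]) (use \<beta> in auto)
      have "Re (dirichlet_L X 1) \<ge> (1 - \<beta>) / 6 * (A * (15 * real q)) powr (-16 * (1 - \<beta>))"
      proof (rule est[where g = X])
        show "dirichlet_L X holomorphic_on UNIV" by (rule dirichlet_L_nonprincipal(1)[OF X])
        show "deriv (dirichlet_L X) s = -(dirichlet_L X s * dser (\<lambda>n. mangoldt n * X n) s)" if "Re s > 1" for s
          by (rule DERIV_imp_deriv[OF deriv_dirichlet_L[OF X that]])
        show "X n \<in> \<real>" for n by (rule R(4)[OF RX])
        show "Re (X n) \<ge> -1" "norm (X n) \<le> 3" for n using val3[OF RX, of n] by auto
        show "dirichlet_L X (of_real t) \<in> \<real>" if "t > 1" for t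
          by (rule dirichlet_L_Reals[OF X R(4)[OF RX]]) (use that in auto)
        show "((\<lambda>t. dirichlet_L X (of_real t)) \<longlongrightarrow> 1) at_top" by (rule tendsto_dirichlet_L_at_top[OF X])
        show "15 * real q \<ge> 1" using q1 by simp
        show "norm (dirichlet_L X s) \<le> 15 * real q" if "s \<in> cball 2 (4/3)" for s
          by (rule norm_dirichlet_L_disc_le[OF X that])
        \<comment> \<open>The factor s - 1 contained in \<open>zeta_reg\<close> is negative at
          \<open>\<beta>\<close>, so a negative value of zeta times L appears here as a nonnegative
          one.\<close>
        show "0 \<le> Re (zeta_reg (of_real \<beta>) * dirichlet_L X (of_real \<beta>))"
          using L_real W_pos[OF \<beta>(5)] pos by (auto elim!: Reals_cases)
      qed (rule \<beta>)+
      moreover have "(1 - \<beta>) / 6 * (A * (15 * real q)) powr (-16 * (1 - \<beta>)) = c * real q powr (-8 * \<eta>)"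
        using A q1 by (simp add: \<beta>(4) c_def powr_mult mult_ac)
      moreover have "c * real q powr (-\<epsilon>) \<le> c * real q powr (-8 * \<eta>)"
        using \<eta> \<open>c > 0\<close> q1 by (intro mult_left_mono powr_mono) auto
      ultimately show "norm (dirichlet_L X 1) \<ge> c * real q powr (-\<epsilon>)"
        using complex_Re_le_cmod[of "dirichlet_L X 1"] by linarith
    qed
  next
    case True
    then obtain q1 X1 \<beta> where RX1: "R q1 X1" and \<beta>: "1 - \<eta> < \<beta>" "\<beta> < 1" and zero: "dirichlet_L X1 (of_real \<beta>) = 0"
      by blast
    have \<beta>': "3/4 \<le> \<beta>" using \<beta> \<eta> by simp
    note X1 = R(2,3)[OF RX1] R(1)[OF RX1]
    have q1: "real q1 \<ge> 1" using X1(3) by simp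
    obtain K where K: "K > 0" "\<And>x. x \<ge> 1 \<Longrightarrow> (1 + ln x) ^ 1 \<le> K * x powr \<eta>"
      using ln_power_le_powr[OF \<eta>(1), of 1] by metis
    \<comment> \<open>What is left of the lower bound for G(1) once the power of q is split off; q1
      and \<open>\<beta>\<close> are fixed, so this is a constant.\<close>
    define a where "a = (1 - \<beta>) / 6 * (A * (15 ^ 3 * real q1 ^ 2)) powr (-16 * (1 - \<beta>))"
    have a: "a > 0" using \<beta> A q1 by (simp add: a_def)
    define b where "b = 10 * (1 + ln (real q1)) * (10 * (1 + ln (real q1)) * K)"
    have b: "b > 0" using q1 K by (simp add: b_def add_pos_nonneg)
    \<comment> \<open>The modulus q1 itself is treated apart, because the product character needs
      coprime moduli; it has finitely many characters, so the least nonzero |L(1, X)| serves as the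
      constant.\<close>
    define S where "S = {norm (dirichlet_L X 1) |X. dirichlet_character q1 X \<and> dirichlet_L X 1 \<noteq> 0}"
    have "finite S"
    proof -
      have "S \<subseteq> (\<lambda>X. norm (dirichlet_L X 1)) ` {X. dirichlet_character q1 X}" by (auto simp: S_def)
      thus ?thesis using finite_dirichlet_characters[OF X1(3)] finite_surj by blast
    qed
    define c where "c = min (a / b) (Min (insert 1 S))"
    have "c > 0" using a b \<open>finite S\<close> by (auto simp: c_def S_def)
    show ?thesis
    proof (rule that[OF \<open>c > 0\<close>])
      fix q X assume pq: "prime q" and X0: "dirichlet_character q X" "X \<noteq> principal_character q" "\<And>n. X n \<in> \<real>"
        and nz: "dirichlet_L X 1 \<noteq> 0"
      hence RX: "R q X" by (simp add: R_def)
      note X = R(2,3)[OF RX] R(1)[OF RX]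
      have q: "real q \<ge> 1" using X(3) by simp
      show "norm (dirichlet_L X 1) \<ge> c * real q powr (-\<epsilon>)"
      proof (cases "q = q1")
        case True
        have "c \<le> Min (insert 1 S)" by (simp add: c_def)
        also have "\<dots> \<le> norm (dirichlet_L X 1)"
          using \<open>finite S\<close> X(1) True nz by (intro Min_le) (auto simp: S_def)
        finally have "c \<le> norm (dirichlet_L X 1)" .
        moreover have "c * real q powr (-\<epsilon>) \<le> c * 1"
          using \<open>c > 0\<close> q \<epsilon> by (intro mult_left_mono) (auto simp: powr_minus intro!: inverse_le_1_iff[THEN iffD2] disjI2 ge_one_powr_ge_zero)
        ultimately show ?thesis by simp
      next
        case False
        hence cop: "coprime q1 q"
          using RX1 RX primes_coprime[of q1 q] by (auto simp: R_def)
        define Y where "Y = (\<lambda>n. X1 n * X n)"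
        have Y: "dirichlet_character (q1 * q) Y" "Y \<noteq> principal_character (q1 * q)" "q1 * q > 0"
          unfolding Y_def using dirichlet_character_product[OF X1(1) X(1,2) cop X1(3) X(3)] X1(3) X(3) by auto
        have Y_real: "Y n \<in> \<real>" for n unfolding Y_def by (intro Reals_mult R(4)[OF RX1] R(4)[OF RX])
        define G where "G = (\<lambda>s. dirichlet_L X1 s * dirichlet_L X s * dirichlet_L Y s)"
        define g where "g = (\<lambda>n. X1 n + X n + Y n)"
        define Bg where "Bg = (15 * real q1) * (15 * real q) * (15 * (real q1 * real q))"
        have slow: "slow_growth (\<lambda>n. mangoldt n * Z n)" if "dirichlet_character r Z" "r > 0" for r Z
          by (intro slow_growth_mult slow_growth_mangoldt completely_mult_slow_growth
                completely_mult_dirichlet_character[OF that])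
        have "Re (G 1) \<ge> (1 - \<beta>) / 6 * (A * Bg) powr (-16 * (1 - \<beta>))"
        proof (rule est[where g = g])
          show "G holomorphic_on UNIV"
            unfolding G_def by (intro holomorphic_intros dirichlet_L_nonprincipal(1)[OF X1]
                dirichlet_L_nonprincipal(1)[OF X] dirichlet_L_nonprincipal(1)[OF Y])
          show "deriv G s = -(G s * dser (\<lambda>n. mangoldt n * g n) s)" if s: "Re s > 1" for s
          proof (rule DERIV_imp_deriv)
            have "dser (\<lambda>n. mangoldt n * g n) s = dser (\<lambda>n. (mangoldt n * X1 n + mangoldt n * X n) + mangoldt n * Y n) s"
              by (simp add: g_def algebra_simps)
            also have "\<dots> = dser (\<lambda>n. mangoldt n * X1 n + mangoldt n * X n) s + dser (\<lambda>n. mangoldt n * Y n) s"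
            proof (rule dser_add[OF _ slow[OF Y(1,3)] s])
              have "norm (X1 n + X n) \<le> 2" for n
                using val3[OF RX1, of n] val3[OF RX, of n] by auto
              hence "slow_growth (\<lambda>n. mangoldt n * (X1 n + X n))"
                by (intro slow_growth_mult slow_growth_mangoldt slow_growth_bounded)
              thus "slow_growth (\<lambda>n. mangoldt n * X1 n + mangoldt n * X n)" by (simp add: algebra_simps)
            qed
            also have "dser (\<lambda>n. mangoldt n * X1 n + mangoldt n * X n) s =
                dser (\<lambda>n. mangoldt n * X1 n) s + dser (\<lambda>n. mangoldt n * X n) s"
              by (rule dser_add[OF slow[OF X1(1,3)] slow[OF X(1,3)] s])
            finally have eq: "dser (\<lambda>n. mangoldt n * g n) s = dser (\<lambda>n. mangoldt n * X1 n) s +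
                dser (\<lambda>n. mangoldt n * X n) s + dser (\<lambda>n. mangoldt n * Y n) s" .
            show "(G has_field_derivative -(G s * dser (\<lambda>n. mangoldt n * g n) s)) (at s)"
              unfolding G_def eq
              by (rule derivative_eq_intros deriv_dirichlet_L[OF X1 s] deriv_dirichlet_L[OF X s]
                    deriv_dirichlet_L[OF Y s] refl)+ (simp add: algebra_simps)
          qed
          show "g n \<in> \<real>" for n unfolding g_def by (intro Reals_add Y_real R(4)[OF RX1] R(4)[OF RX])
          \<comment> \<open>1 + g(n) factors as (1 + X1(n)) (1 + X(n)), and both factors are
            nonnegative because the values are 0, 1 or -1.\<close>
          show "Re (g n) \<ge> -1" "norm (g n) \<le> 3" for n
            unfolding g_def Y_def using val3[OF RX, of n] val3[OF RX1, of n] by auto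
          show "G (of_real t) \<in> \<real>" if "t > 1" for t
            unfolding G_def using that
            by (intro Reals_mult dirichlet_L_Reals[OF X1 R(4)[OF RX1]] dirichlet_L_Reals[OF X R(4)[OF RX]]
                  dirichlet_L_Reals[OF Y Y_real]) auto
          show "((\<lambda>t. G (of_real t)) \<longlongrightarrow> 1) at_top"
            unfolding G_def using tendsto_mult[OF tendsto_mult[OF tendsto_dirichlet_L_at_top[OF X1]
              tendsto_dirichlet_L_at_top[OF X]] tendsto_dirichlet_L_at_top[OF Y]] by simp
          show "Bg \<ge> 1"
          proof -
            have "1 * 1 * (1 * (1 * 1)) \<le> Bg"
              unfolding Bg_def using q1 q by (intro mult_mono mult_nonneg_nonneg) auto
            thus ?thesis by simp
          qed
          show "norm (G s) \<le> Bg" if s: "s \<in> cball 2 (4/3)" for s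
          proof -
            have "norm (dirichlet_L Y s) \<le> 15 * (real q1 * real q)"
              using norm_dirichlet_L_disc_le[OF Y s] by simp
            thus ?thesis unfolding G_def Bg_def norm_mult
              using norm_dirichlet_L_disc_le[OF X1 s] norm_dirichlet_L_disc_le[OF X s]
              by (intro mult_mono mult_nonneg_nonneg) auto
          qed
          show "0 \<le> Re (zeta_reg (of_real \<beta>) * G (of_real \<beta>))" using zero by (simp add: G_def)
        qed (rule \<beta>' \<beta>)+
        also have "(1 - \<beta>) / 6 * (A * Bg) powr (-16 * (1 - \<beta>)) = a * real q powr (-32 * (1 - \<beta>))"
        proof -
          have "A * Bg = (A * (15 ^ 3 * real q1 ^ 2)) * real q ^ 2"
            by (simp add: Bg_def power2_eq_square)
          hence "(A * Bg) powr (-16 * (1 - \<beta>)) =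
              (A * (15 ^ 3 * real q1 ^ 2)) powr (-16 * (1 - \<beta>)) * (real q ^ 2) powr (-16 * (1 - \<beta>))"
            by (simp only: powr_mult)
          also have "(real q ^ 2) powr (-16 * (1 - \<beta>)) = real q powr (-32 * (1 - \<beta>))"
          proof -
            have "real q ^ 2 = real q powr 2" using q by simp
            thus ?thesis by (simp only: powr_powr) (simp add: algebra_simps)
          qed
          finally show ?thesis by (simp add: a_def)
        qed
        finally have low: "a * real q powr (-32 * (1 - \<beta>)) \<le> norm (G 1)"
          using complex_Re_le_cmod[of "G 1"] by linarith
        \<comment> \<open>Upper bounds for the other two factors at 1 turn the lower bound for G(1)
          into one for L(1, X); the logarithm of q is paid for with q^\<open>\<eta>\<close>.\<close>
        have "norm (G 1) \<le> (10 * (1 + ln (real q1))) * norm (dirichlet_L X 1) *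
                 (10 * (1 + ln (real (q1 * q))))"
          unfolding G_def norm_mult
          using norm_dirichlet_L_le(1)[OF X1, of 1] norm_dirichlet_L_le(1)[OF Y, of 1] q1 q
          by (intro mult_mono mult_nonneg_nonneg) auto
        also have "1 + ln (real (q1 * q)) \<le> (1 + ln (real q1)) * (1 + ln (real q))"
          using q q1 by (simp add: ln_mult algebra_simps)
        hence "(10 * (1 + ln (real q1))) * norm (dirichlet_L X 1) * (10 * (1 + ln (real (q1 * q)))) \<le>
           (10 * (1 + ln (real q1))) * norm (dirichlet_L X 1) * (10 * ((1 + ln (real q1)) * (1 + ln (real q))))"
          using q1 by (intro mult_left_mono) auto
        also have "\<dots> \<le> (10 * (1 + ln (real q1))) * norm (dirichlet_L X 1) * (10 * ((1 + ln (real q1)) * (K * real q powr \<eta>)))"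
          using K(2)[OF q] q1 by (intro mult_left_mono) auto
        also have "\<dots> = b * norm (dirichlet_L X 1) * real q powr \<eta>"
          by (simp add: b_def mult_ac)
        finally have "a * real q powr (-32 * (1 - \<beta>)) \<le> b * norm (dirichlet_L X 1) * real q powr \<eta>"
          using low by linarith
        hence "a / b * (real q powr (-32 * (1 - \<beta>)) * real q powr (-\<eta>)) \<le> norm (dirichlet_L X 1)"
          using b q by (simp add: powr_minus field_simps)
        moreover have "c * real q powr (-\<epsilon>) \<le> a / b * (real q powr (-32 * (1 - \<beta>)) * real q powr (-\<eta>))"
          unfolding powr_add [symmetric]
          using \<open>c > 0\<close> q \<beta> \<eta> a b by (intro mult_mono powr_mono) (auto simp: c_def)
        ultimately show ?thesis by linarith
      qed
    qed
  qed
qed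

subsection \<open>Mean values of Dirichlet polynomials\<close>

definition dpoly :: "(nat \<Rightarrow> real) \<Rightarrow> nat \<Rightarrow> (nat \<Rightarrow> complex) \<Rightarrow> complex" where
  "dpoly a N X = (\<Sum>n=1..N. of_real (a n / real n) * X n)"

lemma norm_dpoly_le:
  assumes X: "\<And>n. norm (X n) \<le> 1" and a: "\<And>n. n \<in> {1..N} \<Longrightarrow> \<bar>a n\<bar> \<le> B" and N: "N \<ge> 1"
  shows   "norm (dpoly a N X) \<le> B * (1 + ln (real N))"
proof -
  have "norm (dpoly a N X) \<le> (\<Sum>n=1..N. B * (1 / real n))"
    unfolding dpoly_def
  proof (intro sum_norm_le)
    fix n assume n: "n \<in> {1..N}"
    have "norm (of_real (a n / real n) * X n) = \<bar>a n\<bar> * (1 / real n) * norm (X n)"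
      using n by (simp add: norm_mult norm_divide)
    also have "\<dots> \<le> B * (1 / real n) * 1"
      using X[of n] a[OF n] n by (intro mult_mono) auto
    finally show "norm (of_real (a n / real n) * X n) \<le> B * (1 / real n)" by simp
  qed
  also have "\<dots> = B * (\<Sum>n=1..N. 1 / real n)" by (simp add: sum_distrib_left)
  also have "\<dots> \<le> B * (1 + ln (real N))"
    using sum_inverse_le[OF N] order_trans[OF abs_ge_zero a[of 1]] N by (intro mult_left_mono) auto
  finally show ?thesis .
qed

text \<open>The n > m in the class of m are at least q, 2 q, 3 q, ..., which leaves a harmonic sum
  divided by q. This 1 / q compensates the factor q - 1 from orthogonality in the off-diagonal
  terms.\<close>

lemma sum_inverse_congruent_le:
  assumes q: "q > 0" and N: "N \<ge> 1"
  shows   "(\<Sum>n\<in>{n\<in>{1..N}. m < n \<and> [m = n] (mod q)}. 1 / real n) \<le> (1 + ln (real N)) / real q"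
proof -
  define S where "S = {n\<in>{1..N}. m < n \<and> [m = n] (mod q)}"
  define \<phi> where "\<phi> = (\<lambda>n. (n - m) div q)"
  have n_eq: "n = m + \<phi> n * q" if "n \<in> S" for n
  proof -
    have "q dvd n - m"
      using that cong_altdef_nat[of m n q] cong_altdef_nat[of n m q] by (auto simp: S_def cong_sym_eq)
    thus ?thesis using that by (auto simp: \<phi>_def S_def)
  qed
  have inj: "inj_on \<phi> S" using n_eq by (metis inj_onI)
  have img: "\<phi> n \<in> {1..N}" if "n \<in> S" for n
  proof -
    have "n > m" "n \<le> N" using that by (auto simp: S_def)
    moreover have "\<phi> n \<noteq> 0"
    proof
      assume "\<phi> n = 0"
      hence "m + \<phi> n * q = m" by simp
      thus False using n_eq[OF that] \<open>n > m\<close> by linarith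
    qed
    moreover have "\<phi> n \<le> n"
    proof -
      have "\<phi> n \<le> \<phi> n * q" using q by simp
      also have "\<phi> n * q \<le> n" using n_eq[OF that] by linarith
      finally show ?thesis .
    qed
    ultimately show ?thesis by simp
  qed
  have "(\<Sum>n\<in>S. 1 / real n) \<le> (\<Sum>n\<in>S. 1 / (real (\<phi> n) * real q))"
  proof (rule sum_mono)
    fix n assume n: "n \<in> S"
    have "real (\<phi> n) * real q \<le> real n"
      using arg_cong[OF n_eq[OF n], of real] by simp
    thus "1 / real n \<le> 1 / (real (\<phi> n) * real q)"
      using img[OF n] q n by (intro divide_left_mono mult_pos_pos) (auto simp: S_def)
  qed
  also have "\<dots> = (\<Sum>l\<in>\<phi> ` S. 1 / (real l * real q))"
    using inj by (simp add: sum.reindex)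
  also have "\<dots> \<le> (\<Sum>l=1..N. 1 / (real l * real q))"
    using img by (intro sum_mono2) auto
  also have "\<dots> = (\<Sum>l=1..N. 1 / real l) / real q"
    by (simp add: sum_divide_distrib)
  also have "\<dots> \<le> (1 + ln (real N)) / real q"
    using sum_inverse_le[OF N] by (intro divide_right_mono) auto
  finally show ?thesis by (simp add: S_def)
qed

text \<open>Orthogonality leaves the pairs congruent modulo q. Those with m = n form the main term;
  for the others the saving in \<open>sum_inverse_congruent_le\<close> cancels q - 1, so the length
  N enters only through its logarithm.\<close>

lemma mean_square_dpoly:
  assumes q: "prime (q :: nat)" and a: "\<And>n. n \<in> {1..N} \<Longrightarrow> \<bar>a n\<bar> \<le> B" and N: "N \<ge> 1"
  shows   "\<bar>(\<Sum>X | dirichlet_character q X. norm (dpoly a N X) ^ 2) -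
             (real q - 1) * (\<Sum>n\<in>{n\<in>{1..N}. coprime n q}. (a n / real n) ^ 2)\<bar> \<le> 2 * (B * (1 + ln (real N))) ^ 2"
proof -
  have q0: "q > 0" using q prime_gt_0_nat by auto
  define CH where "CH = {X. dirichlet_character q X}"
  define b where "b = (\<lambda>n. a n / real n)"
  define f where "f = (\<lambda>m n. if coprime m q \<and> [m = n] (mod q) then b m * b n * real (q - 1) else 0)"
  have "complex_of_real (\<Sum>X\<in>CH. norm (dpoly a N X) ^ 2) = (\<Sum>X\<in>CH. dpoly a N X * cnj (dpoly a N X))"
    by (simp only: of_real_sum complex_norm_square)
  also have "\<dots> = (\<Sum>X\<in>CH. \<Sum>m=1..N. \<Sum>n=1..N. of_real (b m * b n) * (X m * cnj (X n)))"
    unfolding dpoly_def cnj_sum sum_product b_def by (intro sum.cong refl) (simp add: mult_ac)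
  also have "\<dots> = (\<Sum>m=1..N. \<Sum>n=1..N. \<Sum>X\<in>CH. of_real (b m * b n) * (X m * cnj (X n)))"
    by (subst sum.swap, intro sum.cong refl, subst sum.swap, rule refl)
  also have "\<dots> = (\<Sum>m=1..N. \<Sum>n=1..N. of_real (f m n))"
  proof (intro sum.cong refl)
    fix m n
    have "(\<Sum>X\<in>CH. of_real (b m * b n) * (X m * cnj (X n))) = of_real (b m * b n) * (\<Sum>X\<in>CH. X m * cnj (X n))"
      by (rule sum_distrib_left [symmetric])
    also have "(\<Sum>X\<in>CH. X m * cnj (X n)) = (if coprime m q \<and> [m = n] (mod q) then of_nat (q - 1) else 0)"
      unfolding CH_def by (rule dirichlet_character_orthogonality[OF q])
    also have "of_real (b m * b n) * \<dots> = of_real (f m n)"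
      by (auto simp: f_def simp del: of_nat_diff)
    finally show "(\<Sum>X\<in>CH. of_real (b m * b n) * (X m * cnj (X n))) = complex_of_real (f m n)" .
  qed
  also have "\<dots> = complex_of_real (\<Sum>m=1..N. \<Sum>n=1..N. f m n)" by simp
  finally have total: "(\<Sum>X\<in>CH. norm (dpoly a N X) ^ 2) = (\<Sum>m=1..N. \<Sum>n=1..N. f m n)"
    using of_real_eq_iff by blast
  \<comment> \<open>Restricted to m < n, since the sum over a residue class is estimated beyond m;
    the pairs m > n are its transpose, whence the factor 2.\<close>
  define h where "h = (\<lambda>m n. if m < n \<and> [m = n] (mod q) then 1 / (real m * real n) else 0)"
  have qm: "real (q - 1) = real q - 1" using q0 by (simp add: of_nat_diff)
  have diag: "(\<Sum>m=1..N. f m m) = (real q - 1) * (\<Sum>n\<in>{n\<in>{1..N}. coprime n q}. (a n / real n) ^ 2)"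
  proof -
    have "(\<Sum>m=1..N. f m m) = (\<Sum>m\<in>{1..N}. if coprime m q then (real q - 1) * (a m / real m) ^ 2 else 0)"
      unfolding f_def qm b_def by (intro sum.cong refl) (simp add: power2_eq_square)
    also have "\<dots> = (\<Sum>n\<in>{n\<in>{1..N}. coprime n q}. (real q - 1) * (a n / real n) ^ 2)"
      by (rule sum.inter_filter [symmetric]) simp
    finally show ?thesis by (simp add: sum_distrib_left)
  qed
  have off: "\<bar>f m n - (if n = m then f m m else 0)\<bar> \<le> real q * B ^ 2 * (h m n + h n m)"
    if m: "m \<in> {1..N}" and n: "n \<in> {1..N}" for m n
  proof (cases "m \<noteq> n \<and> [m = n] (mod q)")
    case False
    have "h m n \<ge> 0" "h n m \<ge> 0" by (auto simp: h_def)
    thus ?thesis using False by (auto simp: f_def)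
  next
    case True
    hence "h m n + h n m = 1 / (real m * real n)"
      by (auto simp: h_def cong_sym_eq mult.commute)
    moreover have "\<bar>f m n\<bar> \<le> real q * B ^ 2 * (1 / (real m * real n))"
    proof -
      have "\<bar>f m n\<bar> \<le> \<bar>b m\<bar> * \<bar>b n\<bar> * real q"
        by (auto simp: f_def abs_mult qm intro!: mult_left_mono)
      also have "\<dots> = (\<bar>a m\<bar> * \<bar>a n\<bar>) * (1 / (real m * real n)) * real q"
        using m n by (simp add: b_def)
      also have "\<dots> \<le> (B * B) * (1 / (real m * real n)) * real q"
        using a[OF m] a[OF n] by (intro mult_right_mono mult_mono) auto
      finally show ?thesis by (simp add: power2_eq_square mult_ac)
    qed
    ultimately show ?thesis using True by auto
  qed
  have hsum: "(\<Sum>m=1..N. \<Sum>n=1..N. h m n) \<le> (1 + ln (real N)) ^ 2 / real q"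
  proof -
    have "(\<Sum>n=1..N. h m n) \<le> 1 / real m * ((1 + ln (real N)) / real q)" if m: "m \<in> {1..N}" for m
    proof -
      have "(\<Sum>n=1..N. h m n) = (\<Sum>n\<in>{n\<in>{1..N}. m < n \<and> [m = n] (mod q)}. 1 / (real m * real n))"
        unfolding h_def by (rule sum.inter_filter [symmetric]) simp
      also have "\<dots> = 1 / real m * (\<Sum>n\<in>{n\<in>{1..N}. m < n \<and> [m = n] (mod q)}. 1 / real n)"
        by (simp add: sum_distrib_left)
      also have "\<dots> \<le> 1 / real m * ((1 + ln (real N)) / real q)"
        using sum_inverse_congruent_le[OF q0 N, of m] by (intro mult_left_mono) auto
      finally show ?thesis .
    qed
    hence "(\<Sum>m=1..N. \<Sum>n=1..N. h m n) \<le> (\<Sum>m=1..N. 1 / real m * ((1 + ln (real N)) / real q))"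
      by (rule sum_mono)
    also have "\<dots> = (\<Sum>m=1..N. 1 / real m) * ((1 + ln (real N)) / real q)"
      by (rule sum_distrib_right [symmetric])
    also have "\<dots> \<le> (1 + ln (real N)) * ((1 + ln (real N)) / real q)"
      using sum_inverse_le[OF N] N by (intro mult_right_mono) auto
    finally show ?thesis by (simp add: power2_eq_square)
  qed
  have "\<bar>(\<Sum>m=1..N. \<Sum>n=1..N. f m n) - (\<Sum>m=1..N. f m m)\<bar> =
        \<bar>\<Sum>m=1..N. \<Sum>n=1..N. f m n - (if n = m then f m m else 0)\<bar>"
    by (simp add: sum_subtractf)
  also have "\<dots> \<le> (\<Sum>m=1..N. \<Sum>n=1..N. \<bar>f m n - (if n = m then f m m else 0)\<bar>)"
    by (intro order_trans[OF sum_abs] sum_mono order_trans[OF sum_abs] order.refl)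
  also have "\<dots> \<le> (\<Sum>m=1..N. \<Sum>n=1..N. real q * B ^ 2 * (h m n + h n m))"
    by (intro sum_mono off)
  also have "\<dots> = real q * B ^ 2 * ((\<Sum>m=1..N. \<Sum>n=1..N. h m n) + (\<Sum>m=1..N. \<Sum>n=1..N. h n m))"
    by (simp only: distrib_left sum.distrib sum_distrib_left)
  also have "(\<Sum>m=1..N. \<Sum>n=1..N. h n m) = (\<Sum>m=1..N. \<Sum>n=1..N. h m n)"
    by (rule sum.swap)
  also have "real q * B ^ 2 * ((\<Sum>m=1..N. \<Sum>n=1..N. h m n) + (\<Sum>m=1..N. \<Sum>n=1..N. h m n)) \<le>
       real q * B ^ 2 * ((1 + ln (real N)) ^ 2 / real q + (1 + ln (real N)) ^ 2 / real q)"
    using hsum by (intro mult_left_mono add_mono) auto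
  also have "\<dots> = 2 * (B * (1 + ln (real N))) ^ 2"
    using q0 by (simp add: power_mult_distrib)
  finally show ?thesis
    unfolding total[unfolded CH_def] diag .
qed

definition dconv :: "(nat \<Rightarrow> real) \<Rightarrow> (nat \<Rightarrow> real) \<Rightarrow> nat \<Rightarrow> real" where
  "dconv a b n = (\<Sum>d | d dvd n. a d * b (n div d))"

text \<open>Both coefficient sequences vanish beyond their lengths, so the product is exact: the
  rectangle of pairs lies in the region d e <= N M, and the pairs of that region outside the
  rectangle contribute 0.\<close>

lemma dpoly_mult:
  assumes X: "completely_mult X" and a: "\<And>n. n > N \<Longrightarrow> a n = 0" and b: "\<And>n. n > M \<Longrightarrow> b n = 0"
  shows   "dpoly a N X * dpoly b M X = dpoly (dconv a b) (N * M) X"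
proof -
  define g where "g = (\<lambda>(d,e). of_real (a d / real d) * X d * (of_real (b e / real e) * X e))"
  define Q where "Q = {(d,e). d \<ge> 1 \<and> e \<ge> 1 \<and> d * e \<le> N * M}"
  have mult: "X (i * j) = X i * X j" for i j using X by (simp add: completely_mult_def)
  have "finite Q"
  proof (rule finite_subset)
    show "Q \<subseteq> {..N * M} \<times> {..N * M}"
    proof
      fix p assume "p \<in> Q"
      then obtain d e where p: "p = (d, e)" "d \<ge> 1" "e \<ge> 1" "d * e \<le> N * M" by (auto simp: Q_def)
      have "d \<le> N * M" by (rule order_trans[OF _ p(4)]) (use p in simp)
      moreover have "e \<le> N * M" by (rule order_trans[OF _ p(4)]) (use p in simp)
      ultimately show "p \<in> {..N * M} \<times> {..N * M}" using p(1) by simp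
    qed
  qed auto
  have "dpoly (dconv a b) (N * M) X = (\<Sum>n=1..N*M. \<Sum>d | d dvd n. g (d, n div d))"
    unfolding dpoly_def
  proof (intro sum.cong refl)
    fix n assume n: "n \<in> {1..N*M}"
    have "of_real (dconv a b n / real n) * X n = (\<Sum>d | d dvd n. of_real (a d * b (n div d) / real n) * X n)"
      unfolding dconv_def by (simp add: sum_divide_distrib sum_distrib_right)
    also have "\<dots> = (\<Sum>d | d dvd n. g (d, n div d))"
    proof (intro sum.cong refl)
      fix d assume "d \<in> {d. d dvd n}"
      then obtain e where e: "n = d * e" by auto
      hence d: "d > 0" "e > 0" "n div d = e" using n by (auto intro!: Nat.gr0I)
      have "a d * b e / real n = a d / real d * (b e / real e)" using d by (simp add: e)
      moreover have "X n = X d * X e" by (simp add: e mult)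
      ultimately show "of_real (a d * b (n div d) / real n) * X n = g (d, n div d)"
        unfolding d(3) g_def by (simp only: of_real_mult prod.case mult_ac)
    qed
    finally show "of_real (dconv a b n / real n) * X n = (\<Sum>d | d dvd n. g (d, n div d))" .
  qed
  also have "\<dots> = (\<Sum>(n,d)\<in>(SIGMA n:{1..N*M}. {d. d dvd n}). g (d, n div d))"
    by (rule sum.Sigma) auto
  also have "\<dots> = (\<Sum>p\<in>Q. g p)"
    by (rule sum.reindex_bij_witness[of _ "\<lambda>(d,e). (d * e, d)" "\<lambda>(n,d). (d, n div d)"])
       (auto simp: Q_def Suc_le_eq intro!: Nat.gr0I)
  also have "\<dots> = (\<Sum>p\<in>{1..N} \<times> {1..M}. g p)"
  proof (rule sum.mono_neutral_right)
    show "{1..N} \<times> {1..M} \<subseteq> Q" by (auto simp: Q_def intro: mult_le_mono)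
    show "\<forall>p\<in>Q - {1..N} \<times> {1..M}. g p = 0"
    proof
      fix p assume "p \<in> Q - {1..N} \<times> {1..M}"
      then obtain d e where p: "p = (d, e)" "(d, e) \<in> Q" "(d, e) \<notin> {1..N} \<times> {1..M}" by (cases p) auto
      hence "d > N \<or> e > M" unfolding Q_def by (simp add: not_le)
      thus "g p = 0" using a[of d] b[of e] p(1) by (auto simp: g_def)
    qed
  qed (rule \<open>finite Q\<close>)
  also have "\<dots> = dpoly a N X * dpoly b M X"
    unfolding dpoly_def sum_product by (simp add: sum.cartesian_product g_def case_prod_unfold)
  finally show ?thesis ..
qed

section \<open>Powers of the truncated prime sum\<close>

definition mangoldt_trunc :: "nat \<Rightarrow> nat \<Rightarrow> real" where
  "mangoldt_trunc q n = (if n \<le> q then mangoldt n else 0)"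

fun mangoldt_trunc_conv :: "nat \<Rightarrow> nat \<Rightarrow> nat \<Rightarrow> real" where
  "mangoldt_trunc_conv q 0 = (\<lambda>n. if n = 1 then 1 else 0)"
| "mangoldt_trunc_conv q (Suc k) = dconv (mangoldt_trunc q) (mangoldt_trunc_conv q k)"

lemma mangoldt_trunc_bounds:
  assumes "n \<ge> 1"
  shows   "0 \<le> mangoldt_trunc q n" "mangoldt_trunc q n \<le> mangoldt n" "mangoldt_trunc q n \<le> ln (real n)"
  using assms mangoldt_le_ln[of n] by (auto simp: mangoldt_trunc_def mangoldt_nonneg)

lemma mangoldt_conv_0: "mangoldt_conv 0 m = (if m = 1 then 1 else 0)"
proof -
  have "factorizations 0 m = (if m = 1 then {[]} else {})"
    by (auto simp: factorizations_def)
  thus ?thesis by (simp add: mangoldt_conv_def)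
qed

text \<open>All divisors of n <= q are at most q, so the cut-off is invisible there; beyond q it
  only removes nonnegative terms.\<close>

lemma mangoldt_trunc_conv_bounds:
  assumes "n \<ge> 1"
  shows   "0 \<le> mangoldt_trunc_conv q k n \<and> mangoldt_trunc_conv q k n \<le> mangoldt_conv k n \<and>
           (n \<le> q \<longrightarrow> mangoldt_trunc_conv q k n = mangoldt_conv k n)"
  using assms
proof (induction k arbitrary: n)
  case 0
  show ?case by (simp add: mangoldt_conv_0)
next
  case (Suc k)
  have pos: "d \<ge> 1" "n div d \<ge> 1" "d \<le> n" "n div d \<le> n" if "d dvd n" for d
    using that Suc.prems by (auto elim!: dvdE simp: Suc_le_eq intro!: Nat.gr0I)
  have eq: "mangoldt_conv (Suc k) n = (\<Sum>d | d dvd n. mangoldt d * mangoldt_conv k (n div d))"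
    using Suc.prems by (intro mangoldt_conv_Suc) auto
  have "0 \<le> mangoldt_trunc_conv q (Suc k) n"
    unfolding mangoldt_trunc_conv.simps dconv_def
    using Suc.IH pos by (intro sum_nonneg mult_nonneg_nonneg mangoldt_trunc_bounds) auto
  moreover have "mangoldt_trunc_conv q (Suc k) n \<le> mangoldt_conv (Suc k) n"
    unfolding eq mangoldt_trunc_conv.simps dconv_def
    using Suc.IH pos by (intro sum_mono mult_mono mangoldt_trunc_bounds mangoldt_nonneg) auto
  moreover have "mangoldt_trunc_conv q (Suc k) n = mangoldt_conv (Suc k) n" if "n \<le> q"
    unfolding eq mangoldt_trunc_conv.simps dconv_def
  proof (intro sum.cong refl)
    fix d assume "d \<in> {d. d dvd n}"
    hence d: "d dvd n" by simp
    have "mangoldt_trunc q d = mangoldt d" using pos[OF d] that by (simp add: mangoldt_trunc_def)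
    moreover have "mangoldt_trunc_conv q k (n div d) = mangoldt_conv k (n div d)"
      using Suc.IH[OF pos(2)[OF d]] pos[OF d] that by simp
    ultimately show "mangoldt_trunc q d * mangoldt_trunc_conv q k (n div d) = mangoldt d * mangoldt_conv k (n div d)"
      by simp
  qed
  ultimately show ?case by blast
qed

text \<open>Each factor of the convolution is supported up to q. The exponent \<open>Suc k\<close>
  is generous for the support, but with it the range contains 1, ..., q - 1 for k = 0 as well, as
  \<open>main_term_truncation\<close> requires.\<close>

lemma mangoldt_trunc_conv_eq_0:
  assumes "q \<ge> 1" "n > q ^ Suc k"
  shows   "mangoldt_trunc_conv q k n = 0"
  using assms(2)
proof (induction k arbitrary: n)
  case 0
  thus ?case using assms(1) by auto
next
  case (Suc k)
  have "mangoldt_trunc q d * mangoldt_trunc_conv q k (n div d) = 0" if dvd: "d dvd n" for d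
  proof (cases "d \<le> q")
    case True
    obtain e where e: "n = d * e" using dvd by auto
    have "q * q ^ Suc k < d * e" using Suc.prems e by simp
    also have "\<dots> \<le> q * e" using True by simp
    finally have "q ^ Suc k < e" by simp
    moreover have "n div d = e" using e Suc.prems by (cases "d = 0") auto
    ultimately show ?thesis using Suc.IH[of e] by simp
  qed (simp add: mangoldt_trunc_def)
  thus ?case by (auto simp: dconv_def intro!: sum.neutral)
qed

text \<open>Turns the 2 k-th moment of the prime sum into the mean square of a single polynomial, so
  that \<open>mean_square_dpoly\<close> applies.\<close>

lemma dpoly_mangoldt_power:
  assumes X: "completely_mult X" and q: "q \<ge> 1"
  shows   "dpoly (mangoldt_trunc q) q X ^ k = dpoly (mangoldt_trunc_conv q k) (q ^ Suc k) X"
proof (induction k)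
  case 0
  have "dpoly (mangoldt_trunc_conv q 0) (q ^ Suc 0) X = (\<Sum>n=1..q. if n = 1 then 1 else 0)"
    unfolding dpoly_def using X by (intro sum.cong) (auto simp: completely_mult_def)
  thus ?case using q by simp
next
  case (Suc k)
  have "dpoly (mangoldt_trunc q) q X * dpoly (mangoldt_trunc_conv q k) (q ^ Suc k) X =
        dpoly (dconv (mangoldt_trunc q) (mangoldt_trunc_conv q k)) (q * q ^ Suc k) X"
    using mangoldt_trunc_conv_eq_0[OF q] by (intro dpoly_mult X) (auto simp: mangoldt_trunc_def)
  thus ?case using Suc by simp
qed

lemma norm_dpoly_mangoldt_le:
  assumes X: "\<And>n. norm (X n) \<le> 1" and q: "q \<ge> 1"
  shows   "norm (dpoly (mangoldt_trunc q) q X) \<le> (1 + ln (real q)) ^ 2"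
proof -
  have "norm (dpoly (mangoldt_trunc q) q X) \<le> ln (real q) * (1 + ln (real q))"
  proof (rule norm_dpoly_le[OF X _ q])
    fix n assume n: "n \<in> {1..q}"
    hence n1: "n \<ge> 1" and "ln (real n) \<le> ln (real q)" by simp_all
    thus "\<bar>mangoldt_trunc q n\<bar> \<le> ln (real q)"
      using mangoldt_trunc_bounds(1,3)[OF n1, of q] by linarith
  qed
  also have "\<dots> \<le> (1 + ln (real q)) * (1 + ln (real q))"
    using q by (intro mult_right_mono) auto
  finally show ?thesis by (simp add: power2_eq_square)
qed

section \<open>The error of the approximation by the prime sum\<close>

lemma sum_inverse_square_tail_le:
  assumes "q \<ge> 1"
  shows   "(\<Sum>n\<in>{q<..M}. 1 / real n ^ 2) \<le> 1 / real q"
proof (cases "M \<ge> q")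
  case True
  have "(\<Sum>n\<in>{q<..M}. 1 / real n ^ 2) \<le> 1 / real q - 1 / real M"
    using True
  proof (induction M rule: dec_induct)
    case (step M)
    have M: "real M > 0" using step assms by simp
    have "1 / real (Suc M) ^ 2 \<le> 1 / (real M * real (Suc M))"
      using M by (intro divide_left_mono) (auto simp: power2_eq_square)
    also have "\<dots> = 1 / real M - 1 / real (Suc M)" using M by (simp add: field_simps)
    finally have "1 / real (Suc M) ^ 2 \<le> 1 / real M - 1 / real (Suc M)" .
    moreover have "{q<..Suc M} = insert (Suc M) {q<..M}" using step by auto
    ultimately show ?case using step.IH by simp
  qed simp
  thus ?thesis by (smt (verit) divide_nonneg_nonneg of_nat_0_le_iff)
qed simp

text \<open>Coefficients of L_N(X) P(X) - D_N(X) with N = q^6, where L_N and D_N are the partial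
  sums for L(1, X) and -L'(1, X). The cut-offs at q^6 belong to the coefficients, so this difference
  is exactly a \<open>dpoly\<close> of length q^7.\<close>

definition error_coeff :: "nat \<Rightarrow> nat \<Rightarrow> real" where
  "error_coeff q n = dconv (mangoldt_trunc q) (\<lambda>n. if n \<le> q ^ 6 then 1 else 0) n -
                     (if n \<le> q ^ 6 then ln (real n) else 0)"

text \<open>Both parts lie between 0 and ln n, hence the bound for their difference. For n <= q no
  cut-off acts on a divisor of n, and the parts agree because Lambda sums to ln n over the
  divisors.\<close>

lemma error_coeff_bounds:
  assumes n: "n \<ge> 1" and q: "q \<ge> 1"
  shows   "\<bar>error_coeff q n\<bar> \<le> ln (real n)" "n \<le> q \<Longrightarrow> error_coeff q n = 0"
proof -
  define D where "D = dconv (mangoldt_trunc q) (\<lambda>n. if n \<le> q ^ 6 then 1 else 0) n"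
  have ln_eq: "ln (real n) = (\<Sum>d | d dvd n. mangoldt d)"
    using n mangoldt_sum[of n, where ?'a = real] by simp
  have pos: "d \<ge> 1" "d \<le> n" "n div d \<le> n" if "d dvd n" for d
    using that n by (auto elim!: dvdE simp: Suc_le_eq intro!: Nat.gr0I)
  have "D \<ge> 0"
    unfolding D_def dconv_def using pos by (intro sum_nonneg mult_nonneg_nonneg mangoldt_trunc_bounds) auto
  moreover have "D \<le> ln (real n)"
    unfolding D_def dconv_def ln_eq
  proof (intro sum_mono)
    fix d assume "d \<in> {d. d dvd n}"
    thus "mangoldt_trunc q d * (if n div d \<le> q ^ 6 then 1 else 0) \<le> mangoldt d"
      using mangoldt_trunc_bounds[OF pos(1)[of d], of q] mangoldt_nonneg[of d] by auto
  qed
  moreover have "ln (real n) \<ge> 0" using n by simp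
  ultimately show "\<bar>error_coeff q n\<bar> \<le> ln (real n)" by (auto simp: error_coeff_def D_def)
  assume "n \<le> q"
  moreover have "q ^ 1 \<le> q ^ 6" using q by (intro power_increasing) auto
  ultimately have nq: "n \<le> q" "n \<le> q ^ 6" by auto
  have "D = ln (real n)"
    unfolding D_def dconv_def ln_eq
  proof (intro sum.cong refl)
    fix d assume "d \<in> {d. d dvd n}"
    hence d: "d dvd n" by simp
    have "d \<le> q" "n div d \<le> q ^ 6"
      using order_trans[OF pos(2)[OF d] nq(1)] order_trans[OF pos(3)[OF d] nq(2)] by blast+
    thus "mangoldt_trunc q d * (if n div d \<le> q ^ 6 then 1 else 0) = mangoldt d"
      by (simp add: mangoldt_trunc_def)
  qed
  thus "error_coeff q n = 0" using nq by (simp add: error_coeff_def D_def)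
qed

text \<open>The diagonal starts beyond q, where the sum of 1 / n^2 is at most 1 / q and cancels the
  number of characters; the off-diagonal terms are a power of the logarithm in any case. The length
  q^7 gives 1 + B <= 7 l, and 3 * 7^4 = 7203.\<close>

lemma mean_square_error_coeff:
  assumes q: "prime (q :: nat)"
  shows   "(\<Sum>X | dirichlet_character q X. norm (dpoly (error_coeff q) (q ^ 7) X) ^ 2) \<le> 7203 * (1 + ln (real q)) ^ 4"
proof -
  have q1: "q \<ge> 1" using q prime_ge_1_nat by auto
  define l where "l = 1 + ln (real q)"
  define N where "N = q ^ 7"
  define B where "B = ln (real N)"
  have N: "N \<ge> 1" using q1 by (simp add: N_def)
  have B: "B \<ge> 0" "1 + B \<le> 7 * l" using q1 by (auto simp: B_def N_def l_def ln_realpow)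
  have a: "\<bar>error_coeff q n\<bar> \<le> B" if "n \<in> {1..N}" for n
  proof -
    have "\<bar>error_coeff q n\<bar> \<le> ln (real n)" using that q1 by (intro error_coeff_bounds) auto
    also have "\<dots> \<le> B" using that by (simp add: B_def)
    finally show ?thesis .
  qed
  have "(\<Sum>n\<in>{n\<in>{1..N}. coprime n q}. (error_coeff q n / real n) ^ 2) \<le> (\<Sum>n\<in>{1..N}. (error_coeff q n / real n) ^ 2)"
    by (intro sum_mono2) auto
  also have "\<dots> = (\<Sum>n\<in>{q<..N}. (error_coeff q n / real n) ^ 2)"
  proof (rule sum.mono_neutral_right)
    show "\<forall>n\<in>{1..N} - {q<..N}. (error_coeff q n / real n) ^ 2 = 0"
      using error_coeff_bounds(2) q1 by auto
  qed (use q1 in auto)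
  also have "\<dots> \<le> (\<Sum>n\<in>{q<..N}. B ^ 2 * (1 / real n ^ 2))"
  proof (rule sum_mono)
    fix n assume n: "n \<in> {q<..N}"
    have "(error_coeff q n) ^ 2 \<le> B ^ 2"
      using a[of n] n q1 B by (intro abs_le_square_iff[THEN iffD1]) auto
    hence "(error_coeff q n) ^ 2 / real n ^ 2 \<le> B ^ 2 / real n ^ 2" by (rule divide_right_mono) simp
    thus "(error_coeff q n / real n) ^ 2 \<le> B ^ 2 * (1 / real n ^ 2)" by (simp add: power_divide)
  qed
  also have "\<dots> = B ^ 2 * (\<Sum>n\<in>{q<..N}. 1 / real n ^ 2)" by (simp add: sum_distrib_left)
  also have "\<dots> \<le> B ^ 2 * (1 / real q)"
    using sum_inverse_square_tail_le[OF q1] by (intro mult_left_mono) auto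
  finally have "(real q - 1) * (\<Sum>n\<in>{n\<in>{1..N}. coprime n q}. (error_coeff q n / real n) ^ 2) \<le> real q * (B ^ 2 * (1 / real q))"
    using q1 by (intro mult_mono sum_nonneg) auto
  also have "\<dots> = B ^ 2 * 1" using q1 by simp
  also have "\<dots> \<le> (1 + B) ^ 2 * (1 + B) ^ 2" using B by (intro mult_mono power_mono one_le_power) auto
  finally have 1: "(real q - 1) * (\<Sum>n\<in>{n\<in>{1..N}. coprime n q}. (error_coeff q n / real n) ^ 2) \<le> (1 + B) ^ 4"
    by (simp flip: power_add)
  have "(B * (1 + B)) ^ 2 \<le> ((1 + B) * (1 + B)) ^ 2" using B by (intro power_mono mult_right_mono) auto
  hence 2: "2 * (B * (1 + ln (real N))) ^ 2 \<le> 2 * (1 + B) ^ 4"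
    unfolding B_def by (simp add: power2_eq_square power4_eq_xxxx mult_ac)
  have "(\<Sum>X | dirichlet_character q X. norm (dpoly (error_coeff q) N X) ^ 2) \<le> 3 * (1 + B) ^ 4"
    using mean_square_dpoly[of q N "error_coeff q" B, OF q a N] 1 2 by (simp add: abs_le_iff)
  also have "\<dots> \<le> 3 * (7 * l) ^ 4"
    using B by (intro mult_left_mono power_mono) auto
  also have "\<dots> = 7203 * l ^ 4" by (simp add: power_mult_distrib)
  finally show ?thesis by (simp add: N_def l_def)
qed

text \<open>Partial sums of length q^6 replace L' at a cost of 16 / q and L at a cost of 4 / q times
  |P|, since sqrt(q^6) outweighs the factor q in the remainders. What is left is exactly the
  polynomial with coefficients \<open>error_coeff q\<close>.\<close>

lemma log_derivative_approximation:
  assumes X: "dirichlet_character q X" "X \<noteq> principal_character q" and q: "q \<ge> 1"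
  shows   "norm (deriv (dirichlet_L X) 1 + dirichlet_L X 1 * dpoly (mangoldt_trunc q) q X) \<le>
             norm (dpoly (error_coeff q) (q ^ 7) X) + 20 * (1 + ln (real q)) ^ 2 / real q"
proof -
  define l where "l = 1 + ln (real q)"
  have l: "l \<ge> 1" using q by (simp add: l_def)
  define N where "N = q ^ 6"
  have q0: "q > 0" using q by simp
  have N: "N \<ge> 1" "sqrt (real N) = real q ^ 3"
  proof -
    have "(real q ^ 3) ^ 2 = real N" by (simp add: N_def flip: power_mult)
    thus "sqrt (real N) = real q ^ 3" by (rule real_sqrt_unique) simp
  qed (use q in \<open>simp add: N_def\<close>)
  have mul: "completely_mult X" by (rule completely_mult_dirichlet_character[OF X(1) q0])
  define P where "P = dpoly (mangoldt_trunc q) q X"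
  define LN where "LN = dpoly (\<lambda>n. if n \<le> N then 1 else 0) N X"
  define DN where "DN = dpoly (\<lambda>n. if n \<le> N then ln (real n) else 0) N X"
  have LN_eq: "LN = (\<Sum>n=1..N. X n * of_nat n powr (-1))"
    unfolding LN_def dpoly_def by (intro sum.cong refl) (simp add: powr_minus divide_inverse)
  have DN_eq: "DN = (\<Sum>n=1..N. X n * of_real (ln (real n)) * of_nat n powr (-1))"
    unfolding DN_def dpoly_def by (intro sum.cong refl) (simp add: powr_minus divide_inverse)
  have small: "real q / real q ^ 3 \<le> 1 / real q"
    using q by (simp add: field_simps power3_eq_cube)
  have e1: "norm (dirichlet_L X 1 - LN) \<le> 4 * (1 / real q)"
    using dirichlet_L_minus_partial_sum_le[OF X q0 _ N(1), of 1] small unfolding LN_eq N(2) by simp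
  have e2: "norm (deriv (dirichlet_L X) 1 + DN) \<le> 16 * (1 / real q)"
    using deriv_dirichlet_L_minus_partial_sum_le[OF X q0 _ N(1), of 1] small unfolding DN_eq N(2) by simp
  have P: "norm P \<le> l ^ 2"
    unfolding P_def l_def
    by (rule norm_dpoly_mangoldt_le[OF dirichlet_character_norm_le_1[OF X(1) q0] q])
  have E: "LN * P - DN = dpoly (error_coeff q) (q ^ 7) X"
  proof -
    have q7: "q ^ 7 = q * N" by (simp add: N_def flip: power_Suc)
    have "P * LN = dpoly (dconv (mangoldt_trunc q) (\<lambda>n. if n \<le> N then 1 else 0)) (q * N) X"
      unfolding P_def LN_def by (rule dpoly_mult[OF mul]) (auto simp: mangoldt_trunc_def)
    moreover have "DN = dpoly (\<lambda>n. if n \<le> N then ln (real n) else 0) (q * N) X"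
      unfolding DN_def dpoly_def using q
      by (intro sum.mono_neutral_left) (auto intro: order_trans[of _ N])
    ultimately show ?thesis
      unfolding dpoly_def error_coeff_def N_def [symmetric] q7
      by (simp add: mult.commute[of LN] left_diff_distrib diff_divide_distrib sum_subtractf)
  qed
  have "deriv (dirichlet_L X) 1 + dirichlet_L X 1 * P =
        (LN * P - DN) + ((deriv (dirichlet_L X) 1 + DN) + (dirichlet_L X 1 - LN) * P)"
    by (simp add: algebra_simps)
  also have "norm \<dots> \<le> norm (LN * P - DN) + (norm (deriv (dirichlet_L X) 1 + DN) + norm ((dirichlet_L X 1 - LN) * P))"
    by (intro order_trans[OF norm_triangle_ineq] add_left_mono norm_triangle_ineq)
  also have "norm ((dirichlet_L X 1 - LN) * P) \<le> 4 * (1 / real q) * l ^ 2"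
    unfolding norm_mult using e1 P by (intro mult_mono) auto
  also have "norm (deriv (dirichlet_L X) 1 + DN) \<le> 16 * (1 / real q) * l ^ 2"
  proof -
    have "16 * (1 / real q) * 1 \<le> 16 * (1 / real q) * l ^ 2"
      using l by (intro mult_left_mono one_le_power) auto
    thus ?thesis using e2 by simp
  qed
  finally show ?thesis unfolding E by (simp add: P_def l_def)
qed

subsection \<open>Moments of the logarithmic derivative\<close>

text \<open>A character is determined by its value at a primitive root. If its square is principal
  this value is 1 or -1, and 1 gives the principal character.\<close>

lemma real_dirichlet_character_unique:
  assumes q: "prime (q :: nat)"
    and X: "dirichlet_character q X" "X \<noteq> principal_character q" "(\<lambda>n. X n * X n) = principal_character q"
    and Y: "dirichlet_character q Y" "Y \<noteq> principal_character q" "(\<lambda>n. Y n * Y n) = principal_character q"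
  shows   "X = Y"
proof -
  obtain g where g: "residue_primroot q g"
    using prime_primitive_root_exists[of q] q prime_gt_1_nat by auto
  have cop: "coprime g q" using g by (auto simp: residue_primroot_def coprime_commute)
  have gen: "\<exists>i. [a = g ^ i] (mod q)" if "coprime a q" for a
    using residue_primroot_power_cong_exists[OF q g that] cong_sym by blast
  have at_gen: "Z g = -1"
    if Z: "dirichlet_character q Z" "Z \<noteq> principal_character q" "(\<lambda>n. Z n * Z n) = principal_character q" for Z
  proof -
    have "Z g * Z g = 1" using fun_cong[OF Z(3), of g] cop by (simp add: principal_character_def)
    moreover have "Z g \<noteq> 1"
    proof
      assume 1: "Z g = 1"
      have "Z a = principal_character q a" for a
      proof (cases "coprime a q")
        case True
        then obtain i where i: "[a = g ^ i] (mod q)" using gen by blast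
        have "Z a = Z (g ^ i)" by (rule dirichlet_character_cong[OF Z(1) i])
        also have "\<dots> = Z g ^ i" by (rule dirichlet_character_power[OF Z(1)])
        finally show ?thesis using True 1 by (simp add: principal_character_def)
      next
        case False
        thus ?thesis using dirichlet_character_eq_0_iff[OF Z(1), of a] by (simp add: principal_character_def)
      qed
      thus False using Z(2) by blast
    qed
    ultimately show ?thesis by (simp add: square_eq_1_iff)
  qed
  show ?thesis
  proof
    fix a
    show "X a = Y a"
    proof (cases "coprime a q")
      case True
      then obtain i where i: "[a = g ^ i] (mod q)" using gen by blast
      show ?thesis
        unfolding dirichlet_character_cong[OF X(1) i] dirichlet_character_cong[OF Y(1) i]
          dirichlet_character_power[OF X(1)] dirichlet_character_power[OF Y(1)] at_gen[OF X] at_gen[OF Y] ..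
    next
      case False
      thus ?thesis
        using dirichlet_character_eq_0_iff[OF X(1), of a] dirichlet_character_eq_0_iff[OF Y(1), of a] by simp
    qed
  qed
qed

lemma abs_power_diff_le:
  fixes x y M :: real
  assumes "0 \<le> x" "x \<le> M" "0 \<le> y" "y \<le> M" "M \<ge> 1"
  shows   "\<bar>x ^ n - y ^ n\<bar> \<le> real n * M ^ n * \<bar>x - y\<bar>"
proof (induction n)
  case (Suc n)
  have "\<bar>x ^ Suc n - y ^ Suc n\<bar> = \<bar>x * (x ^ n - y ^ n) + y ^ n * (x - y)\<bar>"
    by (simp add: algebra_simps)
  also have "\<dots> \<le> x * \<bar>x ^ n - y ^ n\<bar> + y ^ n * \<bar>x - y\<bar>"
    using assms by (intro order_trans[OF abs_triangle_ineq]) (simp add: abs_mult)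
  also have "\<dots> \<le> M * (real n * M ^ n * \<bar>x - y\<bar>) + M ^ Suc n * \<bar>x - y\<bar>"
  proof (intro add_mono mult_mono)
    have "y ^ n \<le> M ^ n" using assms by (intro power_mono) auto
    also have "\<dots> \<le> M ^ Suc n" using assms by (intro power_increasing) auto
    finally show "y ^ n \<le> M ^ Suc n" .
  qed (use assms Suc in auto)
  also have "\<dots> = real (Suc n) * M ^ Suc n * \<bar>x - y\<bar>" by (simp add: algebra_simps)
  finally show ?case .
qed simp

text \<open>With S the full series and T the truncated sum, (q - 1) T - (q - 2) S = S - (q - 1) (S -
  T). So replacing q - 1 by q - 2 costs a constant, and S - T lies between 0 and the tail of the
  series from q on, which is O(q^(-1/2)).\<close>

lemma main_term_truncation:
  obtains C where "C \<ge> 0" "\<And>q. prime q \<Longrightarrow>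
    \<bar>(real q - 1) * (\<Sum>n\<in>{n\<in>{1..q ^ Suc k}. coprime n q}. (mangoldt_trunc_conv q k n / real n) ^ 2) -
     (real q - 2) * (\<Sum>\<^sub>\<infinity>m\<in>{1..}. (mangoldt_conv k m)\<^sup>2 / real m ^ 2)\<bar> \<le> C * sqrt (real q)"
proof -
  define f where "f = (\<lambda>m. (mangoldt_conv k m)\<^sup>2 / real m ^ 2)"
  define S where "S = (\<Sum>\<^sub>\<infinity>m\<in>{1..}. f m)"
  have f_summable: "f summable_on {1..}" unfolding f_def by (rule mangoldt_conv_summable)
  have f_nonneg: "f m \<ge> 0" for m by (simp add: f_def)
  have S: "S \<ge> 0" unfolding S_def by (intro infsum_nonneg f_nonneg)
  have "(1/4 :: real) > 0" by simp
  then obtain K :: real where K: "K > 0" "\<And>x. x \<ge> 1 \<Longrightarrow> (1 + ln x) ^ (2 * k) \<le> K * x powr (1/4)"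
    using ln_power_le_powr[of "1/4" "2 * k"] by metis
  \<comment> \<open>A summable majorant after a factor m^(-1/2) is set aside: the logarithms cost
    m^(1/4), and 2 = 1/4 + 5/4 + 1/2. From q on the factor set aside is at most q^(-1/2).\<close>
  define h where "h = (\<lambda>m::nat. K * real m powr (-5/4))"
  have "summable h" unfolding h_def by (intro summable_mult) (simp add: summable_real_powr_iff)
  hence "h summable_on UNIV"
    using K by (subst summable_on_UNIV_nonneg_real_iff) (auto simp: h_def)
  hence h_summable: "h summable_on A" for A
    by (rule summable_on_subset_banach) simp
  define H where "H = infsum h {1..}"
  have f_le: "f m \<le> h m / sqrt (real q)" if m: "m \<ge> 1" "m \<ge> q" and q: "q > 0" for m q
  proof -
    have "mangoldt_conv k m \<le> ln (real m) ^ k" "mangoldt_conv k m \<ge> 0"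
      using mangoldt_conv_bounds[of m k] m by auto
    hence "(mangoldt_conv k m)\<^sup>2 \<le> (ln (real m) ^ k)\<^sup>2" by (intro power_mono) auto
    also have "\<dots> = ln (real m) ^ (2 * k)" by (simp add: power_mult [symmetric] mult.commute)
    also have "\<dots> \<le> (1 + ln (real m)) ^ (2 * k)" using m by (intro power_mono) auto
    also have "\<dots> \<le> K * real m powr (1/4)" using K(2)[of "real m"] m by simp
    finally have "f m \<le> K * real m powr (1/4) / real m ^ 2"
      unfolding f_def by (rule divide_right_mono) simp
    also have "real m ^ 2 = real m powr 2" using m by simp
    also have "K * real m powr (1/4) / real m powr 2 = h m * real m powr (-1/2)"
    proof -
      have "real m powr (1/4) / real m powr 2 = real m powr (-5/4) * real m powr (-1/2)"
        by (simp only: powr_diff [symmetric] powr_add [symmetric]) simp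
      from arg_cong[OF this, of "\<lambda>x. K * x"] show ?thesis
        by (simp only: h_def mult.assoc times_divide_eq_right)
    qed
    also have "\<dots> \<le> h m * real q powr (-1/2)"
      using m q K by (intro mult_left_mono powr_mono2') (auto simp: h_def)
    also have "real q powr (-1/2) = 1 / sqrt (real q)"
      using powr_minus[of "real q" "1/2"] by (simp add: powr_half_sqrt inverse_eq_divide)
    finally show ?thesis by simp
  qed
  show ?thesis
  proof (rule that[of "H + S"])
    have "H \<ge> 0" unfolding H_def using K by (intro infsum_nonneg) (auto simp: h_def)
    thus "H + S \<ge> 0" using S by simp
    fix q :: nat assume q: "prime q"
    have q1: "q > 1" using q by (rule prime_gt_1_nat)
    define T where "T = (\<Sum>n\<in>{n\<in>{1..q ^ Suc k}. coprime n q}. (mangoldt_trunc_conv q k n / real n) ^ 2)"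
    have "T \<le> (\<Sum>n\<in>{n\<in>{1..q ^ Suc k}. coprime n q}. f n)"
      unfolding T_def
    proof (rule sum_mono)
      fix n assume "n \<in> {n\<in>{1..q ^ Suc k}. coprime n q}"
      hence "0 \<le> mangoldt_trunc_conv q k n" "mangoldt_trunc_conv q k n \<le> mangoldt_conv k n"
        using mangoldt_trunc_conv_bounds[of n q k] by auto
      hence "(mangoldt_trunc_conv q k n)\<^sup>2 \<le> (mangoldt_conv k n)\<^sup>2" by (intro power_mono)
      thus "(mangoldt_trunc_conv q k n / real n) ^ 2 \<le> f n"
        unfolding f_def power_divide by (rule divide_right_mono) simp
    qed
    also have "\<dots> \<le> S"
      unfolding S_def by (rule finite_sum_le_infsum[OF f_summable]) (auto simp: f_nonneg)
    finally have up: "T \<le> S" .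
    have "(\<Sum>n\<in>{1..<q}. f n) = (\<Sum>n\<in>{1..<q}. (mangoldt_trunc_conv q k n / real n) ^ 2)"
    proof (intro sum.cong refl)
      fix n assume "n \<in> {1..<q}"
      hence "mangoldt_trunc_conv q k n = mangoldt_conv k n"
        using mangoldt_trunc_conv_bounds[of n q k] by simp
      thus "f n = (mangoldt_trunc_conv q k n / real n) ^ 2" by (simp add: f_def power_divide)
    qed
    also have "\<dots> \<le> T"
      unfolding T_def
    proof (rule sum_mono2)
      \<comment> \<open>Below the prime q every n is coprime to it; n = q is not, and is counted in
        the tail.\<close>
      show "{1..<q} \<subseteq> {n\<in>{1..q ^ Suc k}. coprime n q}"
      proof safe
        fix n assume n: "n \<in> {1..<q}"
        have "n \<le> q" using n by simp
        also have "q \<le> q ^ Suc k" using q1 by (intro self_le_power) auto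
        finally have "n \<le> q ^ Suc k" .
        thus "n \<in> {1..q ^ Suc k}" using n by simp
        have "\<not>q dvd n" using n by (auto dest: dvd_imp_le)
        from prime_imp_coprime[OF q this] show "coprime n q" by (simp add: coprime_commute)
      qed
    qed auto
    finally have low: "(\<Sum>n\<in>{1..<q}. f n) \<le> T" .
    have "{1..} = {1..<q} \<union> {q..}" using q1 by auto
    hence "S = (\<Sum>\<^sub>\<infinity>m\<in>{1..<q} \<union> {q..}. f m)"
      unfolding S_def by (rule arg_cong)
    also have "\<dots> = infsum f {1..<q} + infsum f {q..}"
    proof (rule infsum_Un_disjoint)
      show "f summable_on {1..<q}" by (rule summable_on_subset_banach[OF f_summable]) auto
      show "f summable_on {q..}" by (rule summable_on_subset_banach[OF f_summable]) (use q1 in auto)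
    qed auto
    finally have S_eq: "S = (\<Sum>n\<in>{1..<q}. f n) + infsum f {q..}" by simp
    have "infsum f {q..} \<le> (\<Sum>\<^sub>\<infinity>m\<in>{q..}. h m * (1 / sqrt (real q)))"
    proof (rule infsum_mono)
      show "f summable_on {q..}" by (rule summable_on_subset_banach[OF f_summable]) (use q1 in auto)
      show "(\<lambda>m. h m * (1 / sqrt (real q))) summable_on {q..}" by (rule summable_on_cmult_left[OF h_summable])
      show "f m \<le> h m * (1 / sqrt (real q))" if "m \<in> {q..}" for m
        using f_le[of m q] that q1 by simp
    qed
    also have "\<dots> = infsum h {q..} * (1 / sqrt (real q))"
      by (rule infsum_cmult_left')
    also have "\<dots> \<le> H * (1 / sqrt (real q))"
    proof (rule mult_right_mono)
      show "infsum h {q..} \<le> H"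
        unfolding H_def by (rule infsum_mono_neutral[OF h_summable h_summable]) (use q1 K in \<open>auto simp: h_def\<close>)
    qed simp
    finally have "S - T \<le> H / sqrt (real q)" using low S_eq by simp
    hence "(real q - 1) * (S - T) \<le> real q * (H / sqrt (real q))"
      using q1 up \<open>H \<ge> 0\<close> by (intro mult_mono) auto
    also have "\<dots> = H * (real q / sqrt (real q))" by simp
    also have "\<dots> = H * sqrt (real q)" by (simp only: real_div_sqrt of_nat_0_le_iff)
    finally have 1: "(real q - 1) * (S - T) \<le> H * sqrt (real q)" .
    have 2: "(real q - 1) * (S - T) \<ge> 0" using q1 up by simp
    have "1 \<le> sqrt (real q)" using q1 by simp
    hence 3: "S \<le> S * sqrt (real q)" using S mult_left_mono[of 1 "sqrt (real q)" S] by simp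
    have "(real q - 1) * T - (real q - 2) * S = S - (real q - 1) * (S - T)" by (simp add: algebra_simps)
    hence "\<bar>(real q - 1) * T - (real q - 2) * S\<bar> \<le> S + (real q - 1) * (S - T)"
      using S 2 by (simp add: abs_le_iff)
    also have "\<dots> \<le> (H + S) * sqrt (real q)" using 1 3 by (simp add: algebra_simps)
    finally show "\<bar>(real q - 1) * (\<Sum>n\<in>{n\<in>{1..q ^ Suc k}. coprime n q}. (mangoldt_trunc_conv q k n / real n) ^ 2) -
     (real q - 2) * (\<Sum>\<^sub>\<infinity>m\<in>{1..}. (mangoldt_conv k m)\<^sup>2 / real m ^ 2)\<bar> \<le> (H + S) * sqrt (real q)"
      unfolding T_def S_def f_def .
  qed
qed

text \<open>Pointwise, |L'/L| and |P| differ by at most the small error divided by |L|, and both are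
  bounded by a power of log q, so taking 2 k-th powers costs only further logarithms. The exponent
  18 k + 11 collects 9 for each of the 2 k factors M, 7 from 1 / |L| and 4 from the mean
  square.\<close>

lemma log_derivative_moment_complex:
  obtains C where "C \<ge> 0" "\<And>q. prime q \<Longrightarrow>
    (\<Sum>X | dirichlet_character q X \<and> X \<noteq> principal_character q \<and> (\<lambda>n. X n * X n) \<noteq> principal_character q.
      \<bar>norm (deriv (dirichlet_L X) 1 / dirichlet_L X 1) ^ (2 * k) - norm (dpoly (mangoldt_trunc q) q X) ^ (2 * k)\<bar>)
    \<le> C * (1 + ln (real q)) ^ (18 * k + 11) * sqrt (real q)"
proof (rule complex_dirichlet_L_lower_bound)
  fix c :: real
  assume c: "c > 0" and low: "\<And>q X. q > 0 \<Longrightarrow> dirichlet_character q X \<Longrightarrow> X \<noteq> principal_character q \<Longrightarrow>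
        (\<lambda>n. X n * X n) \<noteq> principal_character q \<Longrightarrow> norm (dirichlet_L X 1) \<ge> c / (1 + ln (real q)) ^ 7"
  define K where "K = 28 / c + 1"
  have K: "K \<ge> 1" "28 / c \<le> K" using c by (auto simp: K_def)
  \<comment> \<open>7224 = 1 + 7203 + 20 adds the three contributions of the summed pointwise
    bound.\<close>
  define C where "C = real (2 * k) * K ^ (2 * k) / c * 7224"
  show thesis
  proof (rule that[of C])
    show "C \<ge> 0" using c K by (simp add: C_def)
    fix q :: nat assume q: "prime q"
    have q1: "q \<ge> 1" and q0: "q > 0" using q prime_gt_0_nat[of q] by auto
    define l where "l = 1 + ln (real q)"
    have l: "l \<ge> 1" using q1 by (simp add: l_def)
    define A where "A = {X. dirichlet_character q X \<and> X \<noteq> principal_character q \<and> (\<lambda>n. X n * X n) \<noteq> principal_character q}"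
    have fin: "finite {X. dirichlet_character q X}" by (rule finite_dirichlet_characters[OF q0])
    have A_sub: "A \<subseteq> {X. dirichlet_character q X}" by (auto simp: A_def)
    \<comment> \<open>Exponent 9 = 2 + 7: L' is O(l^2) and 1 / L is O(l^7) at 1.\<close>
    define M where "M = K * l ^ 9"
    have M: "M \<ge> 1" using mult_mono[of 1 K 1 "l ^ 9"] K one_le_power[OF l, of 9] by (simp add: M_def)
    define E where "E = (\<lambda>X. norm (dpoly (error_coeff q) (q ^ 7) X))"
    define Q where "Q = real (2 * k) * M ^ (2 * k) * (l ^ 7 / c)"
    have Q: "Q \<ge> 0" using M l c by (simp add: Q_def)
    have pointwise: "\<bar>norm (deriv (dirichlet_L X) 1 / dirichlet_L X 1) ^ (2 * k) - norm (dpoly (mangoldt_trunc q) q X) ^ (2 * k)\<bar>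
        \<le> Q * ((1 / sqrt (real q) + sqrt (real q) * E X ^ 2) + 20 * l ^ 2 / real q)" if XA: "X \<in> A" for X
    proof -
      have X: "dirichlet_character q X" "X \<noteq> principal_character q" "(\<lambda>n. X n * X n) \<noteq> principal_character q"
        using XA by (auto simp: A_def)
      define L where "L = dirichlet_L X 1"
      define D where "D = deriv (dirichlet_L X) 1"
      define P where "P = dpoly (mangoldt_trunc q) q X"
      have L_low: "norm L \<ge> c / l ^ 7" unfolding L_def l_def by (rule low[OF q0 X])
      have cl: "c / l ^ 7 > 0" using c l by simp
      hence L0: "norm L > 0" using L_low by linarith
      have inv: "1 / norm L \<le> l ^ 7 / c"
        using divide_left_mono[OF L_low, of 1] L0 cl c l by (simp add: field_simps)
      have D: "norm D \<le> 28 * l ^ 2"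
        unfolding D_def l_def using norm_dirichlet_L_le(2)[OF X(1,2) q0, of 1] by simp
      have "norm (D / L) = norm D * (1 / norm L)" by (simp add: norm_divide)
      also have "\<dots> \<le> (28 * l ^ 2) * (l ^ 7 / c)" using D inv L0 by (intro mult_mono) auto
      also have "\<dots> = 28 / c * l ^ 9" by (simp flip: power_add)
      also have "\<dots> \<le> M" unfolding M_def using K l by (intro mult_right_mono) auto
      finally have z: "norm (D / L) \<le> M" .
      have "norm P \<le> l ^ 2"
        unfolding P_def l_def by (rule norm_dpoly_mangoldt_le[OF dirichlet_character_norm_le_1[OF X(1) q0] q1])
      also have "\<dots> \<le> l ^ 9" using l by (intro power_increasing) auto
      also have "\<dots> \<le> M" unfolding M_def using K l mult_right_mono[of 1 K "l ^ 9"] by simp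
      finally have P: "norm P \<le> M" .
      have "\<bar>norm (D / L) - norm P\<bar> = \<bar>norm (D / L) - norm (-P)\<bar>" by simp
      also have "\<dots> \<le> norm (D / L - (-P))" by (rule norm_triangle_ineq3)
      also have "D / L - (-P) = (D + L * P) / L" using L0 by (simp add: field_simps)
      also have "norm \<dots> = norm (D + L * P) * (1 / norm L)" by (simp add: norm_divide)
      also have "\<dots> \<le> (E X + 20 * l ^ 2 / real q) * (l ^ 7 / c)"
        using log_derivative_approximation[OF X(1,2) q1] inv L0
        unfolding D_def L_def P_def E_def l_def by (intro mult_mono) (auto intro!: add_nonneg_nonneg)
      finally have diff: "\<bar>norm (D / L) - norm P\<bar> \<le> (E X + 20 * l ^ 2 / real q) * (l ^ 7 / c)" .
      \<comment> \<open>A substitute for Cauchy-Schwarz: summed over the q - 1 characters both terms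
        are at most sqrt(q) up to logarithms, because the sum of the squares \<open>E X ^ 2\<close>
        is bounded by a power of log q.\<close>
      have E: "E X \<le> 1 / sqrt (real q) + sqrt (real q) * E X ^ 2"
      proof (cases "E X \<le> 1 / sqrt (real q)")
        case True
        moreover have "sqrt (real q) * E X ^ 2 \<ge> 0" by simp
        ultimately show ?thesis by linarith
      next
        case False
        hence "1 \<le> sqrt (real q) * E X" using q1 by (simp add: field_simps)
        hence "1 * E X \<le> (sqrt (real q) * E X) * E X" by (rule mult_right_mono) (simp add: E_def)
        hence "E X \<le> sqrt (real q) * E X ^ 2" by (simp add: power2_eq_square mult.assoc)
        moreover have "1 / sqrt (real q) \<ge> 0" by simp
        ultimately show ?thesis by linarith
      qed
      have "\<bar>norm (D / L) ^ (2 * k) - norm P ^ (2 * k)\<bar> \<le> real (2 * k) * M ^ (2 * k) * \<bar>norm (D / L) - norm P\<bar>"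
        by (rule abs_power_diff_le) (use z P M in auto)
      also have "\<dots> \<le> real (2 * k) * M ^ (2 * k) * ((E X + 20 * l ^ 2 / real q) * (l ^ 7 / c))"
        using diff M by (intro mult_left_mono) auto
      also have "\<dots> = Q * (E X + 20 * l ^ 2 / real q)" by (simp add: Q_def)
      also have "\<dots> \<le> Q * ((1 / sqrt (real q) + sqrt (real q) * E X ^ 2) + 20 * l ^ 2 / real q)"
        using E Q by (intro mult_left_mono add_right_mono)
      finally show ?thesis by (simp add: D_def L_def P_def)
    qed
    have "(\<Sum>X\<in>A. \<bar>norm (deriv (dirichlet_L X) 1 / dirichlet_L X 1) ^ (2 * k) - norm (dpoly (mangoldt_trunc q) q X) ^ (2 * k)\<bar>)
        \<le> (\<Sum>X\<in>A. Q * ((1 / sqrt (real q) + sqrt (real q) * E X ^ 2) + 20 * l ^ 2 / real q))"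
      by (rule sum_mono[OF pointwise])
    also have "\<dots> \<le> (\<Sum>X | dirichlet_character q X. Q * ((1 / sqrt (real q) + sqrt (real q) * E X ^ 2) + 20 * l ^ 2 / real q))"
      using Q by (intro sum_mono2 fin A_sub mult_nonneg_nonneg add_nonneg_nonneg) auto
    also have "\<dots> = Q * (real (q - 1) * (1 / sqrt (real q)) + sqrt (real q) * (\<Sum>X | dirichlet_character q X. E X ^ 2) +
        real (q - 1) * (20 * l ^ 2 / real q))"
      by (simp add: sum_distrib_left [symmetric] sum.distrib card_dirichlet_characters[OF q])
    also have "\<dots> \<le> Q * (sqrt (real q) * l ^ 4 + sqrt (real q) * (7203 * l ^ 4) + 20 * (sqrt (real q) * l ^ 4))"
    proof (intro mult_left_mono add_mono)
      have l4: "1 \<le> l ^ 4" "l ^ 2 \<le> l ^ 4" using l by (auto intro: one_le_power power_increasing)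
      have s1: "sqrt (real q) \<ge> 1" using q1 by simp
      have "real (q - 1) * (1 / sqrt (real q)) \<le> real q * (1 / sqrt (real q))"
        by (intro mult_right_mono) auto
      also have "\<dots> = sqrt (real q) * 1" by (simp add: real_div_sqrt)
      also have "\<dots> \<le> sqrt (real q) * l ^ 4" using l4 by (intro mult_left_mono) auto
      finally show "real (q - 1) * (1 / sqrt (real q)) \<le> sqrt (real q) * l ^ 4" .
      show "(\<Sum>X | dirichlet_character q X. E X ^ 2) \<le> 7203 * l ^ 4"
        unfolding E_def l_def by (rule mean_square_error_coeff[OF q])
      have "real (q - 1) * (20 * l ^ 2 / real q) \<le> real q * (20 * l ^ 2 / real q)"
        by (intro mult_right_mono) auto
      also have "\<dots> = 20 * (1 * l ^ 2)" using q0 by simp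
      also have "\<dots> \<le> 20 * (sqrt (real q) * l ^ 4)" using s1 l4 by (intro mult_left_mono mult_mono) auto
      finally show "real (q - 1) * (20 * l ^ 2 / real q) \<le> 20 * (sqrt (real q) * l ^ 4)" .
    qed (use Q in auto)
    also have "\<dots> = C * l ^ (18 * k + 11) * sqrt (real q)"
    proof -
      have "M ^ (2 * k) * l ^ 7 * l ^ 4 = K ^ (2 * k) * l ^ (18 * k + 11)"
        by (simp add: M_def power_mult_distrib mult.assoc add.commute flip: power_mult power_add)
      thus ?thesis by (simp add: C_def Q_def field_simps)
    qed
    finally show "(\<Sum>X | dirichlet_character q X \<and> X \<noteq> principal_character q \<and> (\<lambda>n. X n * X n) \<noteq> principal_character q.
      \<bar>norm (deriv (dirichlet_L X) 1 / dirichlet_L X 1) ^ (2 * k) - norm (dpoly (mangoldt_trunc q) q X) ^ (2 * k)\<bar>)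
      \<le> C * (1 + ln (real q)) ^ (18 * k + 11) * sqrt (real q)"
      unfolding A_def l_def .
  qed
qed

text \<open>At most one character occurs, so the two powers can be bounded separately; Siegel's
  bound makes |L'/L|^(2 k) at most sqrt(q) up to logarithms.\<close>

lemma log_derivative_moment_real:
  obtains C where "C \<ge> 0" "\<And>q. prime q \<Longrightarrow>
    (\<Sum>X | dirichlet_character q X \<and> X \<noteq> principal_character q \<and> (\<lambda>n. X n * X n) = principal_character q.
      \<bar>norm (deriv (dirichlet_L X) 1 / dirichlet_L X 1) ^ (2 * k) - norm (dpoly (mangoldt_trunc q) q X) ^ (2 * k)\<bar>)
    \<le> C * (1 + ln (real q)) ^ (4 * k) * sqrt (real q)"
proof -
  \<comment> \<open>Chosen so that the 2 k-th power of q^\<open>\<delta>\<close> is at most q^(1/2);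
    the added 4 covers k = 0.\<close>
  define \<delta> where "\<delta> = 1 / (4 * real k + 4)"
  have \<delta>: "\<delta> > 0" "\<delta> * real (2 * k) \<le> 1/2" by (auto simp: \<delta>_def field_simps)
  show thesis
  proof (rule siegel[OF \<delta>(1)])
    fix c :: real
    assume c: "c > 0" and low: "\<And>q X. prime q \<Longrightarrow> dirichlet_character q X \<Longrightarrow> X \<noteq> principal_character q \<Longrightarrow>
        (\<And>n. X n \<in> \<real>) \<Longrightarrow> dirichlet_L X 1 \<noteq> 0 \<Longrightarrow> norm (dirichlet_L X 1) \<ge> c * real q powr (-\<delta>)"
    define C where "C = (28 / c) ^ (2 * k) + 1"
    have C: "C \<ge> 0" using c by (simp add: C_def)
    show thesis
    proof (rule that[OF C])
      fix q :: nat assume q: "prime q"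
      have q1: "q \<ge> 1" and q0: "q > 0" using q prime_gt_0_nat[of q] by auto
      define l where "l = 1 + ln (real q)"
      have l: "l \<ge> 1" using q1 by (simp add: l_def)
      define A where "A = {X. dirichlet_character q X \<and> X \<noteq> principal_character q \<and> (\<lambda>n. X n * X n) = principal_character q}"
      have pointwise: "\<bar>norm (deriv (dirichlet_L X) 1 / dirichlet_L X 1) ^ (2 * k) - norm (dpoly (mangoldt_trunc q) q X) ^ (2 * k)\<bar>
        \<le> C * l ^ (4 * k) * sqrt (real q)" if XA: "X \<in> A" for X
      proof -
        have X: "dirichlet_character q X" "X \<noteq> principal_character q" "(\<lambda>n. X n * X n) = principal_character q"
          using XA by (auto simp: A_def)
        have real: "X n \<in> \<real>" for n
        proof (cases "coprime n q")
          case True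
          hence "X n * X n = 1" using fun_cong[OF X(3), of n] by (simp add: principal_character_def)
          hence "X n = 1 \<or> X n = -1" by (simp add: square_eq_1_iff)
          thus ?thesis by auto
        next
          case False
          hence "X n = 0" using dirichlet_character_eq_0_iff[OF X(1), of n] by blast
          thus ?thesis by simp
        qed
        define L where "L = dirichlet_L X 1"
        define D where "D = deriv (dirichlet_L X) 1"
        define P where "P = dpoly (mangoldt_trunc q) q X"
        have qd: "real q powr \<delta> > 0" using q0 by simp
        have z: "norm (D / L) \<le> 28 / c * l ^ 2 * real q powr \<delta>"
        proof (cases "L = 0")
          case True
          thus ?thesis using c by simp
        next
          case False
          have L_low: "norm L \<ge> c * real q powr (-\<delta>)"
            unfolding L_def by (rule low[OF q X(1,2) real]) (use False in \<open>simp_all add: L_def\<close>)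
          have "1 / norm L \<le> 1 / (c * real q powr (-\<delta>))"
            using L_low False c q0 by (intro divide_left_mono mult_pos_pos) auto
          also have "\<dots> = real q powr \<delta> / c" using c q0 by (simp add: powr_minus field_simps)
          finally have inv: "1 / norm L \<le> real q powr \<delta> / c" .
          have D: "norm D \<le> 28 * l ^ 2"
            unfolding D_def l_def using norm_dirichlet_L_le(2)[OF X(1,2) q0, of 1] by simp
          have "norm (D / L) = norm D * (1 / norm L)" by (simp add: norm_divide)
          also have "\<dots> \<le> (28 * l ^ 2) * (real q powr \<delta> / c)" using D inv by (intro mult_mono) auto
          finally show ?thesis by (simp add: mult_ac)
        qed
        have "norm (D / L) ^ (2 * k) \<le> (28 / c * l ^ 2 * real q powr \<delta>) ^ (2 * k)"
          using z by (intro power_mono) auto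
        also have "\<dots> = (28 / c) ^ (2 * k) * l ^ (4 * k) * real q powr (\<delta> * real (2 * k))"
        proof -
          have "(real q powr \<delta>) ^ (2 * k) = real q powr (\<delta> * real (2 * k))"
            using qd by (subst powr_realpow [symmetric]) (auto simp: powr_powr)
          moreover have "(l ^ 2) ^ (2 * k) = l ^ (4 * k)" by (simp flip: power_mult)
          ultimately show ?thesis by (simp only: power_mult_distrib)
        qed
        also have "\<dots> \<le> (28 / c) ^ (2 * k) * l ^ (4 * k) * real q powr (1/2)"
          using q1 \<delta>(2) c l by (intro mult_left_mono powr_mono) auto
        finally have 1: "norm (D / L) ^ (2 * k) \<le> (28 / c) ^ (2 * k) * l ^ (4 * k) * sqrt (real q)"
          by (simp add: powr_half_sqrt)
        have "norm P \<le> l ^ 2"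
          unfolding P_def l_def by (rule norm_dpoly_mangoldt_le[OF dirichlet_character_norm_le_1[OF X(1) q0] q1])
        hence "norm P ^ (2 * k) \<le> (l ^ 2) ^ (2 * k)" by (intro power_mono) auto
        also have "\<dots> = l ^ (4 * k) * 1" by (simp flip: power_mult)
        also have "\<dots> \<le> l ^ (4 * k) * sqrt (real q)" using l q1 by (intro mult_left_mono) auto
        finally have 2: "norm P ^ (2 * k) \<le> l ^ (4 * k) * sqrt (real q)" .
        have "\<bar>norm (D / L) ^ (2 * k) - norm P ^ (2 * k)\<bar> \<le> norm (D / L) ^ (2 * k) + norm P ^ (2 * k)"
          by (intro order_trans[OF abs_triangle_ineq4]) (simp add: abs_of_nonneg)
        also have "\<dots> \<le> C * l ^ (4 * k) * sqrt (real q)"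
          using 1 2 by (simp add: C_def algebra_simps)
        finally show ?thesis by (simp add: D_def L_def P_def)
      qed
      have "card A \<le> 1"
      proof (cases "A = {}")
        case False
        then obtain X where "X \<in> A" by blast
        hence "A \<subseteq> {X}"
          using real_dirichlet_character_unique[OF q] unfolding A_def by blast
        thus ?thesis using card_mono[of "{X}" A] by simp
      qed simp
      have "(\<Sum>X\<in>A. \<bar>norm (deriv (dirichlet_L X) 1 / dirichlet_L X 1) ^ (2 * k) - norm (dpoly (mangoldt_trunc q) q X) ^ (2 * k)\<bar>)
        \<le> (\<Sum>X\<in>A. C * l ^ (4 * k) * sqrt (real q))"
        by (rule sum_mono[OF pointwise])
      also have "\<dots> = real (card A) * (C * l ^ (4 * k) * sqrt (real q))" by simp
      also have "\<dots> \<le> 1 * (C * l ^ (4 * k) * sqrt (real q))"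
        using \<open>card A \<le> 1\<close> C l by (intro mult_right_mono) auto
      finally show "(\<Sum>X | dirichlet_character q X \<and> X \<noteq> principal_character q \<and> (\<lambda>n. X n * X n) = principal_character q.
        \<bar>norm (deriv (dirichlet_L X) 1 / dirichlet_L X 1) ^ (2 * k) - norm (dpoly (mangoldt_trunc q) q X) ^ (2 * k)\<bar>)
        \<le> C * (1 + ln (real q)) ^ (4 * k) * sqrt (real q)"
        unfolding A_def l_def by simp
    qed
  qed
qed

text \<open>Orthogonality needs all characters, so the principal one is included and then removed;
  by the trivial bound for the prime sum its contribution is only a power of the logarithm.\<close>

lemma dpoly_mangoldt_moment:
  obtains C where "C \<ge> 0" "\<And>q. prime q \<Longrightarrow>
    \<bar>(\<Sum>X | dirichlet_character q X \<and> X \<noteq> principal_character q. norm (dpoly (mangoldt_trunc q) q X) ^ (2 * k)) -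
     (real q - 2) * (\<Sum>\<^sub>\<infinity>m\<in>{1..}. (mangoldt_conv k m)\<^sup>2 / real m ^ 2)\<bar>
    \<le> C * (1 + ln (real q)) ^ (4 * k + 2) * sqrt (real q)"
proof (rule main_term_truncation[of k])
  fix C0 :: real
  assume C0: "C0 \<ge> 0" and main: "\<And>q. prime q \<Longrightarrow>
    \<bar>(real q - 1) * (\<Sum>n\<in>{n\<in>{1..q ^ Suc k}. coprime n q}. (mangoldt_trunc_conv q k n / real n) ^ 2) -
     (real q - 2) * (\<Sum>\<^sub>\<infinity>m\<in>{1..}. (mangoldt_conv k m)\<^sup>2 / real m ^ 2)\<bar> \<le> C0 * sqrt (real q)"
  define a where "a = real (Suc k)"
  have a: "a \<ge> 1" by (simp add: a_def)
  define C where "C = C0 + 2 * a ^ (2 * k + 2) + 1"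
  show thesis
  proof (rule that[of C])
    show "C \<ge> 0" using C0 a by (simp add: C_def)
    fix q :: nat assume q: "prime q"
    have q1: "q \<ge> 1" and q0: "q > 0" using q prime_gt_0_nat[of q] by auto
    define l where "l = 1 + ln (real q)"
    have l: "l \<ge> 1" using q1 by (simp add: l_def)
    define S where "S = (\<Sum>\<^sub>\<infinity>m\<in>{1..}. (mangoldt_conv k m)\<^sup>2 / real m ^ 2)"
    define T where "T = (real q - 1) * (\<Sum>n\<in>{n\<in>{1..q ^ Suc k}. coprime n q}. (mangoldt_trunc_conv q k n / real n) ^ 2)"
    define P where "P = (\<lambda>X. norm (dpoly (mangoldt_trunc q) q X) ^ (2 * k))"
    define N where "N = q ^ Suc k"
    have N: "N \<ge> 1" using q1 by (simp add: N_def)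
    have lnN: "ln (real N) = a * ln (real q)" using q0 by (simp add: N_def a_def ln_realpow ln_mult algebra_simps)
    have lnN_le: "1 + ln (real N) \<le> a * l" "ln (real N) \<le> a * l" "0 \<le> ln (real N)"
      using lnN a q1 by (auto simp: l_def algebra_simps)
    have fin: "finite {X. dirichlet_character q X}" by (rule finite_dirichlet_characters[OF q0])
    have coeff: "\<bar>mangoldt_trunc_conv q k n\<bar> \<le> (a * l) ^ k" if n: "n \<in> {1..N}" for n
    proof -
      have n1: "n \<ge> 1" "n > 0" using n by auto
      have "0 \<le> mangoldt_trunc_conv q k n" "mangoldt_trunc_conv q k n \<le> mangoldt_conv k n"
        using mangoldt_trunc_conv_bounds[OF n1(1), of q k] by blast+
      moreover have "mangoldt_conv k n \<le> ln (real n) ^ k" using mangoldt_conv_bounds[OF n1(2), of k] by blast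
      moreover have "ln (real n) ^ k \<le> (a * l) ^ k"
      proof (rule power_mono)
        have "ln (real n) \<le> ln (real N)" using n by simp
        thus "ln (real n) \<le> a * l" using lnN_le by linarith
      qed (use n in simp)
      ultimately show ?thesis by linarith
    qed
    have P_eq: "P X = norm (dpoly (mangoldt_trunc_conv q k) N X) ^ 2" if "dirichlet_character q X" for X
    proof -
      have "dpoly (mangoldt_trunc q) q X ^ k = dpoly (mangoldt_trunc_conv q k) N X"
        unfolding N_def by (rule dpoly_mangoldt_power[OF completely_mult_dirichlet_character[OF that q0] q1])
      hence "norm (dpoly (mangoldt_trunc_conv q k) N X) = norm (dpoly (mangoldt_trunc q) q X) ^ k"
        by (simp flip: norm_power)
      thus ?thesis unfolding P_def by (simp add: mult.commute flip: power_mult)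
    qed
    have "(\<Sum>X | dirichlet_character q X. P X) = (\<Sum>X | dirichlet_character q X. norm (dpoly (mangoldt_trunc_conv q k) N X) ^ 2)"
      by (intro sum.cong refl P_eq) (simp only: mem_Collect_eq)
    hence "\<bar>(\<Sum>X | dirichlet_character q X. P X) - T\<bar> \<le> 2 * ((a * l) ^ k * (1 + ln (real N))) ^ 2"
      using mean_square_dpoly[of q N "mangoldt_trunc_conv q k" "(a * l) ^ k", OF q coeff N] by (simp only: T_def N_def)
    also have "\<dots> \<le> 2 * ((a * l) ^ k * (a * l)) ^ 2"
      using lnN_le a l by (intro mult_left_mono power_mono mult_nonneg_nonneg) auto
    also have "(y ^ k * y) ^ 2 = y ^ (2 * k + 2)" for y :: real
    proof -
      have "(y ^ k * y) ^ 2 = y ^ (Suc k * 2)" by (simp only: power_Suc2 power_mult)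
      also have "Suc k * 2 = 2 * k + 2" by simp
      finally show ?thesis .
    qed
    also have "2 * (a * l) ^ (2 * k + 2) = 2 * a ^ (2 * k + 2) * l ^ (2 * k + 2)"
      by (simp only: power_mult_distrib mult.assoc)
    finally have e1: "\<bar>(\<Sum>X | dirichlet_character q X. P X) - T\<bar> \<le> 2 * a ^ (2 * k + 2) * l ^ (2 * k + 2)" .
    have "norm (dpoly (mangoldt_trunc q) q (principal_character q)) \<le> l ^ 2"
      unfolding l_def
      by (rule norm_dpoly_mangoldt_le[OF dirichlet_character_norm_le_1[OF dirichlet_character_principal q0] q1])
    hence "P (principal_character q) \<le> (l ^ 2) ^ (2 * k)" unfolding P_def by (intro power_mono) auto
    also have "\<dots> = l ^ (4 * k)" by (simp flip: power_mult)
    finally have e2: "P (principal_character q) \<le> l ^ (4 * k)" .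
    have P0: "P (principal_character q) \<ge> 0" by (simp add: P_def)
    have "{X. dirichlet_character q X} = insert (principal_character q) {X. dirichlet_character q X \<and> X \<noteq> principal_character q}"
      using dirichlet_character_principal[of q] by blast
    hence "(\<Sum>X | dirichlet_character q X. P X) =
       (\<Sum>X\<in>insert (principal_character q) {X. dirichlet_character q X \<and> X \<noteq> principal_character q}. P X)"
      by (rule arg_cong)
    also have "\<dots> = P (principal_character q) + (\<Sum>X | dirichlet_character q X \<and> X \<noteq> principal_character q. P X)"
      by (rule sum.insert) (use fin in \<open>auto intro: finite_subset\<close>)
    finally have split: "(\<Sum>X | dirichlet_character q X. P X) =
      P (principal_character q) + (\<Sum>X | dirichlet_character q X \<and> X \<noteq> principal_character q. P X)" .
    have e3: "\<bar>T - (real q - 2) * S\<bar> \<le> C0 * sqrt (real q)" unfolding T_def S_def by (rule main[OF q])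
    define R where "R = l ^ (4 * k + 2) * sqrt (real q)"
    have s1: "sqrt (real q) \<ge> 1" using q1 by simp
    have R: "l ^ (2 * k + 2) \<le> R" "l ^ (4 * k) \<le> R" "sqrt (real q) \<le> R"
    proof -
      have "l ^ (2 * k + 2) * 1 \<le> R" unfolding R_def using l s1 by (intro mult_mono power_increasing) auto
      thus "l ^ (2 * k + 2) \<le> R" by simp
      have "l ^ (4 * k) * 1 \<le> R" unfolding R_def using l s1 by (intro mult_mono power_increasing) auto
      thus "l ^ (4 * k) \<le> R" by simp
      have "1 * sqrt (real q) \<le> R" unfolding R_def using l s1 by (intro mult_right_mono one_le_power) auto
      thus "sqrt (real q) \<le> R" by simp
    qed
    have "\<bar>(\<Sum>X | dirichlet_character q X \<and> X \<noteq> principal_character q. P X) - (real q - 2) * S\<bar> \<le>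
       2 * a ^ (2 * k + 2) * l ^ (2 * k + 2) + l ^ (4 * k) + C0 * sqrt (real q)"
      using e1 e2 e3 split P0 by linarith
    also have "\<dots> \<le> 2 * a ^ (2 * k + 2) * R + R + C0 * R"
      using R C0 a by (intro add_mono mult_left_mono) auto
    also have "\<dots> = C * l ^ (4 * k + 2) * sqrt (real q)"
      by (simp add: C_def R_def algebra_simps)
    finally show "\<bar>(\<Sum>X | dirichlet_character q X \<and> X \<noteq> principal_character q. norm (dpoly (mangoldt_trunc q) q X) ^ (2 * k)) -
     (real q - 2) * (\<Sum>\<^sub>\<infinity>m\<in>{1..}. (mangoldt_conv k m)\<^sup>2 / real m ^ 2)\<bar>
      \<le> C * (1 + ln (real q)) ^ (4 * k + 2) * sqrt (real q)"
      unfolding P_def S_def l_def .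
  qed
qed

theorem theorem2:
  fixes k :: nat and \<epsilon> :: real
  assumes "\<epsilon> > 0"
  shows "\<exists>C::real. \<forall>q::nat. prime q \<longrightarrow>
    \<bar>(\<Sum>X | dirichlet_character q X \<and> X \<noteq> principal_character q.
        cmod (deriv (dirichlet_L X) 1 / dirichlet_L X 1) ^ (2 * k))
      - (real q - 2) * (\<Sum>\<^sub>\<infinity>m\<in>{1..}. (mangoldt_conv k m)\<^sup>2 / real m ^ 2)\<bar>
    \<le> C * real q powr (9/10 + \<epsilon>)"
proof (rule log_derivative_moment_complex[of k], rule log_derivative_moment_real[of k],
       rule dpoly_mangoldt_moment[of k])
  fix C1 C2 C3 :: real
  assume C1: "C1 \<ge> 0" and complex: "\<And>q. prime q \<Longrightarrow>
    (\<Sum>X | dirichlet_character q X \<and> X \<noteq> principal_character q \<and> (\<lambda>n. X n * X n) \<noteq> principal_character q.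
      \<bar>norm (deriv (dirichlet_L X) 1 / dirichlet_L X 1) ^ (2 * k) - norm (dpoly (mangoldt_trunc q) q X) ^ (2 * k)\<bar>)
    \<le> C1 * (1 + ln (real q)) ^ (18 * k + 11) * sqrt (real q)"
  assume C2: "C2 \<ge> 0" and real: "\<And>q. prime q \<Longrightarrow>
    (\<Sum>X | dirichlet_character q X \<and> X \<noteq> principal_character q \<and> (\<lambda>n. X n * X n) = principal_character q.
      \<bar>norm (deriv (dirichlet_L X) 1 / dirichlet_L X 1) ^ (2 * k) - norm (dpoly (mangoldt_trunc q) q X) ^ (2 * k)\<bar>)
    \<le> C2 * (1 + ln (real q)) ^ (4 * k) * sqrt (real q)"
  assume C3: "C3 \<ge> 0" and poly: "\<And>q. prime q \<Longrightarrow>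
    \<bar>(\<Sum>X | dirichlet_character q X \<and> X \<noteq> principal_character q. norm (dpoly (mangoldt_trunc q) q X) ^ (2 * k)) -
     (real q - 2) * (\<Sum>\<^sub>\<infinity>m\<in>{1..}. (mangoldt_conv k m)\<^sup>2 / real m ^ 2)\<bar>
    \<le> C3 * (1 + ln (real q)) ^ (4 * k + 2) * sqrt (real q)"
  \<comment> \<open>2/5 = 9/10 - 1/2 is the room available for absorbing the powers of log
    q.\<close>
  have "(2/5 :: real) > 0" by simp
  then obtain K :: real where K: "K > 0" "\<And>x. x \<ge> 1 \<Longrightarrow> (1 + ln x) ^ (18 * k + 11) \<le> K * x powr (2/5)"
    using ln_power_le_powr[of "2/5" "18 * k + 11"] by metis
  show ?thesis
  proof (intro exI[of _ "(C1 + C2 + C3) * K"] allI impI)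
    fix q :: nat assume q: "prime q"
    have q1: "q \<ge> 1" and q0: "q > 0" using q prime_gt_0_nat[of q] by auto
    define l where "l = 1 + ln (real q)"
    have l: "l \<ge> 1" using q1 by (simp add: l_def)
    define S where "S = (\<Sum>\<^sub>\<infinity>m\<in>{1..}. (mangoldt_conv k m)\<^sup>2 / real m ^ 2)"
    define A where "A = {X. dirichlet_character q X \<and> X \<noteq> principal_character q \<and> (\<lambda>n. X n * X n) \<noteq> principal_character q}"
    define B where "B = {X. dirichlet_character q X \<and> X \<noteq> principal_character q \<and> (\<lambda>n. X n * X n) = principal_character q}"
    define Z where "Z = (\<lambda>X. cmod (deriv (dirichlet_L X) 1 / dirichlet_L X 1) ^ (2 * k))"
    define P where "P = (\<lambda>X. norm (dpoly (mangoldt_trunc q) q X) ^ (2 * k))"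
    have "finite {X. dirichlet_character q X}" by (rule finite_dirichlet_characters[OF q0])
    hence fin: "finite A" "finite B" unfolding A_def B_def by (auto intro: finite_subset[rotated])
    have AB: "{X. dirichlet_character q X \<and> X \<noteq> principal_character q} = A \<union> B" "A \<inter> B = {}"
      by (auto simp: A_def B_def)
    have split: "sum f (A \<union> B) = sum f A + sum f B" for f :: "_ \<Rightarrow> real"
      by (rule sum.union_disjoint[OF fin AB(2)])
    define R where "R = l ^ (18 * k + 11) * sqrt (real q)"
    have le_R: "c * l ^ i * sqrt (real q) \<le> c * R" if "c \<ge> 0" "i \<le> 18 * k + 11" for c i
      unfolding R_def mult.assoc using l that by (intro mult_left_mono mult_right_mono power_increasing) auto
    \<comment> \<open>On each of the two classes of characters \<open>Z\<close> is exchanged for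
      \<open>P\<close>; the full sum of \<open>P\<close> is then compared with the main
      term.\<close>
    have "\<bar>sum Z (A \<union> B) - (real q - 2) * S\<bar> =
        \<bar>(\<Sum>X\<in>A. Z X - P X) + (\<Sum>X\<in>B. Z X - P X) + (sum P (A \<union> B) - (real q - 2) * S)\<bar>"
      unfolding split by (simp add: sum_subtractf)
    also have "\<dots> \<le> (\<Sum>X\<in>A. \<bar>Z X - P X\<bar>) + (\<Sum>X\<in>B. \<bar>Z X - P X\<bar>) + \<bar>sum P (A \<union> B) - (real q - 2) * S\<bar>"
      by (intro order_trans[OF abs_triangle_ineq] add_mono sum_abs order.refl)
    also have "\<dots> \<le> C1 * R + C2 * R + C3 * R"
    proof (intro add_mono)
      show "(\<Sum>X\<in>A. \<bar>Z X - P X\<bar>) \<le> C1 * R"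
        using complex[OF q] le_R[OF C1, of "18 * k + 11"] unfolding A_def Z_def P_def l_def by linarith
      show "(\<Sum>X\<in>B. \<bar>Z X - P X\<bar>) \<le> C2 * R"
        using real[OF q] le_R[OF C2, of "4 * k"] unfolding B_def Z_def P_def l_def by simp
      show "\<bar>sum P (A \<union> B) - (real q - 2) * S\<bar> \<le> C3 * R"
        using poly[OF q] le_R[OF C3, of "4 * k + 2"] unfolding AB(1) [symmetric] P_def S_def l_def by simp
    qed
    also have "\<dots> = (C1 + C2 + C3) * R" by (simp add: algebra_simps)
    also have "\<dots> \<le> (C1 + C2 + C3) * (K * real q powr (9/10 + \<epsilon>))"
    proof (rule mult_left_mono)
      have "R \<le> K * real q powr (2/5) * real q powr (1/2)"
        unfolding R_def l_def using K(2)[of "real q"] K(1) q1 by (intro mult_mono) (auto simp: powr_half_sqrt)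
      also have "\<dots> = K * real q powr (9/10)" by (simp add: mult.assoc flip: powr_add)
      also have "\<dots> \<le> K * real q powr (9/10 + \<epsilon>)"
        using K(1) q1 assms by (intro mult_left_mono powr_mono) auto
      finally show "R \<le> K * real q powr (9/10 + \<epsilon>)" .
    qed (use C1 C2 C3 in auto)
    finally show "\<bar>(\<Sum>X | dirichlet_character q X \<and> X \<noteq> principal_character q.
        cmod (deriv (dirichlet_L X) 1 / dirichlet_L X 1) ^ (2 * k))
      - (real q - 2) * (\<Sum>\<^sub>\<infinity>m\<in>{1..}. (mangoldt_conv k m)\<^sup>2 / real m ^ 2)\<bar>
      \<le> (C1 + C2 + C3) * K * real q powr (9/10 + \<epsilon>)"
      unfolding AB(1) Z_def S_def by (simp add: mult.assoc)
  qed
qed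


end
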